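(* Let $D\subset L^2(T)$ be an identifiable sub-space with $\dim D=d<\infty$, let $E=\pi(D)\subseteq S$ be its orthogonal projection on $S$, let $F=S\cap E^{\perp}$, and decompose $\beta=\beta^E+\beta^F+\beta^{S^\perp}$ along the orthogonal sum $L^2(T)=E\oplus F\oplus S^{\perp}$. Let $\{\varphi^E_1,\dots,\varphi^E_d\}$ be an orthonormal basis of $E$, let $X^E$ be the $n\times d$ matrix with entries $[X^E]_{ij}=\langle x_i,\varphi^E_j\rangle$, and let $\boldsymbol{\beta^E}\in\mathbb{R}^d$ be the coordinate vector of $\beta^E$ in this basis. Let $\widehat\beta^E_n=\arg\min_{b\in E}\sum_{i=1}^n(y_i-\langle x_i,b\rangle)^2$ be the least square estimator in $E$, with coordinate vector $\boldsymbol{\widehat\beta^E_n}=((X^E)^TX^E)^{-1}(X^E)^T(y_1,\dots,y_n)^T\in\mathbb{R}^d$ (well defined whenever $(X^E)^TX^E$ is invertible). (1) Conditionally on the data $\mathbf{x}=(x_1,\dots,x_n)$, $$\mathbb{E}[\boldsymbol{\widehat\beta^E_n}\mid \mathbf{x}]=\boldsymbol{\beta^E}+\boldsymbol{\gamma_n},\qquad \mathrm{Cov}(\boldsymbol{\widehat\beta^E_n}\mid\mathbf{x})=\sigma^2\left((X^E)^TX^E\right)^{-1},$$ where $\boldsymbol{\gamma_n}=((X^E)^TX^E)^{-1}(X^E)^T\left(\langle x_1,\beta^F\rangle,\dots,\langle x_n,\beta^F\rangle\right)^T$. (2) As $n\to\infty$, almost surely $$\boldsymbol{\gamma_n}\to\boldsymbol{\gamma}:=\left(\mathbb{E}[\mathbf{X}^E(\mathbf{X}^E)^T]\right)^{-1}\mathbb{E}[\mathbf{X}^E\langle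 X,\beta^F\rangle],\qquad \mathbf{X}^E:=(\langle X,\varphi^E_1\rangle,\dots,\langle X,\varphi^E_d\rangle)^T,$$ and $\boldsymbol{\widehat\beta^E_n}\to\boldsymbol{\beta^E}+\boldsymbol{\gamma}$; equivalently, writing $\gamma=\sum_{k=1}^d\boldsymbol{\gamma}_k\varphi^E_k\in E$, $$\widehat\beta^E_n\to\beta^E+\gamma\quad\text{almost surely}.$$
   Context: $T\subset\mathbb{R}$ is compact, $\langle a,b\rangle=\int_T a(t)b(t)\,dt$ is the inner product of $L^2(T)$ and $\|\cdot\|$ its norm. The model is $y_i=\langle x_i,\beta\rangle+\epsilon_i$, $i=1,\dots,n$, where $\beta\in L^2(T)$ is deterministic, $x_1,\dots,x_n$ are i.i.d. realizations of an $L^2(T)$-valued process $X$ with $\mathbb{E}[X]=0$ and $\mathbb{E}\|X\|^2<\infty$, and $\epsilon_1,\dots,\epsilon_n$ are real random variables independent of $x_1,\dots,x_n$, with $\mathbb{E}[\epsilon_i]=0$ and $\mathrm{Var}[\epsilon_i]=\sigma^2>0$. $S$ is the smallest closed linear sub-space of $L^2(T)$ containing the support of $X$; $S^\perp$ is its orthogonal complement. A linear sub-space $D$ is called identifiable if $D\cap S^\perp=\{0\}$. $\pi$ denotes the restriction to $D$ of the orthogonal projection of $L^2(T)$ onto $S$.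
   Formalization: The covariance formula in (1) is stated under the additional assumption that the errors are pairwise uncorrelated, E[ε_i ε_j]=0 for i≠j; without it the formula fails, e.g. when ε_1=ε_2. *)

theory Defs
  imports "HOL-Probability.Probability" "Jordan_Normal_Form.Gauss_Jordan_Elimination"
begin

subsection \<open>The Hilbert space of square integrable functions on the line\<close>

definition square_integrable :: "(real \<Rightarrow> real) \<Rightarrow> bool" where
  "square_integrable f \<longleftrightarrow> f \<in> borel_measurable lborel \<and> integrable lborel (\<lambda>t. (f t)\<^sup>2)"

lemma square_integrable_measurable: "square_integrable f \<Longrightarrow> f \<in> borel_measurable borel"
  by (simp add: square_integrable_def)

lemma square_integrable_zero: "square_integrable (\<lambda>_. 0)"
  by (simp add: square_integrable_def)

lemma square_integrable_bound:
  assumes "square_integrable w" "f \<in> borel_measurable borel" "AE t in lborel. \<bar>f t\<bar> \<le> \<bar>w t\<bar>"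
  shows "square_integrable f"
  unfolding square_integrable_def
proof
  show "integrable lborel (\<lambda>t. (f t)\<^sup>2)"
  proof (rule Bochner_Integration.integrable_bound)
    show "integrable lborel (\<lambda>t. (w t)\<^sup>2)" using assms(1) by (simp add: square_integrable_def)
    show "AE t in lborel. norm ((f t)\<^sup>2) \<le> norm ((w t)\<^sup>2)"
      using assms(3) by eventually_elim (simp add: abs_le_square_iff)
  qed (use assms(2) in measurable)
qed (use assms(2) in simp)

lemma square_integrable_mult_integrable:
  assumes "square_integrable f" "square_integrable g"
  shows "integrable lborel (\<lambda>t. f t * g t)"
proof (rule Bochner_Integration.integrable_bound)
  show "integrable lborel (\<lambda>t. (f t)\<^sup>2 + (g t)\<^sup>2)"
    using assms by (simp add: square_integrable_def)
  show "(\<lambda>t. f t * g t) \<in> borel_measurable lborel"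
    using assms by (auto simp: square_integrable_def)
  have "\<bar>a * b\<bar> \<le> a\<^sup>2 + b\<^sup>2" for a b :: real
  proof -
    have "2 * \<bar>a * b\<bar> \<le> a\<^sup>2 + b\<^sup>2"
      using zero_le_power2[of "\<bar>a\<bar> - \<bar>b\<bar>"] by (simp add: power2_diff abs_mult)
    then show ?thesis by linarith
  qed
  then show "AE t in lborel. norm (f t * g t) \<le> norm ((f t)\<^sup>2 + (g t)\<^sup>2)"
    by (auto simp: abs_of_nonneg)
qed

lemma square_integrable_add:
  assumes "square_integrable f" "square_integrable g"
  shows "square_integrable (\<lambda>t. f t + g t)"
proof -
  have "integrable lborel (\<lambda>t. (f t)\<^sup>2 + (g t)\<^sup>2 + 2 * (f t * g t))"
    using assms square_integrable_mult_integrable[OF assms] by (simp add: square_integrable_def)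
  moreover have "(\<lambda>t. (f t)\<^sup>2 + (g t)\<^sup>2 + 2 * (f t * g t)) = (\<lambda>t. (f t + g t)\<^sup>2)"
    by (auto simp: power2_sum algebra_simps)
  moreover have "(\<lambda>t. f t + g t) \<in> borel_measurable borel"
    using assms[THEN square_integrable_measurable] by measurable
  ultimately show ?thesis by (simp add: square_integrable_def)
qed

lemma square_integrable_scale:
  "square_integrable f \<Longrightarrow> square_integrable (\<lambda>t. c * f t)"
  by (auto simp: square_integrable_def power_mult_distrib)

lemma square_integrable_minus:
  "square_integrable f \<Longrightarrow> square_integrable (\<lambda>t. - f t)"
  using square_integrable_scale[of f "-1"] by simp

lemma square_integrable_diff:
  "square_integrable f \<Longrightarrow> square_integrable g \<Longrightarrow> square_integrable (\<lambda>t. f t - g t)"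
  using square_integrable_add[of f "\<lambda>t. - g t"] square_integrable_minus[of g] by simp

lemma AE_cong2:
  assumes "AE t in M. f t = f' t" "AE t in M. g t = g' t"
  shows "AE t in M. h (f t) (g t) = h (f' t) (g' t)"
  using assms by eventually_elim simp

text \<open>Elements of \<open>L2\<close> are almost-everywhere classes of square integrable functions on
  \<open>\<real>\<close>. For a set \<open>T\<close>, the space \<open>L\<^sup>2(T)\<close> is the subspace \<open>L2_on T\<close> below of classes of functions
  extended by zero outside \<open>T\<close>: this embedding is isometric, and it makes the type-class library
  for (separable) Hilbert spaces available.\<close>

quotient_type L2 = "real \<Rightarrow> real" / partial:
  "\<lambda>f g. square_integrable f \<and> square_integrable g \<and> (AE t in lborel. f t = g t)"
proof (rule part_equivpI)
  show "\<exists>f. square_integrable f \<and> square_integrable f \<and> (AE t in lborel. f t = f t)"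
    using square_integrable_zero by auto
  show "transp (\<lambda>f g. square_integrable f \<and> square_integrable g \<and> (AE t in lborel. f t = g t))"
    by (intro transpI) (elim conjE, intro conjI; (assumption | (elim AE_mp, simp)))
  show "symp (\<lambda>f g. square_integrable f \<and> square_integrable g \<and> (AE t in lborel. f t = g t))"
    by (intro sympI) (auto simp: eq_commute)
qed

instantiation L2 :: ab_group_add
begin

lift_definition zero_L2 :: L2 is "\<lambda>_. 0"
  by (simp add: square_integrable_zero)

lift_definition plus_L2 :: "L2 \<Rightarrow> L2 \<Rightarrow> L2" is "\<lambda>f g t. f t + g t"
  by (intro conjI square_integrable_add AE_cong2[where h = "(+)"]) auto

lift_definition uminus_L2 :: "L2 \<Rightarrow> L2" is "\<lambda>f t. - f t"
  by (auto intro: square_integrable_minus)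

lift_definition minus_L2 :: "L2 \<Rightarrow> L2 \<Rightarrow> L2" is "\<lambda>f g t. f t - g t"
  by (intro conjI square_integrable_diff AE_cong2[where h = "(-)"]) auto

instance
proof
  fix a b c :: L2
  show "a + b + c = a + (b + c)"
    by transfer (auto intro!: square_integrable_add simp: algebra_simps)
  show "a + b = b + a"
    by transfer (auto intro!: square_integrable_add simp: algebra_simps)
  show "0 + a = a"
    by transfer auto
  show "- a + a = 0"
    by transfer (auto simp: square_integrable_zero)
  show "a - b = a + - b"
    by transfer (auto intro!: square_integrable_diff)
qed

end

instantiation L2 :: real_inner
begin

lift_definition scaleR_L2 :: "real \<Rightarrow> L2 \<Rightarrow> L2" is "\<lambda>c f t. c * f t"
  by (auto intro: square_integrable_scale)

lift_definition inner_L2 :: "L2 \<Rightarrow> L2 \<Rightarrow> real" is "\<lambda>f g. LINT t|lborel. f t * g t"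
  by (intro integral_cong_AE AE_cong2[where h = "(*)"])
     (auto simp: square_integrable_def)

definition norm_L2 :: "L2 \<Rightarrow> real" where "norm_L2 a = sqrt (inner a a)"
definition sgn_L2 :: "L2 \<Rightarrow> L2" where "sgn_L2 a = inverse (norm a) *\<^sub>R a"
definition dist_L2 :: "L2 \<Rightarrow> L2 \<Rightarrow> real" where "dist_L2 a b = norm (a - b)"
definition uniformity_L2 :: "(L2 \<times> L2) filter" where
  "uniformity_L2 = (INF e\<in>{0<..}. principal {(x, y). dist x y < e})"
definition open_L2 :: "L2 set \<Rightarrow> bool" where
  "open_L2 U \<longleftrightarrow> (\<forall>x\<in>U. eventually (\<lambda>(x', y). x' = x \<longrightarrow> y \<in> U) uniformity)"

instance
proof
  fix a b c :: L2 and r s :: real and U :: "L2 set"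
  show "r *\<^sub>R (a + b) = r *\<^sub>R a + r *\<^sub>R b"
    by transfer (auto intro!: square_integrable_add square_integrable_scale simp: algebra_simps)
  show "(r + s) *\<^sub>R a = r *\<^sub>R a + s *\<^sub>R a"
    by transfer (auto intro!: square_integrable_add square_integrable_scale simp: algebra_simps)
  show "r *\<^sub>R s *\<^sub>R a = (r * s) *\<^sub>R a"
    by transfer (auto intro!: square_integrable_scale simp: algebra_simps)
  show "1 *\<^sub>R a = a"
    by transfer auto
  show "sgn a = inverse (norm a) *\<^sub>R a" by (rule sgn_L2_def)
  show "dist a b = norm (a - b)" by (rule dist_L2_def)
  show "uniformity = (INF e\<in>{0<..}. principal {(x, y :: L2). dist x y < e})"
    by (rule uniformity_L2_def)
  show "open U \<longleftrightarrow> (\<forall>x\<in>U. eventually (\<lambda>(x', y). x' = x \<longrightarrow> y \<in> U) uniformity)"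
    by (rule open_L2_def)
  show "inner a b = inner b a"
    by transfer (simp add: mult.commute)
  show "inner (a + b) c = inner a c + inner b c"
    by transfer (simp add: distrib_right square_integrable_mult_integrable)
  show "inner (r *\<^sub>R a) b = r * inner a b"
    by transfer (simp add: mult.assoc square_integrable_mult_integrable)
  show "0 \<le> inner a a"
    by transfer simp
  show "inner a a = 0 \<longleftrightarrow> a = 0"
  proof transfer
    fix f assume "square_integrable f \<and> square_integrable f \<and> (AE t in lborel. f t = f t)"
    then have f: "square_integrable f" by simp
    have "(LINT t|lborel. f t * f t) = 0 \<longleftrightarrow> (AE t in lborel. f t * f t = 0)"
      by (rule integral_nonneg_eq_0_iff_AE) (auto intro: square_integrable_mult_integrable f)
    then show "((LINT t|lborel. f t * f t) = 0) =
      (square_integrable f \<and> square_integrable (\<lambda>_. 0) \<and> (AE t in lborel. f t = 0))"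
      using f by (simp add: square_integrable_zero)
  qed
  show "norm a = sqrt (inner a a)" by (rule norm_L2_def)
qed

end

lemma square_integrable_rep_L2: "square_integrable (rep_L2 a)"
  using Quotient_rep_reflp[OF Quotient_L2] by auto

lemma abs_rep_L2: "abs_L2 (rep_L2 a) = a"
  using Quotient_abs_rep[OF Quotient_L2] .

lemma inner_abs_L2:
  "square_integrable f \<Longrightarrow> square_integrable g \<Longrightarrow>
    inner (abs_L2 f) (abs_L2 g) = (LINT t|lborel. f t * g t)"
  by (simp add: inner_L2.abs_eq)

lemma norm_abs_L2:
  "square_integrable f \<Longrightarrow> (norm (abs_L2 f))\<^sup>2 = (LINT t|lborel. (f t)\<^sup>2)"
  by (simp only: power2_norm_eq_inner inner_abs_L2) (simp add: power2_eq_square)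

lemma nn_integral_abs_L2:
  "square_integrable f \<Longrightarrow> (\<integral>\<^sup>+t. ennreal ((f t)\<^sup>2) \<partial>lborel) = ennreal ((norm (abs_L2 f))\<^sup>2)"
  by (simp add: norm_abs_L2 nn_integral_eq_integral square_integrable_def)

lemma diff_abs_L2:
  "square_integrable f \<Longrightarrow> square_integrable g \<Longrightarrow> abs_L2 f - abs_L2 g = abs_L2 (\<lambda>t. f t - g t)"
  by (simp add: minus_L2.abs_eq)

lemma add_abs_L2:
  "square_integrable f \<Longrightarrow> square_integrable g \<Longrightarrow> abs_L2 f + abs_L2 g = abs_L2 (\<lambda>t. f t + g t)"
  by (simp add: plus_L2.abs_eq)

lemma scaleR_abs_L2:
  "square_integrable f \<Longrightarrow> c *\<^sub>R abs_L2 f = abs_L2 (\<lambda>t. c * f t)"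
  by (simp add: scaleR_L2.abs_eq)

lemma zero_abs_L2: "abs_L2 (\<lambda>t. 0) = 0"
  by (simp add: zero_L2_def)

lemma rapid_Cauchy_convergent:
  fixes u :: "nat \<Rightarrow> real"
  assumes "(\<Sum>k. ennreal (4 ^ k * (u (Suc k) - u k)\<^sup>2)) \<noteq> \<infinity>"
  shows "convergent u"
proof -
  have "summable (\<lambda>k. 4 ^ k * (u (Suc k) - u k)\<^sup>2)"
    using assms by (intro summable_suminf_not_top) auto
  then have "(\<lambda>k. 4 ^ k * (u (Suc k) - u k)\<^sup>2) \<longlonglongrightarrow> 0"
    by (rule summable_LIMSEQ_zero)
  then have "\<forall>\<^sub>F k in sequentially. 4 ^ k * (u (Suc k) - u k)\<^sup>2 < 1"
    by (rule order_tendstoD) simp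
  then have "\<forall>\<^sub>F k in sequentially. norm (u (Suc k) - u k) \<le> (1/2) ^ k"
  proof eventually_elim
    case (elim k)
    have "(4::real) ^ k = (2\<^sup>2) ^ k" by simp
    also have "\<dots> = (2 ^ k)\<^sup>2" by (simp only: power_mult[symmetric] mult.commute)
    finally have "(4::real) ^ k = (2 ^ k)\<^sup>2" .
    then have "(2 ^ k * (u (Suc k) - u k))\<^sup>2 \<le> 1\<^sup>2"
      using elim by (simp add: power_mult_distrib)
    then have "\<bar>2 ^ k * (u (Suc k) - u k)\<bar> \<le> 1"
      by (metis abs_le_square_iff abs_one)
    then have "2 ^ k * \<bar>u (Suc k) - u k\<bar> \<le> 1"
      by (simp only: abs_mult power_abs abs_numeral)
    then have "\<bar>u (Suc k) - u k\<bar> \<le> 1 / 2 ^ k"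
      by (simp only: pos_le_divide_eq zero_less_power zero_less_numeral mult.commute)
    then show ?case
      by (simp only: real_norm_def power_one_over)
  qed
  then have "summable (\<lambda>k. u (Suc k) - u k)"
    by (rule summable_comparison_test_ev) (simp add: summable_geometric)
  then have "convergent (\<lambda>n. \<Sum>k<n. u (Suc k) - u k)"
    by (simp add: summable_iff_convergent)
  then have "convergent (\<lambda>n. u n - u 0)"
    by (simp add: sum_lessThan_telescope)
  then show ?thesis
    using convergent_add[OF _ convergent_const, of "\<lambda>n. u n - u 0" "u 0"] by simp
qed

lemma quarter_power2: "((1/4 :: real) ^ k)\<^sup>2 = (1/16) ^ k"
proof -
  have "((1/4 :: real) ^ k)\<^sup>2 = ((1/4)\<^sup>2) ^ k"
    by (simp only: power_mult[symmetric] mult.commute)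
  then show ?thesis by (simp add: power_divide)
qed

lemma L2_Cauchy_convergent:
  fixes X :: "nat \<Rightarrow> L2"
  assumes "Cauchy X"
  shows "convergent X"
proof -
  have "\<forall>k. \<exists>N. \<forall>m\<ge>N. \<forall>n\<ge>N. norm (X m - X n) < (1/4) ^ k"
    using assms by (simp add: Cauchy_iff)
  then obtain N where N: "\<And>k m n. m \<ge> N k \<Longrightarrow> n \<ge> N k \<Longrightarrow> norm (X m - X n) < (1/4) ^ k"
    by metis
  define r where "r k = Max (N ` {..k})" for k
  have r_ge: "N k \<le> r m" if "k \<le> m" for k m
    unfolding r_def using that by (intro Max_ge) auto
  define f where "f k = rep_L2 (X (r k))" for k
  have f_sq: "square_integrable (f k)" for k
    unfolding f_def by (rule square_integrable_rep_L2)
  have f_meas [measurable]: "f k \<in> borel_measurable borel" for k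
    by (rule square_integrable_measurable[OF f_sq])
  have f_diff: "square_integrable (\<lambda>t. f m t - f k t)" for m k
    by (rule square_integrable_diff[OF f_sq f_sq])
  have f_nn: "(\<integral>\<^sup>+t. ennreal ((f m t - f k t)\<^sup>2) \<partial>lborel) \<le> ennreal ((1/16) ^ k)"
    if "k \<le> m" for m k
  proof -
    have "abs_L2 (\<lambda>t. f m t - f k t) = X (r m) - X (r k)"
      using diff_abs_L2[OF f_sq f_sq, of m k] by (simp add: f_def abs_rep_L2)
    then have "norm (abs_L2 (\<lambda>t. f m t - f k t)) \<le> (1/4) ^ k"
      using N[OF r_ge[OF that] r_ge[OF order_refl]] by simp
    then have "(norm (abs_L2 (\<lambda>t. f m t - f k t)))\<^sup>2 \<le> ((1/4) ^ k)\<^sup>2"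
      by (intro power_mono) auto
    also have "\<dots> = (1/16) ^ k"
      by (rule quarter_power2)
    finally show ?thesis
      using nn_integral_abs_L2[OF f_diff[of m k]] by (simp add: ennreal_leI)
  qed
  have "AE t in lborel. (\<Sum>k. ennreal (4 ^ k * (f (Suc k) t - f k t)\<^sup>2)) \<noteq> \<infinity>"
  proof (rule nn_integral_PInf_AE)
    have "(\<integral>\<^sup>+t. (\<Sum>k. ennreal (4 ^ k * (f (Suc k) t - f k t)\<^sup>2)) \<partial>lborel)
        = (\<Sum>k. \<integral>\<^sup>+t. ennreal (4 ^ k * (f (Suc k) t - f k t)\<^sup>2) \<partial>lborel)"
      by (rule nn_integral_suminf) measurable
    also have "\<dots> = (\<Sum>k. ennreal (4 ^ k) * (\<integral>\<^sup>+t. ennreal ((f (Suc k) t - f k t)\<^sup>2) \<partial>lborel))"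
      by (intro suminf_cong) (simp add: ennreal_mult nn_integral_cmult)
    also have "\<dots> \<le> (\<Sum>k. ennreal ((1/4) ^ k))"
    proof (intro suminf_le summableI)
      fix k
      have "ennreal (4 ^ k) * (\<integral>\<^sup>+t. ennreal ((f (Suc k) t - f k t)\<^sup>2) \<partial>lborel)
          \<le> ennreal (4 ^ k) * ennreal ((1/16) ^ k)"
        by (intro mult_left_mono f_nn) auto
      also have "\<dots> = ennreal (4 ^ k * (1/16) ^ k)"
        by (simp add: ennreal_mult)
      also have "(4::real) ^ k * (1/16) ^ k = (1/4) ^ k"
        by (simp only: power_mult_distrib[symmetric]) simp
      finally show "ennreal (4 ^ k) * (\<integral>\<^sup>+t. ennreal ((f (Suc k) t - f k t)\<^sup>2) \<partial>lborel)
          \<le> ennreal ((1/4) ^ k)" .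
    qed
    also have "\<dots> < \<infinity>"
    proof -
      have "(\<Sum>k. ennreal ((1/4) ^ k)) = ennreal (\<Sum>k. (1/4) ^ k)"
        by (rule suminf_ennreal2) (simp_all add: summable_geometric)
      then show ?thesis by (simp only: ennreal_less_top infinity_ennreal_def)
    qed
    finally show "(\<integral>\<^sup>+t. (\<Sum>k. ennreal (4 ^ k * (f (Suc k) t - f k t)\<^sup>2)) \<partial>lborel) \<noteq> \<infinity>"
      by simp
  qed measurable
  then have conv: "AE t in lborel. convergent (\<lambda>k. f k t)"
    by eventually_elim (rule rapid_Cauchy_convergent)
  define g where "g t = lim (\<lambda>k. f k t)" for t
  have g_meas [measurable]: "g \<in> borel_measurable borel"
    unfolding g_def by (rule borel_measurable_lim_metric) measurable
  have g_nn: "(\<integral>\<^sup>+t. ennreal ((g t - f k t)\<^sup>2) \<partial>lborel) \<le> ennreal ((1/16) ^ k)" for k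
  proof -
    have "AE t in lborel. ennreal ((g t - f k t)\<^sup>2) = liminf (\<lambda>m. ennreal ((f m t - f k t)\<^sup>2))"
      using conv
    proof eventually_elim
      case (elim t)
      then have "(\<lambda>m. f m t) \<longlonglongrightarrow> g t"
        by (simp add: g_def convergent_LIMSEQ_iff)
      then have "(\<lambda>m. ennreal ((f m t - f k t)\<^sup>2)) \<longlonglongrightarrow> ennreal ((g t - f k t)\<^sup>2)"
        by (intro tendsto_ennrealI tendsto_intros)
      then show ?case
        by (intro lim_imp_Liminf[symmetric]) auto
    qed
    then have "(\<integral>\<^sup>+t. ennreal ((g t - f k t)\<^sup>2) \<partial>lborel)
        = (\<integral>\<^sup>+t. liminf (\<lambda>m. ennreal ((f m t - f k t)\<^sup>2)) \<partial>lborel)"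
      by (rule nn_integral_cong_AE)
    also have "\<dots> \<le> liminf (\<lambda>m. \<integral>\<^sup>+t. ennreal ((f m t - f k t)\<^sup>2) \<partial>lborel)"
      by (rule nn_integral_liminf) measurable
    also have "\<dots> \<le> ennreal ((1/16) ^ k)"
    proof (rule Liminf_le)
      show "\<forall>\<^sub>F m in sequentially. (\<integral>\<^sup>+t. ennreal ((f m t - f k t)\<^sup>2) \<partial>lborel) \<le> ennreal ((1/16) ^ k)"
        using eventually_ge_at_top[of k] by eventually_elim (rule f_nn)
    qed simp
    finally show ?thesis .
  qed
  have gf_sq: "square_integrable (\<lambda>t. g t - f k t)" for k
    unfolding square_integrable_def
  proof
    show "integrable lborel (\<lambda>t. (g t - f k t)\<^sup>2)"
    proof (rule integrableI_nonneg)
      show "(\<integral>\<^sup>+t. ennreal ((g t - f k t)\<^sup>2) \<partial>lborel) < \<infinity>"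
        by (rule le_less_trans[OF g_nn]) simp
    qed auto
  qed measurable
  have g_sq: "square_integrable g"
    using square_integrable_add[OF gf_sq f_sq, of 0 0] by simp
  have gY: "norm (abs_L2 g - X (r k)) \<le> (1/4) ^ k" for k
  proof -
    have eq: "abs_L2 g - X (r k) = abs_L2 (\<lambda>t. g t - f k t)"
      using diff_abs_L2[OF g_sq f_sq, of k] by (simp add: f_def abs_rep_L2)
    have "(norm (abs_L2 (\<lambda>t. g t - f k t)))\<^sup>2 \<le> (1/16) ^ k"
      using g_nn[of k] nn_integral_abs_L2[OF gf_sq[of k]] by (simp add: ennreal_le_iff)
    also have "(1/16) ^ k = ((1/4 :: real) ^ k)\<^sup>2"
      by (rule quarter_power2[symmetric])
    finally show ?thesis
      unfolding eq by (rule power2_le_imp_le) simp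
  qed
  have "X \<longlonglongrightarrow> abs_L2 g"
  proof (rule LIMSEQ_I)
    fix e :: real assume "0 < e"
    then obtain k where k: "(1/4) ^ k < e / 2"
      using real_arch_pow_inv[of "e/2" "1/4"] by auto
    have "norm (X n - abs_L2 g) < e" if "n \<ge> N k" for n
    proof -
      have "norm (X n - abs_L2 g) \<le> norm (X n - X (r k)) + norm (X (r k) - abs_L2 g)"
        by (rule order_trans[OF _ norm_triangle_ineq]) simp
      also have "norm (X (r k) - abs_L2 g) \<le> (1/4) ^ k"
        using gY[of k] by (simp add: norm_minus_commute)
      also have "norm (X n - X (r k)) < (1/4) ^ k"
        by (rule N[OF that r_ge]) simp
      finally show ?thesis using k by simp
    qed
    then show "\<exists>no. \<forall>n\<ge>no. norm (X n - abs_L2 g) < e" by auto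
  qed
  then show ?thesis by (auto simp: convergent_def)
qed

instance L2 :: complete_space
  by standard (rule L2_Cauchy_convergent)

instance L2 :: banach ..

lemma tendsto_abs_L2_dominated:
  assumes w: "square_integrable w"
    and f [measurable]: "\<And>k. f k \<in> borel_measurable borel" and g [measurable]: "g \<in> borel_measurable borel"
    and bound: "\<And>k. AE t in lborel. \<bar>f k t\<bar> \<le> \<bar>w t\<bar>"
    and lim: "AE t in lborel. (\<lambda>k::nat. f k t) \<longlonglongrightarrow> g t"
  shows "square_integrable (f k)" and "square_integrable g"
    and "(\<lambda>k. abs_L2 (f k)) \<longlonglongrightarrow> abs_L2 g"
proof -
  show f_sq: "square_integrable (f k)" for k
    by (rule square_integrable_bound[OF w f bound])
  have bound_all: "AE t in lborel. \<forall>k. \<bar>f k t\<bar> \<le> \<bar>w t\<bar>"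
    using bound by (simp add: AE_all_countable)
  have g_bound: "AE t in lborel. \<bar>g t\<bar> \<le> \<bar>w t\<bar>"
    using bound_all lim
  proof eventually_elim
    case (elim t)
    show ?case
      by (rule LIMSEQ_le_const2[OF tendsto_rabs[OF elim(2)]]) (use elim(1) in blast)
  qed
  show g_sq: "square_integrable g"
    by (rule square_integrable_bound[OF w g g_bound])
  have w_meas [measurable]: "w \<in> borel_measurable borel"
    by (rule square_integrable_measurable[OF w])
  have "(\<lambda>k. LINT t|lborel. (f k t - g t)\<^sup>2) \<longlonglongrightarrow> (LINT t::real|lborel. 0)"
  proof (rule integral_dominated_convergence)
    show "integrable lborel (\<lambda>t. (2 * w t)\<^sup>2)"
      using square_integrable_scale[OF w, of 2] by (simp add: square_integrable_def)
    show "AE t in lborel. (\<lambda>k. (f k t - g t)\<^sup>2) \<longlonglongrightarrow> 0"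
      using lim
    proof eventually_elim
      case (elim t)
      then have "(\<lambda>k. (f k t - g t)\<^sup>2) \<longlonglongrightarrow> (g t - g t)\<^sup>2"
        by (intro tendsto_intros)
      then show ?case by simp
    qed
    show "AE t in lborel. norm ((f k t - g t)\<^sup>2) \<le> (2 * w t)\<^sup>2" for k
      using bound[of k] g_bound
    proof eventually_elim
      case (elim t)
      then have "\<bar>f k t - g t\<bar> \<le> \<bar>2 * w t\<bar>" by linarith
      then show ?case by (simp only: abs_le_square_iff real_norm_def abs_power2)
    qed
  qed measurable
  then have "(\<lambda>k. sqrt ((norm (abs_L2 (f k) - abs_L2 g))\<^sup>2)) \<longlonglongrightarrow> sqrt 0"
    by (intro tendsto_intros)
       (simp add: diff_abs_L2[OF f_sq g_sq] norm_abs_L2[OF square_integrable_diff[OF f_sq g_sq]])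
  then have "(\<lambda>k. norm (abs_L2 (f k) - abs_L2 g)) \<longlonglongrightarrow> 0"
    by simp
  then show "(\<lambda>k. abs_L2 (f k)) \<longlonglongrightarrow> abs_L2 g"
    by (simp add: LIM_zero_iff tendsto_norm_zero_iff)
qed

lemma square_integrable_indicator_Ioc: "square_integrable (indicator {a<..b})"
proof -
  have "(\<lambda>t::real. (indicator {a<..b} t :: real)\<^sup>2) = indicator {a<..b}"
    by (auto simp: indicator_def)
  moreover have "integrable lborel (indicator {a<..b} :: real \<Rightarrow> real)"
    by (rule integrable_real_indicator) (cases "a \<le> b"; simp)+
  ultimately show ?thesis
    by (simp add: square_integrable_def)
qed

lemma square_integrable_indicator_Int_Ioc:
  assumes [measurable]: "A \<in> sets borel"
  shows "square_integrable (indicator (A \<inter> {a<..b}))"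
  by (rule square_integrable_bound[OF square_integrable_indicator_Ioc[of a b]])
     (auto simp: indicator_def)

lemma closed_subspace_indicator:
  fixes V :: "L2 set"
  assumes V: "subspace V" "closed V"
    and Ioc: "\<And>a b. abs_L2 (indicator {a<..b}) \<in> V"
    and A: "A \<in> sets borel"
  shows "abs_L2 (indicator (A \<inter> {a<..b})) \<in> V"
proof -
  have "Int_stable (range (\<lambda>(a, b). {a<..b::real}))"
  proof (rule Int_stableI_image)
    show "\<exists>k\<in>UNIV. (case i of (a, b) \<Rightarrow> {a<..b}) \<inter> (case j of (a, b) \<Rightarrow> {a<..b})
        = (case k of (a, b) \<Rightarrow> {a<..b::real})" for i j
      by (rule bexI[of _ "(max (fst i) (fst j), min (snd i) (snd j))"])
         (simp_all add: case_prod_beta Int_greaterThanAtMost)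
  qed
  moreover have "range (\<lambda>(a, b). {a<..b::real}) \<subseteq> Pow UNIV" by simp
  moreover have borel_eq: "sets borel = sigma_sets UNIV (range (\<lambda>(a, b). {a<..b::real}))"
    by (subst borel_sigma_sets_Ioc) (simp add: sets_measure_of)
  then have "A \<in> sigma_sets UNIV (range (\<lambda>(a, b). {a<..b::real}))"
    using A by simp
  ultimately show ?thesis
  proof (induction rule: sigma_sets_induct_disjoint)
    case (basic A)
    then obtain c d where "A = {c<..d}" by auto
    then show ?case using Ioc[of "max c a" "min d b"] by (simp only: Int_greaterThanAtMost)
  next
    case empty
    have "(indicator ({} \<inter> {a<..b}) :: real \<Rightarrow> real) = (\<lambda>t. 0)" by auto
    then show ?case using V(1) by (simp add: zero_abs_L2 subspace_0)
  next
    case (compl A)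
    then have A: "A \<in> sets borel" using borel_eq by simp
    have "(indicator ((UNIV - A) \<inter> {a<..b}) :: real \<Rightarrow> real)
        = (\<lambda>t. indicator {a<..b} t - indicator (A \<inter> {a<..b}) t)"
      by (rule ext) (auto split: split_indicator)
    then have "abs_L2 (indicator ((UNIV - A) \<inter> {a<..b}))
        = abs_L2 (indicator {a<..b}) - abs_L2 (indicator (A \<inter> {a<..b}))"
      by (simp add: diff_abs_L2 square_integrable_indicator_Ioc square_integrable_indicator_Int_Ioc[OF A])
    then show ?case using compl Ioc V(1) by (simp add: subspace_diff)
  next
    case (union A)
    then have A: "A i \<in> sets borel" for i using borel_eq by auto
    let ?I = "{a<..b}"
    let ?f = "\<lambda>k t. \<Sum>i<k. indicator (A i \<inter> ?I) t :: real"
    have f_eq: "?f k = indicator ((\<Union>i<k. A i) \<inter> ?I)" for k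
    proof
      fix t
      have "disjoint_family_on (\<lambda>i. A i \<inter> ?I) {..<k}"
        using union(1) by (auto simp: disjoint_family_on_def)
      then have "indicator (\<Union>i<k. A i \<inter> ?I) t = ?f k t"
        by (rule indicator_UN_disjoint[rotated]) simp
      then show "?f k t = indicator ((\<Union>i<k. A i) \<inter> ?I) t"
        by simp
    qed
    have f_V: "square_integrable (?f k) \<and> abs_L2 (?f k) \<in> V" for k
    proof (induction k)
      case 0
      then show ?case using V(1) by (simp add: zero_abs_L2 subspace_0 square_integrable_zero)
    next
      case (Suc k)
      have "abs_L2 (?f (Suc k)) = abs_L2 (?f k) + abs_L2 (indicator (A k \<inter> ?I))"
        using Suc by (simp add: add_abs_L2 square_integrable_indicator_Int_Ioc[OF A])
      moreover have "square_integrable (?f (Suc k))"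
        using square_integrable_add[OF _ square_integrable_indicator_Int_Ioc[OF A], of "?f k" k a b] Suc
        by simp
      ultimately show ?case
        using Suc union(3)[of k] V(1) by (simp add: subspace_add)
    qed
    have "(\<lambda>k. abs_L2 (indicator ((\<Union>i<k. A i) \<inter> ?I))) \<longlonglongrightarrow> abs_L2 (indicator ((\<Union>i. A i) \<inter> ?I))"
    proof (rule tendsto_abs_L2_dominated(3)[OF square_integrable_indicator_Ioc[of a b]])
      show "(indicator ((\<Union>i<k. A i) \<inter> ?I) :: real \<Rightarrow> real) \<in> borel_measurable borel" for k
        using A by (intro borel_measurable_indicator) auto
      show "(indicator ((\<Union>i. A i) \<inter> ?I) :: real \<Rightarrow> real) \<in> borel_measurable borel"
        using A by (intro borel_measurable_indicator) auto
      show "AE t in lborel. \<bar>indicator ((\<Union>i<k. A i) \<inter> ?I) t :: real\<bar> \<le> \<bar>indicator ?I t\<bar>" for k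
        by (rule AE_I2) (simp split: split_indicator)
      have "(\<lambda>k. indicator (\<Union>i<k. A i \<inter> ?I) t :: real) \<longlonglongrightarrow> indicator (\<Union>i. A i \<inter> ?I) t" for t
        by (rule LIMSEQ_indicator_UN)
      then show "AE t in lborel. (\<lambda>k. indicator ((\<Union>i<k. A i) \<inter> ?I) t :: real)
          \<longlonglongrightarrow> indicator ((\<Union>i. A i) \<inter> ?I) t"
        by simp
    qed
    moreover have "abs_L2 (indicator ((\<Union>i<k. A i) \<inter> ?I)) \<in> V" for k
      using f_V[of k] by (simp only: f_eq)
    ultimately show ?case
      by (rule closed_sequentially[OF V(2), rotated])
  qed
qed

lemma closed_subspace_eq_UNIV:
  fixes V :: "L2 set"
  assumes V: "subspace V" "closed V"
    and Ioc: "\<And>a b. abs_L2 (indicator {a<..b}) \<in> V"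
  shows "h \<in> V"
proof -
  define f where "f = rep_L2 h"
  have f_sq: "square_integrable f" unfolding f_def by (rule square_integrable_rep_L2)
  have f_meas [measurable]: "f \<in> borel_measurable borel"
    by (rule square_integrable_measurable[OF f_sq])
  obtain s where s: "\<And>k. simple_function borel (s k)"
    and s_lim: "\<And>t. (\<lambda>k::nat. s k t) \<longlonglongrightarrow> f t"
    and s_bound: "\<And>k t. \<bar>s k t\<bar> \<le> 2 * \<bar>f t\<bar>"
    using borel_measurable_implies_sequence_metric[OF f_meas, of 0] by auto
  have s_meas [measurable]: "s k \<in> borel_measurable borel" for k
    by (rule borel_measurable_simple_function[OF s])
  let ?I = "\<lambda>k::nat. {- real k<..real k}"
  have s_V: "abs_L2 (\<lambda>t. s k t * indicator (?I k) t) \<in> V" for k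
  proof -
    have fin: "finite (range (s k))"
      using s[of k] by (simp add: simple_function_def)
    have level: "s k -` {y} \<in> sets borel" for y
      using measurable_sets[OF s_meas[of k], of "{y}"] by simp
    have eq: "(\<lambda>t. s k t * indicator (?I k) t)
        = (\<lambda>t. \<Sum>y\<in>range (s k). y * indicator (s k -` {y} \<inter> ?I k) t)"
    proof
      fix t
      have "(\<Sum>y\<in>range (s k). y * indicator (s k -` {y} \<inter> ?I k) t)
          = (\<Sum>y\<in>range (s k). if y = s k t then y * indicator (?I k) t else 0)"
        by (intro sum.cong) (auto simp: indicator_def)
      also have "\<dots> = s k t * indicator (?I k) t"
        using fin by (subst sum.delta) auto
      finally show "s k t * indicator (?I k) t
          = (\<Sum>y\<in>range (s k). y * indicator (s k -` {y} \<inter> ?I k) t)" ..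
    qed
    have "square_integrable (\<lambda>t. \<Sum>y\<in>Y. y * indicator (s k -` {y} \<inter> ?I k) t)
        \<and> abs_L2 (\<lambda>t. \<Sum>y\<in>Y. y * indicator (s k -` {y} \<inter> ?I k) t) \<in> V" if "finite Y" for Y
      using that
    proof induction
      case empty
      then show ?case using V(1) by (simp add: zero_abs_L2 subspace_0 square_integrable_zero)
    next
      case (insert y Y)
      let ?g = "\<lambda>t. \<Sum>y\<in>Y. y * indicator (s k -` {y} \<inter> ?I k) t"
      let ?i = "indicator (s k -` {y} \<inter> ?I k) :: real \<Rightarrow> real"
      have i_sq: "square_integrable ?i"
        by (rule square_integrable_indicator_Int_Ioc[OF level])
      have sum_eq: "(\<lambda>t. \<Sum>y\<in>insert y Y. y * indicator (s k -` {y} \<inter> ?I k) t) = (\<lambda>t. y * ?i t + ?g t)"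
        by (rule ext) (rule sum.insert[OF insert.hyps])
      have "abs_L2 (\<lambda>t. y * ?i t + ?g t) = y *\<^sub>R abs_L2 ?i + abs_L2 ?g"
        using insert.IH i_sq by (simp add: add_abs_L2 scaleR_abs_L2 square_integrable_scale)
      also have "\<dots> \<in> V"
        using insert.IH closed_subspace_indicator[OF V Ioc level] V(1)
        by (simp add: subspace_add subspace_scale)
      finally show ?case
        unfolding sum_eq using insert.IH i_sq by (auto intro!: square_integrable_add square_integrable_scale)
    qed
    from this[OF fin] show ?thesis by (simp only: eq)
  qed
  have "(\<lambda>k. abs_L2 (\<lambda>t. s k t * indicator (?I k) t)) \<longlonglongrightarrow> abs_L2 f"
  proof (rule tendsto_abs_L2_dominated(3)[OF square_integrable_scale[OF f_sq, of 2]])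
    show "AE t in lborel. \<bar>s k t * indicator (?I k) t\<bar> \<le> \<bar>2 * f t\<bar>" for k
      using s_bound[of k] by (auto simp: indicator_def abs_mult)
    have "(\<lambda>k. s k t * indicator (?I k) t) \<longlonglongrightarrow> f t" for t
    proof (rule Lim_transform_eventually[OF s_lim])
      show "\<forall>\<^sub>F k in sequentially. s k t = s k t * indicator (?I k) t"
        using eventually_gt_at_top[of "nat \<lceil>\<bar>t\<bar>\<rceil>"]
      proof eventually_elim
        case (elim k)
        then have "\<bar>t\<bar> < real k" by linarith
        then show ?case by (auto simp: indicator_def)
      qed
    qed
    then show "AE t in lborel. (\<lambda>k. s k t * indicator (?I k) t) \<longlonglongrightarrow> f t" by simp
  qed measurable
  then have "abs_L2 f \<in> V"
    by (rule closed_sequentially[OF V(2) s_V])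
  then show ?thesis by (simp add: f_def abs_rep_L2)
qed

lemma second_countable_dense:
  fixes D :: "'a::metric_space set"
  assumes "countable D" and dense: "\<And>x e. e > 0 \<Longrightarrow> \<exists>d\<in>D. dist d x < e"
  shows "\<exists>B::'a set set. countable B \<and> open = generate_topology B"
proof (intro exI conjI)
  let ?B = "(\<lambda>(d, n). ball d (1 / real (Suc n))) ` (D \<times> UNIV)"
  show "countable ?B" using assms(1) by auto
  have "topological_basis ?B"
  proof (rule topological_basisI)
    fix U :: "'a set" and x assume U: "open U" "x \<in> U"
    then obtain e where e: "e > 0" "ball x e \<subseteq> U" by (meson openE)
    obtain n where n: "1 / real (Suc n) < e / 2"
      using nat_approx_posE[of "e / 2"] e(1) by auto
    obtain d where d: "d \<in> D" "dist d x < 1 / real (Suc n)"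
      using dense[of "1 / real (Suc n)" x] by auto
    have "ball d (1 / real (Suc n)) \<subseteq> ball x e"
    proof
      fix y assume "y \<in> ball d (1 / real (Suc n))"
      then have "dist d y < 1 / real (Suc n)" by (simp only: mem_ball)
      then have "dist x y < e"
        using dist_triangle[of x y d] d(2) n by (simp only: dist_commute[of x d])
      then show "y \<in> ball x e" by (simp only: mem_ball)
    qed
    then have "ball d (1 / real (Suc n)) \<subseteq> U" "x \<in> ball d (1 / real (Suc n))"
      using e(2) d(2) by (auto simp only: mem_ball)
    then show "\<exists>B'\<in>?B. x \<in> B' \<and> B' \<subseteq> U"
      using d(1) by (intro bexI[of _ "ball d (1 / real (Suc n))"] conjI) (auto intro!: image_eqI[of _ _ "(d, n)"])
  qed auto
  then show "open = generate_topology ?B" by (rule topological_basis_imp_subbasis)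
qed

definition rat_step :: "(rat \<times> rat \<times> rat) list \<Rightarrow> L2" where
  "rat_step xs = (\<Sum>(c, a, b)\<leftarrow>xs. of_rat c *\<^sub>R abs_L2 (indicator {of_rat a<..of_rat b}))"

lemma rat_step_append: "rat_step (xs @ ys) = rat_step xs + rat_step ys"
  by (simp add: rat_step_def)

lemma rat_step_scale:
  "rat_step (map (\<lambda>(c, a, b). (q * c, a, b)) xs) = of_rat q *\<^sub>R rat_step xs"
  by (induction xs) (auto simp: rat_step_def of_rat_mult scaleR_right_distrib)

lemma real_rat_seq: "\<exists>q. (\<lambda>n::nat. real_of_rat (q n)) \<longlonglongrightarrow> x"
proof -
  have "\<exists>r. \<bar>real_of_rat r - x\<bar> \<le> 1 / real (Suc n)" for n
  proof -
    obtain r where "x < of_rat r" "of_rat r < x + 1 / real (Suc n)"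
      using of_rat_dense[of x "x + 1 / real (Suc n)"] by auto
    then show ?thesis by (intro exI[of _ r]) linarith
  qed
  then obtain q where q: "\<And>n. \<bar>real_of_rat (q n) - x\<bar> \<le> 1 / real (Suc n)" by metis
  have "(\<lambda>n. real_of_rat (q n) - x) \<longlonglongrightarrow> 0"
  proof (rule Lim_null_comparison)
    show "(\<lambda>n. 1 / real (Suc n)) \<longlonglongrightarrow> 0"
      by (rule LIMSEQ_Suc[OF lim_1_over_n])
    show "\<forall>\<^sub>F n in sequentially. norm (real_of_rat (q n) - x) \<le> 1 / real (Suc n)"
      by (intro always_eventually allI) (simp only: real_norm_def q)
  qed
  then show ?thesis by (auto simp: LIM_zero_iff)
qed

lemma closure_rat_step: "closure (range rat_step) = UNIV"
proof -
  let ?V = "closure (range rat_step)"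
  have "rat_step [] = 0" by (simp add: rat_step_def)
  then have zero: "0 \<in> ?V"
    by (intro subsetD[OF closure_subset] range_eqI[of _ _ "[]"]) (rule sym)
  have add: "x + y \<in> ?V" if xy: "x \<in> ?V" "y \<in> ?V" for x y
  proof -
    obtain f where f: "\<And>n. f n \<in> range rat_step" "f \<longlonglongrightarrow> x"
      using iffD1[OF closure_sequential xy(1)] by blast
    obtain g where g: "\<And>n. g n \<in> range rat_step" "g \<longlonglongrightarrow> y"
      using iffD1[OF closure_sequential xy(2)] by blast
    have "f n + g n \<in> range rat_step" for n
    proof -
      obtain xs ys where "f n = rat_step xs" "g n = rat_step ys"
        using f(1)[of n] g(1)[of n] by blast
      then show ?thesis by (simp only: rat_step_append[symmetric] rangeI)
    qed
    then show ?thesis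
      using iffD2[OF closure_sequential, OF exI, OF conjI, OF allI, OF _ tendsto_add[OF f(2) g(2)]] by blast
  qed
  have scale: "c *\<^sub>R x \<in> ?V" if x: "x \<in> ?V" for c x
  proof -
    obtain f where f: "\<And>n. f n \<in> range rat_step" "f \<longlonglongrightarrow> x"
      using iffD1[OF closure_sequential x] by blast
    obtain q where q: "(\<lambda>n. real_of_rat (q n)) \<longlonglongrightarrow> c"
      using real_rat_seq by blast
    have "real_of_rat (q n) *\<^sub>R f n \<in> range rat_step" for n
    proof -
      obtain xs where "f n = rat_step xs"
        using f(1)[of n] by blast
      then show ?thesis by (simp only: rat_step_scale[symmetric] rangeI)
    qed
    then show ?thesis
      using iffD2[OF closure_sequential, OF exI, OF conjI, OF allI, OF _ tendsto_scaleR[OF q f(2)]] by blast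
  qed
  have sub: "subspace ?V"
    unfolding subspace_def using zero add scale by blast
  have "abs_L2 (indicator {a<..b}) \<in> ?V" for a b
  proof -
    obtain p where p: "(\<lambda>n. real_of_rat (p n)) \<longlonglongrightarrow> a"
      using real_rat_seq by blast
    obtain q where q: "(\<lambda>n. real_of_rat (q n)) \<longlonglongrightarrow> b"
      using real_rat_seq by blast
    obtain K where K: "\<And>n. norm (real_of_rat (p n)) \<le> K"
      using convergent_imp_Bseq[OF convergentI[OF p]] unfolding Bseq_def by blast
    obtain L where L: "\<And>n. norm (real_of_rat (q n)) \<le> L"
      using convergent_imp_Bseq[OF convergentI[OF q]] unfolding Bseq_def by blast
    have "(\<lambda>n. abs_L2 (indicator {real_of_rat (p n)<..real_of_rat (q n)})) \<longlonglongrightarrow> abs_L2 (indicator {a<..b})"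
    proof (rule tendsto_abs_L2_dominated(3)[OF square_integrable_indicator_Ioc[of "-K - 1" L]])
      show "(indicator {real_of_rat (p n)<..real_of_rat (q n)} :: real \<Rightarrow> real) \<in> borel_measurable borel" for n
        by simp
      show "(indicator {a<..b} :: real \<Rightarrow> real) \<in> borel_measurable borel"
        by simp
      show "AE t in lborel. \<bar>indicator {real_of_rat (p n)<..real_of_rat (q n)} t :: real\<bar>
          \<le> \<bar>indicator {- K - 1<..L} t\<bar>" for n
      proof (rule AE_I2)
        fix t :: real
        have "{real_of_rat (p n)<..real_of_rat (q n)} \<subseteq> {- K - 1<..L}"
          using K[of n] L[of n] by (auto simp only: greaterThanAtMost_iff real_norm_def)
        then show "\<bar>indicator {real_of_rat (p n)<..real_of_rat (q n)} t :: real\<bar>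
            \<le> \<bar>indicator {- K - 1<..L} t\<bar>"
          by (auto simp del: greaterThanAtMost_iff split: split_indicator)
      qed
      have "AE t in lborel. t \<noteq> a \<and> t \<noteq> b"
        by (intro AE_conjI AE_lborel_singleton)
      then show "AE t in lborel. (\<lambda>n. indicator {real_of_rat (p n)<..real_of_rat (q n)} t :: real)
          \<longlonglongrightarrow> indicator {a<..b} t"
      proof eventually_elim
        case (elim t)
        have ep: "\<forall>\<^sub>F n in sequentially. (real_of_rat (p n) < t) = (a < t)"
        proof (cases "a < t")
          case True
          from order_tendstoD(2)[OF p True] show ?thesis
            by eventually_elim (use True in simp)
        next
          case False
          then have "t < a" using elim by simp
          from order_tendstoD(1)[OF p this] show ?thesis
            by eventually_elim (use False in simp)
        qed
        have eq: "\<forall>\<^sub>F n in sequentially. (t \<le> real_of_rat (q n)) = (t \<le> b)"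
        proof (cases "t < b")
          case True
          from order_tendstoD(1)[OF q True] show ?thesis
            by eventually_elim (use True in simp)
        next
          case False
          then have "b < t" using elim by simp
          from order_tendstoD(2)[OF q this] show ?thesis
            by eventually_elim (use \<open>b < t\<close> in simp)
        qed
        have "\<forall>\<^sub>F n in sequentially. indicator {a<..b} t =
            (indicator {real_of_rat (p n)<..real_of_rat (q n)} t :: real)"
          using ep eq by eventually_elim (simp add: indicator_def)
        then show ?case
          by (rule Lim_transform_eventually[OF tendsto_const])
      qed
    qed
    moreover have "abs_L2 (indicator {real_of_rat (p n)<..real_of_rat (q n)}) \<in> range rat_step" for n
      by (rule range_eqI[of _ _ "[(1, p n, q n)]"]) (simp add: rat_step_def)
    ultimately show ?thesis
      unfolding closure_sequential
      by (intro exI[of _ "\<lambda>n. abs_L2 (indicator {real_of_rat (p n)<..real_of_rat (q n)})"]) simp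
  qed
  then show ?thesis
    using closed_subspace_eq_UNIV[OF sub closed_closure] by blast
qed

instance L2 :: second_countable_topology
proof (standard, rule second_countable_dense)
  show "countable (range rat_step)" by simp
  show "\<exists>d\<in>range rat_step. dist d x < e" if "0 < e" for x :: L2 and e
    using closure_rat_step that closure_approachable[of x "range rat_step"] by blast
qed

subsection \<open>The space of square integrable functions on a set\<close>

definition L2_on :: "real set \<Rightarrow> L2 set" where
  "L2_on T = abs_L2 ` {f. square_integrable f \<and> (\<forall>t. t \<notin> T \<longrightarrow> f t = 0)}"

lemma inner_abs_L2_on:
  assumes f: "square_integrable f" "\<And>t. t \<notin> T \<Longrightarrow> f t = 0"
    and g: "square_integrable g" "\<And>t. t \<notin> T \<Longrightarrow> g t = 0"
  shows "inner (abs_L2 f) (abs_L2 g) = (LINT t:T|lborel. f t * g t)"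
proof -
  have "(\<lambda>t. indicator T t *\<^sub>R (f t * g t)) = (\<lambda>t. f t * g t)"
  proof
    fix t
    show "indicator T t *\<^sub>R (f t * g t) = f t * g t"
      using f(2)[of t] by (cases "t \<in> T") simp_all
  qed
  then show ?thesis
    using f(1) g(1) by (simp add: inner_abs_L2 set_lebesgue_integral_def)
qed

subsection \<open>Support, orthogonal projection, coordinates\<close>

definition rv_support :: "'w measure \<Rightarrow> ('w \<Rightarrow> 'b::topological_space) \<Rightarrow> 'b set" where
  "rv_support M X = {h. \<forall>U. open U \<and> h \<in> U \<longrightarrow> measure M (X -` U \<inter> space M) > 0}"

definition support_space :: "'w measure \<Rightarrow> ('w \<Rightarrow> L2) \<Rightarrow> L2 set" where
  "support_space M X = (\<lambda>V. subspace V \<and> closed V) hull rv_support M X"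

definition orth_compl_on :: "real set \<Rightarrow> L2 set \<Rightarrow> L2 set" where
  "orth_compl_on T S = L2_on T \<inter> orthogonal_comp S"

definition orth_proj :: "L2 set \<Rightarrow> L2 \<Rightarrow> L2" where
  "orth_proj S h = (THE p. p \<in> S \<and> h - p \<in> orthogonal_comp S)"

definition identifiable :: "real set \<Rightarrow> L2 set \<Rightarrow> L2 set \<Rightarrow> bool" where
  "identifiable T S D \<longleftrightarrow> D \<inter> orth_compl_on T S = {0}"

text \<open>A family indexed by \<open>{..<d}\<close>; all vectors and matrices below are indexed from 0.\<close>

definition orthonormal_basis :: "(nat \<Rightarrow> L2) \<Rightarrow> nat \<Rightarrow> L2 set \<Rightarrow> bool" where
  "orthonormal_basis \<phi> d E \<longleftrightarrow>
    (\<forall>j<d. \<forall>k<d. inner (\<phi> j) (\<phi> k) = (if j = k then 1 else 0)) \<and> span (\<phi> ` {..<d}) = E"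

definition lin_comb :: "(nat \<Rightarrow> L2) \<Rightarrow> real Matrix.vec \<Rightarrow> L2" where
  "lin_comb \<phi> v = (\<Sum>k<dim_vec v. vec_index v k *\<^sub>R \<phi> k)"

subsection \<open>Least squares\<close>

text \<open>The value 0 for singular matrices is only a convention, chosen so that the random vectors
  built from \<open>mat_inv\<close> are measurable on the whole probability space.\<close>

definition mat_inv :: "real mat \<Rightarrow> real mat" where
  "mat_inv A = (case mat_inverse A of Some B \<Rightarrow> B | None \<Rightarrow> 0\<^sub>m (dim_row A) (dim_col A))"

definition design_matrix :: "(nat \<Rightarrow> L2) \<Rightarrow> nat \<Rightarrow> (nat \<Rightarrow> L2) \<Rightarrow> nat \<Rightarrow> real mat" where
  "design_matrix \<phi> d xs n = mat n d (\<lambda>(i, j). inner (xs i) (\<phi> j))"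

definition gram :: "real mat \<Rightarrow> real mat" where
  "gram A = transpose_mat A * A"

definition ls_coords :: "real mat \<Rightarrow> real Matrix.vec \<Rightarrow> real Matrix.vec" where
  "ls_coords A v = (mat_inv (gram A) * transpose_mat A) *\<^sub>v v"

definition rss :: "(nat \<Rightarrow> L2) \<Rightarrow> (nat \<Rightarrow> real) \<Rightarrow> nat \<Rightarrow> L2 \<Rightarrow> real" where
  "rss xs ys n b = (\<Sum>i<n. (ys i - inner (xs i) b)\<^sup>2)"

definition ls_estimator :: "L2 set \<Rightarrow> (nat \<Rightarrow> L2) \<Rightarrow> (nat \<Rightarrow> real) \<Rightarrow> nat \<Rightarrow> L2" where
  "ls_estimator E xs ys n = arg_min_on (rss xs ys n) E"

subsection \<open>Generated sigma-algebras and conditional moments\<close>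

definition family_algebra ::
  "'w measure \<Rightarrow> nat set \<Rightarrow> (nat \<Rightarrow> 'w \<Rightarrow> 'b::topological_space) \<Rightarrow> 'w measure" where
  "family_algebra M I Z =
    vimage_algebra (space M) (\<lambda>\<omega>. \<lambda>i\<in>I. Z i \<omega>) (\<Pi>\<^sub>M i\<in>I. borel)"

text \<open>The least squares coordinates need not be integrable. \<open>real_cond_exp\<close> is the difference of
  the conditional expectations of the positive and negative parts, which are defined for all
  nonnegative measurable functions, so it still is the conditional expectation in this case.\<close>

definition cond_exp_vec ::
  "'w measure \<Rightarrow> 'w measure \<Rightarrow> nat \<Rightarrow> ('w \<Rightarrow> real Matrix.vec) \<Rightarrow> 'w \<Rightarrow> real Matrix.vec" where
  "cond_exp_vec M F d V \<omega> = Matrix.vec d (\<lambda>k. real_cond_exp M F (\<lambda>\<omega>. vec_index (V \<omega>) k) \<omega>)"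

definition cond_cov_mat ::
  "'w measure \<Rightarrow> 'w measure \<Rightarrow> nat \<Rightarrow> ('w \<Rightarrow> real Matrix.vec) \<Rightarrow> 'w \<Rightarrow> real mat" where
  "cond_cov_mat M F d V \<omega> = mat d d (\<lambda>(j, k). real_cond_exp M F (\<lambda>\<omega>.
      (vec_index (V \<omega>) j - vec_index (cond_exp_vec M F d V \<omega>) j) *
      (vec_index (V \<omega>) k - vec_index (cond_exp_vec M F d V \<omega>) k)) \<omega>)"

end

theory Submission
  imports Defs "HOL-Library.Discrete_Functions" "Jordan_Normal_Form.Determinant"
begin

text \<open>Since \<open>x i\<close> lies in \<open>S\<close> almost surely, \<open>\<langle>x i, \<beta>\<rangle>\<close> splits into the parts of \<open>\<beta>\<close> in \<open>E\<close> and \<open>F\<close>. Least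
  squares reproduces the first part exactly, turns the second into the bias \<open>\<gamma>n\<close>, and adds a linear
  combination of the errors whose weights depend only on the design. As the errors are
  independent of the design, the conditional moments follow.

  For the limit, the Gram matrix divided by \<open>n\<close> converges to the second moment matrix of \<open>X\<close> in the
  basis \<open>\<phi>\<close> by the strong law of large numbers. The latter matrix is invertible: a vector of its kernel
  gives an \<open>e\<close> in \<open>E \<subseteq> S\<close> that is almost surely orthogonal to \<open>X\<close>, hence orthogonal to \<open>S\<close>. The noise
  terms \<open>\<langle>x i, \<phi> k\<rangle> \<epsilon> i\<close> are only uncorrelated, with equal second moments, and their averages vanish by
  Rajchman's law.\<close>

subsection \<open>Laws of large numbers\<close>

text \<open>Two laws of large numbers are needed because the two kinds of averages have different
  moments. The products \<open>inner (x i \<omega>) a * inner (x i \<omega>) b\<close> are i.i.d.,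
  but as only the second moment of \<open>norm X\<close> is finite they have just a first moment,
  and a variance estimate is out of reach; hence the argument through running maxima. The noise
  products do have second moments, because independence factors them, but they need be neither
  independent nor identically distributed, so only orthogonality is left to work with. The other
  obstacle is the random inverse: its entries may fail to be integrable, and it exists only on an
  event. The former is met by localising conditional expectations, the latter by the adjugate
  formula, which under \<open>inverse 0 = 0\<close> agrees with \<open>mat_inv\<close> on singular
  matrices too and yields both measurability and continuity at invertible limits.\<close>

lemma AE_tendsto_0_of_summable_integrals:
  fixes f :: "nat \<Rightarrow> 'a \<Rightarrow> real"
  assumes f [measurable]: "\<And>m. integrable M (f m)" and nonneg: "\<And>m \<omega>. 0 \<le> f m \<omega>"
    and bound: "\<And>m. (\<integral>\<omega>. f m \<omega> \<partial>M) \<le> g m" and g: "summable g"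
  shows "AE \<omega> in M. (\<lambda>m. f m \<omega>) \<longlonglongrightarrow> 0"
proof -
  have g_nonneg: "0 \<le> g m" for m
    using order_trans[OF Bochner_Integration.integral_nonneg bound] nonneg by blast
  \<comment> \<open>The series of all \<open>f m\<close> has finite integral, hence is finite almost
    everywhere, and its terms tend to 0.\<close>
  have "(\<integral>\<^sup>+\<omega>. (\<Sum>m. ennreal (f m \<omega>)) \<partial>M) = (\<Sum>m. \<integral>\<^sup>+\<omega>. ennreal (f m \<omega>) \<partial>M)"
    by (rule nn_integral_suminf) measurable
  also have "\<dots> \<le> (\<Sum>m. ennreal (g m))"
    using f nonneg bound
    by (intro suminf_le summableI) (simp add: nn_integral_eq_integral ennreal_leI)
  also have "\<dots> < \<infinity>"
    using g g_nonneg by (simp add: suminf_ennreal2)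
  finally have "AE \<omega> in M. (\<Sum>m. ennreal (f m \<omega>)) \<noteq> \<infinity>"
    by (intro nn_integral_PInf_AE) auto
  then show ?thesis
  proof eventually_elim
    case (elim \<omega>)
    then have "summable (\<lambda>m. f m \<omega>)"
      using nonneg by (intro summable_suminf_not_top) auto
    then show ?case
      by (rule summable_LIMSEQ_zero)
  qed
qed

lemma integrable_mult_of_squares:
  fixes f g :: "'a \<Rightarrow> real"
  assumes [measurable]: "f \<in> borel_measurable M" "g \<in> borel_measurable M"
    and "integrable M (\<lambda>\<omega>. (f \<omega>)\<^sup>2)" "integrable M (\<lambda>\<omega>. (g \<omega>)\<^sup>2)"
  shows "integrable M (\<lambda>\<omega>. f \<omega> * g \<omega>)"
proof (rule Bochner_Integration.integrable_bound)
  show "integrable M (\<lambda>\<omega>. (f \<omega>)\<^sup>2 + (g \<omega>)\<^sup>2)"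
    using assms by simp
  have "\<bar>a * b\<bar> \<le> a\<^sup>2 + b\<^sup>2" for a b :: real
  proof -
    have "2 * \<bar>a * b\<bar> \<le> a\<^sup>2 + b\<^sup>2"
      using zero_le_power2[of "\<bar>a\<bar> - \<bar>b\<bar>"] by (simp add: power2_diff abs_mult)
    then show ?thesis by linarith
  qed
  then show "AE \<omega> in M. norm (f \<omega> * g \<omega>) \<le> norm ((f \<omega>)\<^sup>2 + (g \<omega>)\<^sup>2)"
    by (auto simp: abs_of_nonneg)
qed measurable

context
  fixes M :: "'a measure" and w :: "nat \<Rightarrow> 'a \<Rightarrow> real" and C :: real
  assumes meas [measurable]: "\<And>i. w i \<in> borel_measurable M"
    and sq: "\<And>i. integrable M (\<lambda>\<omega>. (w i \<omega>)\<^sup>2)"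
    and bound: "\<And>i. (\<integral>\<omega>. (w i \<omega>)\<^sup>2 \<partial>M) \<le> C"
    and orth: "\<And>i j. i \<noteq> j \<Longrightarrow> (\<integral>\<omega>. w i \<omega> * w j \<omega> \<partial>M) = 0"
begin

text \<open>The cross terms vanish, so the second moment grows only linearly in the number of terms.
  The index set is arbitrary because both initial segments and gaps between squares are
  needed.\<close>

lemma orthogonal_sum_square:
  assumes "finite I"
  shows "integrable M (\<lambda>\<omega>. (\<Sum>i\<in>I. w i \<omega>)\<^sup>2)"
    and "(\<integral>\<omega>. (\<Sum>i\<in>I. w i \<omega>)\<^sup>2 \<partial>M) \<le> C * card I"
proof -
  have int: "integrable M (\<lambda>\<omega>. w i \<omega> * w j \<omega>)" for i j
    by (intro integrable_mult_of_squares sq meas)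
  have eq: "(\<lambda>\<omega>. (\<Sum>i\<in>I. w i \<omega>)\<^sup>2) = (\<lambda>\<omega>. \<Sum>i\<in>I. \<Sum>j\<in>I. w i \<omega> * w j \<omega>)"
    by (simp add: power2_eq_square sum_product)
  show "integrable M (\<lambda>\<omega>. (\<Sum>i\<in>I. w i \<omega>)\<^sup>2)"
    unfolding eq using int by simp
  have "(\<integral>\<omega>. (\<Sum>i\<in>I. w i \<omega>)\<^sup>2 \<partial>M) = (\<Sum>i\<in>I. \<Sum>j\<in>I. \<integral>\<omega>. w i \<omega> * w j \<omega> \<partial>M)"
    unfolding eq using int by simp
  also have "\<dots> = (\<Sum>i\<in>I. \<Sum>j\<in>I. if j = i then (\<integral>\<omega>. (w i \<omega>)\<^sup>2 \<partial>M) else 0)"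
    by (intro sum.cong refl) (auto simp: orth power2_eq_square)
  also have "\<dots> = (\<Sum>i\<in>I. \<integral>\<omega>. (w i \<omega>)\<^sup>2 \<partial>M)"
    using assms by simp
  also have "\<dots> \<le> of_nat (card I) * C"
    by (rule sum_bounded_above) (rule bound)
  finally show "(\<integral>\<omega>. (\<Sum>i\<in>I. w i \<omega>)\<^sup>2 \<partial>M) \<le> C * card I"
    by (simp add: mult.commute)
qed

text \<open>The averages tend to 0 along the squares because their second moments are summable there,
  and so do the deviations from the last square, even after summing them over the whole gap.\<close>

theorem rajchman_law: "AE \<omega> in M. (\<lambda>n. (\<Sum>i<n. w i \<omega>) / real n) \<longlonglongrightarrow> 0"
proof -
  define Q where "Q m \<omega> = (\<Sum>i<m\<^sup>2. w i \<omega>)\<^sup>2 / real m ^ 4" for m \<omega>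
  \<comment> \<open>The sum over the gap replaces the maximum over the gap. It has
    \<open>2 * m + 1\<close> terms, each of second moment at most \<open>C * (2 * m + 1)\<close>,
    and the denominator is the square of the smallest \<open>n\<close> in the gap, so the order is
    \<open>1 / m\<^sup>2\<close>.\<close>
  define R where "R m \<omega> = (\<Sum>k\<in>{m\<^sup>2..<(Suc m)\<^sup>2}. (\<Sum>i\<in>{m\<^sup>2..<k}. w i \<omega>)\<^sup>2) / real m ^ 4" for m \<omega>
  have C: "0 \<le> C"
    by (rule order_trans[OF Bochner_Integration.integral_nonneg bound]) simp
  have summ: "summable (\<lambda>m. c * (1 / real m ^ 2))" for c :: real
    using inverse_power_summable[of 2, where 'a=real]
    by (intro summable_mult) (simp add: inverse_eq_divide)
  have Q: "AE \<omega> in M. (\<lambda>m. Q m \<omega>) \<longlonglongrightarrow> 0"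
  proof (rule AE_tendsto_0_of_summable_integrals)
    show "integrable M (Q m)" "0 \<le> Q m \<omega>" for m \<omega>
      unfolding Q_def[abs_def] by (auto intro!: orthogonal_sum_square)
    show "(\<integral>\<omega>. Q m \<omega> \<partial>M) \<le> C * (1 / real m ^ 2)" for m
    proof (cases "m = 0")
      case False
      have "(\<integral>\<omega>. Q m \<omega> \<partial>M) = (\<integral>\<omega>. (\<Sum>i<m\<^sup>2. w i \<omega>)\<^sup>2 \<partial>M) / real m ^ 4"
        unfolding Q_def by simp
      also have "\<dots> \<le> (C * card {..<m\<^sup>2}) / real m ^ 4"
        by (intro divide_right_mono orthogonal_sum_square) auto
      also have "\<dots> = C * (1 / real m ^ 2)"
        using False by (simp add: field_simps power2_eq_square power4_eq_xxxx)
      finally show ?thesis .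
    qed (simp add: Q_def)
  qed (rule summ)
  have R: "AE \<omega> in M. (\<lambda>m. R m \<omega>) \<longlonglongrightarrow> 0"
  proof (rule AE_tendsto_0_of_summable_integrals)
    show "integrable M (R m)" for m
      unfolding R_def[abs_def] by (auto intro!: orthogonal_sum_square)
    show "0 \<le> R m \<omega>" for m \<omega>
      unfolding R_def by (intro divide_nonneg_nonneg sum_nonneg) simp_all
    \<comment> \<open>The 9 comes from \<open>2 * m + 1 \<le> 3 * m\<close> for positive
      \<open>m\<close>; at \<open>m = 0\<close> both sides are 0, since division by 0 gives
      0.\<close>
    show "(\<integral>\<omega>. R m \<omega> \<partial>M) \<le> (9 * C) * (1 / real m ^ 2)" for m
    proof (cases "m = 0")
      case False
      let ?K = "{m\<^sup>2..<(Suc m)\<^sup>2}"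
      have card: "card ?K = 2 * m + 1"
        by (simp add: power2_eq_square)
      have "(\<integral>\<omega>. R m \<omega> \<partial>M) = (\<Sum>k\<in>?K. \<integral>\<omega>. (\<Sum>i\<in>{m\<^sup>2..<k}. w i \<omega>)\<^sup>2 \<partial>M) / real m ^ 4"
        unfolding R_def using orthogonal_sum_square(1) by simp
      also have "\<dots> \<le> (\<Sum>k\<in>?K. C * real (2 * m + 1)) / real m ^ 4"
      proof (intro divide_right_mono sum_mono)
        fix k assume "k \<in> ?K"
        then have "card {m\<^sup>2..<k} \<le> 2 * m + 1"
          by (auto simp: power2_eq_square)
        then have "C * card {m\<^sup>2..<k} \<le> C * real (2 * m + 1)"
          using C by (intro mult_left_mono) linarith+
        then show "(\<integral>\<omega>. (\<Sum>i\<in>{m\<^sup>2..<k}. w i \<omega>)\<^sup>2 \<partial>M) \<le> C * real (2 * m + 1)"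
          using orthogonal_sum_square(2)[of "{m\<^sup>2..<k}"] by simp
      qed simp
      also have "\<dots> = C * (real (2 * m + 1))\<^sup>2 / real m ^ 4"
        unfolding sum_constant card by (simp add: power2_eq_square)
      also have "\<dots> \<le> C * (3 * real m)\<^sup>2 / real m ^ 4"
        using C False by (intro divide_right_mono mult_left_mono power_mono) auto
      also have "\<dots> = (9 * C) * (1 / real m ^ 2)"
        using False by (simp add: field_simps power2_eq_square power4_eq_xxxx)
      finally show ?thesis .
    qed (simp add: R_def)
  qed (rule summ)
  have sqrt_lim: "filterlim floor_sqrt sequentially sequentially"
    unfolding filterlim_at_top
  proof
    fix Z :: nat
    show "\<forall>\<^sub>F n in sequentially. Z \<le> floor_sqrt n"
      using eventually_ge_at_top[of "Z\<^sup>2"]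
      by eventually_elim (metis floor_sqrt_inverse_power2 mono_floor_sqrt')
  qed
  show ?thesis using Q R
  proof eventually_elim
    case (elim \<omega>)
    let ?S = "\<lambda>n. \<Sum>i<n. w i \<omega>"
    have "(\<lambda>m. 2 * (Q m \<omega> + R m \<omega>)) \<longlonglongrightarrow> 2 * (0 + 0)"
      using elim by (intro tendsto_intros)
    then have lim: "(\<lambda>n. 2 * (Q (floor_sqrt n) \<omega> + R (floor_sqrt n) \<omega>)) \<longlonglongrightarrow> 0"
      using filterlim_compose[OF _ sqrt_lim] by simp
    have "(\<lambda>n. (?S n / real n)\<^sup>2) \<longlonglongrightarrow> 0"
    proof (rule Lim_null_comparison[OF _ lim])
      show "\<forall>\<^sub>F n in sequentially. norm ((?S n / real n)\<^sup>2)
          \<le> 2 * (Q (floor_sqrt n) \<omega> + R (floor_sqrt n) \<omega>)"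
        using eventually_gt_at_top[of 0]
      proof eventually_elim
        case (elim n)
        define m where "m = floor_sqrt n"
        have m: "m > 0" "m\<^sup>2 \<le> n" "n < (Suc m)\<^sup>2"
          using elim Suc_floor_sqrt_power2_gt[of n] by (auto simp: m_def)
        have "?S n = ?S (m\<^sup>2) + (\<Sum>i\<in>{m\<^sup>2..<n}. w i \<omega>)"
          using m(2) by (metis atLeast0LessThan le0 sum.atLeastLessThan_concat)
        then have "(?S n)\<^sup>2 \<le> 2 * ((?S (m\<^sup>2))\<^sup>2 + (\<Sum>i\<in>{m\<^sup>2..<n}. w i \<omega>)\<^sup>2)"
          using sum_squares_bound[of "?S (m\<^sup>2)" "\<Sum>i\<in>{m\<^sup>2..<n}. w i \<omega>"] by (simp add: power2_sum)
        \<comment> \<open>As \<open>n\<close> itself lies in the gap after \<open>m\<^sup>2\<close>,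
          its deviation is one of the nonnegative summands.\<close>
        also have "(\<Sum>i\<in>{m\<^sup>2..<n}. w i \<omega>)\<^sup>2 \<le> (\<Sum>k\<in>{m\<^sup>2..<(Suc m)\<^sup>2}. (\<Sum>i\<in>{m\<^sup>2..<k}. w i \<omega>)\<^sup>2)"
          using m by (intro member_le_sum[of n _ "\<lambda>k. (\<Sum>i\<in>{m\<^sup>2..<k}. w i \<omega>)\<^sup>2"]) auto
        finally have *: "(?S n)\<^sup>2 \<le> 2 * ((?S (m\<^sup>2))\<^sup>2
            + (\<Sum>k\<in>{m\<^sup>2..<(Suc m)\<^sup>2}. (\<Sum>i\<in>{m\<^sup>2..<k}. w i \<omega>)\<^sup>2))"
          by simp
        have "real m ^ 4 = (real (m\<^sup>2))\<^sup>2"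
          by (simp flip: power_mult)
        also have "\<dots> \<le> (real n)\<^sup>2"
          using m(2) by (intro power_mono) (simp_all only: of_nat_le_iff of_nat_0_le_iff)
        finally have "(?S n / real n)\<^sup>2 \<le> (?S n)\<^sup>2 / real m ^ 4"
          unfolding power_divide using m(1) elim by (intro divide_left_mono) auto
        also have "\<dots> \<le> 2 * (Q m \<omega> + R m \<omega>)"
          using divide_right_mono[OF *, of "real m ^ 4"]
          by (simp add: Q_def R_def add_divide_distrib)
        finally show ?case
          by (simp add: m_def)
      qed
    qed
    from tendsto_real_sqrt[OF this] have "(\<lambda>n. \<bar>?S n / real n\<bar>) \<longlonglongrightarrow> 0"
      by (simp only: real_sqrt_abs real_sqrt_zero)
    then show ?case
      by (rule tendsto_rabs_zero_cancel)
  qed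
qed

end

section \<open>The strong law for i.i.d. variables with a first moment\<close>

text \<open>This is the maximum of the partial sums of length 0 to \<open>n\<close>, the empty sum
  included. The recursion splits off the first step instead of the last, so that the maximum of a
  walk is expressed by that of its shift.\<close>

primrec running_max :: "nat \<Rightarrow> (nat \<Rightarrow> real) \<Rightarrow> real" where
  "running_max 0 f = 0"
| "running_max (Suc n) f = max 0 (f 0 + running_max n (\<lambda>i. f (Suc i)))"

lemma running_max_nonneg: "0 \<le> running_max n f"
  by (cases n) auto

lemma running_max_mono: "running_max n f \<le> running_max (Suc n) f"
proof (induction n arbitrary: f)
  case (Suc n)
  show ?case
    using Suc[of "\<lambda>i. f (Suc i)"] by simp
qed simp

lemma running_max_le: "running_max n f \<le> (\<Sum>i<n. \<bar>f i\<bar>)"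
proof (induction n arbitrary: f)
  case (Suc n)
  have "0 \<le> (\<Sum>i<n. \<bar>f (Suc i)\<bar>)" by (simp add: sum_nonneg)
  then show ?case
    using Suc[of "\<lambda>i. f (Suc i)"] by (simp add: sum.lessThan_Suc_shift del: sum.lessThan_Suc)
qed simp

lemma partial_sum_le_running_max: "(\<Sum>i<n. f i) \<le> running_max n f"
proof (induction n arbitrary: f)
  case (Suc n)
  show ?case
    using Suc[of "\<lambda>i. f (Suc i)"] by (simp add: sum.lessThan_Suc_shift del: sum.lessThan_Suc)
qed simp

lemma measurable_running_max [measurable]:
  "(\<lambda>f. running_max n f) \<in> borel_measurable (\<Pi>\<^sub>M i\<in>UNIV. borel)"
proof (induction n)
  case (Suc n)
  let ?P = "\<Pi>\<^sub>M i\<in>(UNIV::nat set). (borel :: real measure)"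
  have "(\<lambda>f i. f (Suc i)) \<in> ?P \<rightarrow>\<^sub>M ?P"
    by (rule measurable_PiM_single', rule measurable_component_singleton) (simp_all add: PiE_UNIV_domain)
  from measurable_compose[OF this Suc]
  have "(\<lambda>f. max 0 (f 0 + running_max n (\<lambda>i. f (Suc i)))) \<in> borel_measurable ?P"
    by (intro borel_measurable_max borel_measurable_add borel_measurable_const
        measurable_component_singleton UNIV_I)
  then show ?case
    by (simp only: running_max.simps)
qed (simp only: running_max.simps borel_measurable_const)

text \<open>Dropping the first \<open>m\<close> terms changes all later partial sums by one fixed
  number. This is what makes boundedness of the walk a tail event.\<close>

lemma bdd_above_partial_sums_shift:
  fixes f :: "nat \<Rightarrow> real"
  shows "bdd_above (range (\<lambda>n. \<Sum>i<n. f (i + m))) \<longleftrightarrow> bdd_above (range (\<lambda>n. \<Sum>i<n. f i))"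
proof (induction m)
  case (Suc m)
  let ?g = "\<lambda>i. f (i + m)"
  have "bdd_above (range (\<lambda>n. \<Sum>i<n. ?g (Suc i))) \<longleftrightarrow> bdd_above (range (\<lambda>n. \<Sum>i<n. ?g i))"
  proof
    assume "bdd_above (range (\<lambda>n. \<Sum>i<n. ?g (Suc i)))"
    then obtain K where K: "\<And>n. (\<Sum>i<n. ?g (Suc i)) \<le> K"
      by (auto simp: bdd_above_def)
    have "(\<Sum>i<n. ?g i) \<le> max 0 (?g 0 + K)" for n
      using K by (cases n) (auto simp: sum.lessThan_Suc_shift le_max_iff_disj simp del: sum.lessThan_Suc)
    then show "bdd_above (range (\<lambda>n. \<Sum>i<n. ?g i))"
      by (auto intro!: bdd_aboveI)
  next
    assume "bdd_above (range (\<lambda>n. \<Sum>i<n. ?g i))"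
    then obtain K where K: "\<And>n. (\<Sum>i<n. ?g i) \<le> K"
      by (auto simp: bdd_above_def)
    have "(\<Sum>i<n. ?g (Suc i)) \<le> K - ?g 0" for n
      using K[of "Suc n"] by (simp add: sum.lessThan_Suc_shift del: sum.lessThan_Suc)
    then show "bdd_above (range (\<lambda>n. \<Sum>i<n. ?g (Suc i)))"
      by (auto intro!: bdd_aboveI)
  qed
  then show ?case
    using Suc by simp
qed simp

text \<open>For every \<open>m\<close> the event can be expressed by the variables from index
  \<open>m\<close> on, so Kolmogorov's 0-1 law applies.\<close>

lemma (in prob_space) indep_vars_partial_sums_bdd_above_0_1:
  fixes X :: "nat \<Rightarrow> 'a \<Rightarrow> real"
  assumes indep: "indep_vars (\<lambda>_. borel) X UNIV"
  shows "(AE \<omega> in M. bdd_above (range (\<lambda>n. \<Sum>i<n. X i \<omega>)))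
    \<or> (AE \<omega> in M. \<not> bdd_above (range (\<lambda>n. \<Sum>i<n. X i \<omega>)))"
proof -
  let ?A = "\<lambda>i. sigma_sets (space M) {X i -` B \<inter> space M | B. B \<in> sets borel}"
  let ?U = "{\<omega> \<in> space M. bdd_above (range (\<lambda>n. \<Sum>i<n. X i \<omega>))}"
  have ind: "indep_sets ?A UNIV"
    using indep unfolding indep_vars_def by simp
  have "?U \<in> tail_events ?A"
    unfolding tail_events_def
  proof
    fix m :: nat
    define N where "N = sigma (space M) (\<Union> (?A ` {m..}))"
    have pow: "\<Union> (?A ` {m..}) \<subseteq> Pow (space M)"
    proof (intro UN_least)
      fix i show "?A i \<subseteq> Pow (space M)"
        using sigma_sets_into_sp[of "{X i -` B \<inter> space M | B. B \<in> sets borel}" "space M"] by auto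
    qed
    have space: "space N = space M"
      unfolding N_def using pow by (rule space_measure_of)
    have sets: "sets N = sigma_sets (space M) (\<Union> (?A ` {m..}))"
      unfolding N_def using pow by (rule sets_measure_of)
    have [measurable]: "X (i + m) \<in> borel_measurable N" for i
    proof (rule measurableI)
      fix B :: "real set" assume "B \<in> sets borel"
      then have "X (i + m) -` B \<inter> space M \<in> ?A (i + m)" by (intro sigma_sets.Basic) auto
      then show "X (i + m) -` B \<inter> space N \<in> sets N"
        unfolding sets space by (intro sigma_sets.Basic) auto
    qed simp
    \<comment> \<open>A natural number as bound turns the event into a countable union of countable
      intersections, hence a measurable set.\<close>
    have "bdd_above (range (\<lambda>n. \<Sum>i<n. X (i + m) \<omega>)) \<longleftrightarrow> (\<exists>K::nat. \<forall>n. (\<Sum>i<n. X (i + m) \<omega>) \<le> real K)" for \<omega>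
      unfolding bdd_above_def by (auto, meson le_trans order_trans real_arch_simple)
    then have "?U = {\<omega> \<in> space N. \<exists>K::nat. \<forall>n. (\<Sum>i<n. X (i + m) \<omega>) \<le> real K}"
      unfolding space using bdd_above_partial_sums_shift[of "\<lambda>i. X i \<omega>" m for \<omega>] by auto
    also have "\<dots> \<in> sets N" by measurable
    finally show "?U \<in> sigma_sets (space M) (\<Union> (?A ` {m..}))"
      by (simp only: sets)
  qed
  moreover have "sigma_algebra (space M) (?A i)" for i
    by (rule sigma_algebra_sigma_sets) auto
  ultimately have "prob ?U = 0 \<or> prob ?U = 1"
    by (intro kolmogorov_0_1_law[OF _ ind])
  moreover have "?U \<in> events"
    using \<open>?U \<in> tail_events ?A\<close> tail_events_sets[of ?A] ind unfolding indep_sets_def by blast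
  ultimately show ?thesis
    using prob_Collect_eq_0[of "\<lambda>\<omega>. bdd_above (range (\<lambda>n. \<Sum>i<n. X i \<omega>))"]
      prob_Collect_eq_1[of "\<lambda>\<omega>. bdd_above (range (\<lambda>n. \<Sum>i<n. X i \<omega>))"] by blast
qed

lemma
  fixes X Y :: "'a \<Rightarrow> real"
  assumes X: "X \<in> borel_measurable M" and Y: "Y \<in> borel_measurable M"
    and eq: "distr M borel X = distr M borel Y"
  shows integrable_of_distr_eq: "integrable M Y \<Longrightarrow> integrable M X"
    and integral_of_distr_eq: "(\<integral>\<omega>. X \<omega> \<partial>M) = (\<integral>\<omega>. Y \<omega> \<partial>M)"
proof -
  have id: "(\<lambda>t. t) \<in> borel_measurable (borel :: real measure)"
    by simp
  show "integrable M Y \<Longrightarrow> integrable M X"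
    using integrable_distr_eq[OF X id] integrable_distr_eq[OF Y id] eq by (simp only:)
  show "(\<integral>\<omega>. X \<omega> \<partial>M) = (\<integral>\<omega>. Y \<omega> \<partial>M)"
    using integral_distr[OF X id] integral_distr[OF Y id] eq by (simp only:)
qed

text \<open>Garsia's argument: running maxima of the walk and of its shift have the same law, so
  \<open>E max (-R\<^sub>n) X\<^sub>0 \<ge> 0\<close> for the running maximum \<open>R\<^sub>n\<close> of the shifted walk. If the walk were unbounded
  above, \<open>n \<rightarrow> \<infinity>\<close> would give \<open>E X\<^sub>0 \<ge> 0\<close>.\<close>

lemma (in prob_space) iid_negative_drift_bdd_above:
  fixes X :: "nat \<Rightarrow> 'a \<Rightarrow> real"
  assumes indep: "indep_vars (\<lambda>_. borel) X UNIV"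
    and distr: "\<And>i. distr M borel (X i) = distr M borel Y"
    and Y: "integrable M Y" and neg: "expectation Y < 0"
  shows "AE \<omega> in M. bdd_above (range (\<lambda>n. \<Sum>i<n. X i \<omega>))"
proof -
  have X_meas [measurable]: "X i \<in> borel_measurable M" for i
    using indep unfolding indep_vars_def by simp
  have [measurable]: "Y \<in> borel_measurable M"
    using Y by simp
  have X_int [simp]: "integrable M (X i)" for i
    by (rule integrable_of_distr_eq[OF _ _ distr]) (use Y in auto)
  have EX: "expectation (X i) = expectation Y" for i
    by (rule integral_of_distr_eq[OF _ _ distr]) auto
  let ?P = "\<Pi>\<^sub>M i\<in>(UNIV::nat set). (borel :: real measure)"
  \<comment> \<open>Reindexing is obtained by grouping the family into the disjoint singleton blocks
    \<open>{Suc i}\<close>.\<close>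
  have "indep_vars (\<lambda>i. PiM {Suc i} (\<lambda>_. borel)) (\<lambda>i \<omega>. restrict (\<lambda>i. X i \<omega>) {Suc i}) UNIV"
    by (rule indep_vars_restrict[OF indep]) (auto simp: disjoint_family_on_def)
  then have "indep_vars (\<lambda>_. borel) (\<lambda>i \<omega>. (\<lambda>f. f (Suc i)) (restrict (\<lambda>i. X i \<omega>) {Suc i})) UNIV"
    by (rule indep_vars_compose2) simp
  then have indep': "indep_vars (\<lambda>_. borel) (\<lambda>i. X (Suc i)) UNIV"
    by simp
  \<comment> \<open>By independence both joint laws are products of their marginals, and all
    marginals are the law of \<open>Y\<close>.\<close>
  have law: "distr M ?P (\<lambda>\<omega> i. X i \<omega>) = distr M ?P (\<lambda>\<omega> i. X (Suc i) \<omega>)"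
    using indep indep' by (simp add: indep_vars_iff_distr_eq_PiM distr restrict_UNIV)
  have [measurable]: "(\<lambda>\<omega> i. X i \<omega>) \<in> M \<rightarrow>\<^sub>M ?P" "(\<lambda>\<omega> i. X (Suc i) \<omega>) \<in> M \<rightarrow>\<^sub>M ?P"
    by (auto intro!: measurable_PiM_single' simp: space_PiM)
  define R where "R n \<omega> = running_max n (\<lambda>i. X i \<omega>)" for n \<omega>
  define R' where "R' n \<omega> = running_max n (\<lambda>i. X (Suc i) \<omega>)" for n \<omega>
  have [measurable]: "R n \<in> borel_measurable M" "R' n \<in> borel_measurable M" for n
    unfolding R_def[abs_def] R'_def[abs_def] by measurable
  have R_int: "integrable M (R n)" for n
  proof (rule Bochner_Integration.integrable_bound)
    show "integrable M (\<lambda>\<omega>. \<Sum>i<n. \<bar>X i \<omega>\<bar>)" by simp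
    show "AE \<omega> in M. norm (R n \<omega>) \<le> norm (\<Sum>i<n. \<bar>X i \<omega>\<bar>)"
      by (rule AE_I2) (simp add: R_def running_max_nonneg running_max_le sum_nonneg)
  qed measurable
  have "distr M borel (R n) = distr M borel (R' n)" for n
    using arg_cong[OF law, of "\<lambda>N. distr N borel (running_max n)"]
    by (simp add: distr_distr comp_def R_def[abs_def] R'_def[abs_def])
  then have R'_int: "integrable M (R' n)" and ER': "expectation (R n) = expectation (R' n)" for n
    using R_int integrable_of_distr_eq[of "R' n" M "R n"] integral_of_distr_eq[of "R n" M "R' n"] by auto
  have garsia: "0 \<le> expectation (\<lambda>\<omega>. max (- R' n \<omega>) (X 0 \<omega>))" for n
  proof -
    \<comment> \<open>\<open>R n\<close> and \<open>R' n\<close> have the same mean, so monotonicity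
      of the running maximum makes the mean of \<open>R (Suc n) - R' n\<close> nonnegative; the
      recursion rewrites this difference as the maximum of \<open>- R' n\<close> and
      \<open>X 0\<close>.\<close>
    have "expectation (R n) \<le> expectation (R (Suc n))"
      by (intro integral_mono R_int) (simp only: R_def running_max_mono)
    then have "0 \<le> expectation (\<lambda>\<omega>. R (Suc n) \<omega> - R' n \<omega>)"
      using R_int R'_int ER' by simp
    also have "(\<lambda>\<omega>. R (Suc n) \<omega> - R' n \<omega>) = (\<lambda>\<omega>. max (- R' n \<omega>) (X 0 \<omega>))"
      unfolding R_def R'_def by (auto simp: max_def)
    finally show ?thesis .
  qed
  have False if unb: "AE \<omega> in M. \<not> bdd_above (range (\<lambda>n. \<Sum>i<n. X i \<omega>))"
  proof -
    have "(\<lambda>n. expectation (\<lambda>\<omega>. max (- R' n \<omega>) (X 0 \<omega>))) \<longlonglongrightarrow> expectation (X 0)"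
    proof (rule integral_dominated_convergence[where w="\<lambda>\<omega>. \<bar>X 0 \<omega>\<bar>"])
      show "AE \<omega> in M. (\<lambda>n. max (- R' n \<omega>) (X 0 \<omega>)) \<longlonglongrightarrow> X 0 \<omega>"
        using unb
      proof eventually_elim
        case (elim \<omega>)
        then have "\<not> bdd_above (range (\<lambda>n. \<Sum>i<n. X (i + 1) \<omega>))"
          by (simp only: bdd_above_partial_sums_shift[of "\<lambda>i. X i \<omega>" 1] not_False_eq_True)
        then have "\<exists>n. - X 0 \<omega> < (\<Sum>i<n. X (Suc i) \<omega>)"
          by (force simp: bdd_above_def not_le)
        then obtain N where "- X 0 \<omega> < R' N \<omega>"
          unfolding R'_def using partial_sum_le_running_max less_le_trans by blast
        moreover have "incseq (\<lambda>n. R' n \<omega>)"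
          unfolding R'_def by (rule incseq_SucI) (rule running_max_mono)
        ultimately have "R' n \<omega> > - X 0 \<omega>" if "n \<ge> N" for n
          using that by (meson incseqD less_le_trans)
        then have "\<forall>\<^sub>F n in sequentially. X 0 \<omega> = max (- R' n \<omega>) (X 0 \<omega>)"
          unfolding eventually_sequentially by (intro exI[of _ N]) fastforce
        then show ?case
          by (rule Lim_transform_eventually[OF tendsto_const])
      qed
      \<comment> \<open>The maximum differs from \<open>X 0\<close> only if
        \<open>X 0 < - R' n\<close>, and then it lies between \<open>X 0\<close> and 0 because
        \<open>R' n\<close> is nonnegative.\<close>
      show "AE \<omega> in M. norm (max (- R' n \<omega>) (X 0 \<omega>)) \<le> \<bar>X 0 \<omega>\<bar>" for n
        using running_max_nonneg[of n] by (intro AE_I2) (auto simp: R'_def max_def)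
    qed simp_all
    then have "0 \<le> expectation (X 0)"
      by (rule LIMSEQ_le_const) (use garsia in blast)
    then show False
      using neg EX by simp
  qed
  \<comment> \<open>Only almost sure unboundedness was refuted; the 0-1 law turns this into almost
    sure boundedness.\<close>
  then show ?thesis
    using indep_vars_partial_sums_bdd_above_0_1[OF indep] by blast
qed

text \<open>Subtracting a constant slightly above the mean gives negative drift, so the remaining
  sums stay below some \<open>K\<close> depending on \<omega>, and \<open>K / n\<close> vanishes.
  The countably many constants \<open>expectation Y + 1 / real (Suc k)\<close> yield one null set
  that serves every \<open>c\<close>.\<close>

lemma (in prob_space) iid_average_upper_bound:
  fixes X :: "nat \<Rightarrow> 'a \<Rightarrow> real"
  assumes indep: "indep_vars (\<lambda>_. borel) X UNIV"
    and distr: "\<And>i. distr M borel (X i) = distr M borel Y" and Y: "integrable M Y"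
  shows "AE \<omega> in M. \<forall>c > expectation Y. \<forall>\<^sub>F n in sequentially. (\<Sum>i<n. X i \<omega>) / real n < c"
proof -
  have X_meas [measurable]: "X i \<in> borel_measurable M" for i
    using indep unfolding indep_vars_def by simp
  have [measurable]: "Y \<in> borel_measurable M"
    using Y by simp
  let ?c = "\<lambda>k. expectation Y + 1 / real (Suc k)"
  have "AE \<omega> in M. bdd_above (range (\<lambda>n. \<Sum>i<n. X i \<omega> - ?c k))" for k
  proof (rule iid_negative_drift_bdd_above)
    show "indep_vars (\<lambda>_. borel) (\<lambda>i \<omega>. X i \<omega> - ?c k) UNIV"
      by (rule indep_vars_compose2[OF indep]) simp
    have "distr M borel (\<lambda>\<omega>. Z \<omega> - ?c k) = distr (distr M borel Z) borel (\<lambda>t. t - ?c k)"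
      if [measurable]: "Z \<in> borel_measurable M" for Z
      by (simp add: distr_distr comp_def)
    then show "distr M borel (\<lambda>\<omega>. X i \<omega> - ?c k) = distr M borel (\<lambda>\<omega>. Y \<omega> - ?c k)" for i
      by (simp add: distr)
  qed (use Y in \<open>simp_all add: prob_space\<close>)
  then have "AE \<omega> in M. \<forall>k. bdd_above (range (\<lambda>n. \<Sum>i<n. X i \<omega> - ?c k))"
    by (simp only: AE_all_countable) blast
  then show ?thesis
  proof eventually_elim
    case (elim \<omega>)
    show ?case
    proof (intro allI impI)
      fix c assume "expectation Y < c"
      then obtain k where k: "?c k < c"
        using nat_approx_posE[of "c - expectation Y"] by (auto simp: algebra_simps)
      obtain K where K: "(\<Sum>i<n. X i \<omega> - ?c k) \<le> K" for n
        using elim by (fastforce simp: bdd_above_def)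
      have "(\<lambda>n. K / real n) \<longlonglongrightarrow> 0"
        by (rule tendsto_divide_0[OF tendsto_const]) (simp add: filterlim_at_top_imp_at_infinity filterlim_real_sequentially)
      then have "\<forall>\<^sub>F n in sequentially. K / real n < c - ?c k"
        by (rule order_tendstoD) (use k in simp)
      then show "\<forall>\<^sub>F n in sequentially. (\<Sum>i<n. X i \<omega>) / real n < c"
        using eventually_gt_at_top[of 0]
      proof eventually_elim
        case (elim n)
        have "(\<Sum>i<n. X i \<omega>) \<le> K + real n * ?c k"
          using K[of n] by (simp add: sum_subtractf)
        then have "(\<Sum>i<n. X i \<omega>) / real n \<le> (K + real n * ?c k) / real n"
          by (rule divide_right_mono) simp
        also have "\<dots> = K / real n + ?c k"
          using elim(2) by (simp add: add_divide_distrib)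
        finally show ?case
          using elim(1) by linarith
      qed
    qed
  qed
qed

text \<open>The upper bound for \<open>X\<close> controls the upper limit of the averages, and the
  same bound for the negated variables controls the lower limit.\<close>

theorem (in prob_space) iid_strong_law:
  fixes X :: "nat \<Rightarrow> 'a \<Rightarrow> real"
  assumes indep: "indep_vars (\<lambda>_. borel) X UNIV"
    and distr: "\<And>i. distr M borel (X i) = distr M borel Y" and Y: "integrable M Y"
  shows "AE \<omega> in M. (\<lambda>n. (\<Sum>i<n. X i \<omega>) / real n) \<longlonglongrightarrow> expectation Y"
proof -
  have X_meas [measurable]: "X i \<in> borel_measurable M" for i
    using indep unfolding indep_vars_def by simp
  have [measurable]: "Y \<in> borel_measurable M"
    using Y by simp
  have neg: "AE \<omega> in M. \<forall>c > expectation (\<lambda>\<omega>. - Y \<omega>).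
      \<forall>\<^sub>F n in sequentially. (\<Sum>i<n. - X i \<omega>) / real n < c"
  proof (rule iid_average_upper_bound)
    show "indep_vars (\<lambda>_. borel) (\<lambda>i \<omega>. - X i \<omega>) UNIV"
      by (rule indep_vars_compose2[OF indep]) simp
    have "distr M borel (\<lambda>\<omega>. - Z \<omega>) = distr (distr M borel Z) borel uminus"
      if [measurable]: "Z \<in> borel_measurable M" for Z :: "'a \<Rightarrow> real"
      by (simp add: distr_distr comp_def)
    then show "distr M borel (\<lambda>\<omega>. - X i \<omega>) = distr M borel (\<lambda>\<omega>. - Y \<omega>)" for i
      by (simp add: distr)
  qed (use Y in simp)
  show ?thesis
    using iid_average_upper_bound[OF assms] neg
  proof eventually_elim
    case (elim \<omega>)
    show ?case
    proof (rule order_tendstoI)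
      fix a assume "a < expectation Y"
      then have "\<forall>\<^sub>F n in sequentially. (\<Sum>i<n. - X i \<omega>) / real n < - a"
        using elim(2) by simp
      then show "\<forall>\<^sub>F n in sequentially. a < (\<Sum>i<n. X i \<omega>) / real n"
        by eventually_elim (simp add: sum_negf)
    qed (use elim(1) in blast)
  qed
qed

subsection \<open>Conditional expectations\<close>

text \<open>The indicator of \<open>A\<close> can be moved inside the conditional expectation, where
  it makes the two functions equal. The argument runs through \<open>nn_cond_exp\<close> of the
  positive and negative parts because pulling out a factor there requires no integrability.\<close>

lemma (in sigma_finite_subalgebra) real_cond_exp_local:
  assumes A [measurable]: "A \<in> sets F"
    and [measurable]: "f \<in> borel_measurable M" "g \<in> borel_measurable M"
    and eq: "\<And>x. x \<in> A \<Longrightarrow> f x = g x"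
  shows "AE x in M. x \<in> A \<longrightarrow> real_cond_exp M F f x = real_cond_exp M F g x"
proof -
  have nn: "AE x in M. x \<in> A \<longrightarrow> nn_cond_exp M F (\<lambda>x. ennreal (u x)) x = nn_cond_exp M F (\<lambda>x. ennreal (v x)) x"
    if [measurable]: "u \<in> borel_measurable M" "v \<in> borel_measurable M" and uv: "\<And>x. x \<in> A \<Longrightarrow> u x = v x"
    for u v :: "'a \<Rightarrow> real"
  proof -
    have "(\<lambda>x. indicator A x * ennreal (u x)) = (\<lambda>x. indicator A x * ennreal (v x))"
      using uv by (auto simp: indicator_def)
    then have "AE x in M. indicator A x * nn_cond_exp M F (\<lambda>x. ennreal (u x)) x
        = indicator A x * nn_cond_exp M F (\<lambda>x. ennreal (v x)) x"
      using nn_cond_exp_prod[of "indicator A" "\<lambda>x. ennreal (u x)"]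
        nn_cond_exp_prod[of "indicator A" "\<lambda>x. ennreal (v x)"] by auto
    then show ?thesis
      by eventually_elim (auto split: split_indicator_asm)
  qed
  have "AE x in M. x \<in> A \<longrightarrow> nn_cond_exp M F (\<lambda>x. ennreal (f x)) x = nn_cond_exp M F (\<lambda>x. ennreal (g x)) x"
    by (rule nn) (simp_all add: eq)
  moreover have "AE x in M. x \<in> A \<longrightarrow> nn_cond_exp M F (\<lambda>x. ennreal (- f x)) x = nn_cond_exp M F (\<lambda>x. ennreal (- g x)) x"
    by (rule nn) (simp_all add: eq)
  ultimately show ?thesis
    by eventually_elim (simp add: real_cond_exp_def)
qed

text \<open>On the events where all \<open>\<bar>a i\<bar> \<le> m\<close>, which exhaust the space, the coefficients can be replaced
  by their truncations; this is why the products need not be integrable.\<close>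

lemma (in sigma_finite_subalgebra) real_cond_exp_lincomb:
  fixes a h :: "'i \<Rightarrow> 'a \<Rightarrow> real"
  assumes I: "finite I" and a [measurable]: "\<And>i. a i \<in> borel_measurable F"
    and h: "\<And>i. integrable M (h i)"
  shows "AE x in M. real_cond_exp M F (\<lambda>x. \<Sum>i\<in>I. a i x * h i x) x
    = (\<Sum>i\<in>I. a i x * real_cond_exp M F (h i) x)"
proof -
  have [measurable]: "h i \<in> borel_measurable M" for i
    using h by simp
  have aM [measurable]: "a i \<in> borel_measurable M" for i
    by (rule measurable_from_subalg[OF subalg a])
  define t where "t m i x = max (- real m) (min (real m) (a i x))" for m :: nat and i x
  have t_meas [measurable]: "t m i \<in> borel_measurable F" for m i
    unfolding t_def[abs_def] by measurable
  have tM [measurable]: "t m i \<in> borel_measurable M" for m i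
    by (rule measurable_from_subalg[OF subalg t_meas])
  have t_int: "integrable M (\<lambda>x. t m i x * h i x)" for m i
  proof (rule Bochner_Integration.integrable_bound)
    show "integrable M (\<lambda>x. real m * h i x)"
      using h by simp
    have "\<bar>t m i x\<bar> \<le> real m" for x
      unfolding t_def by auto
    then show "AE x in M. norm (t m i x * h i x) \<le> norm (real m * h i x)"
      by (auto simp: abs_mult intro!: mult_right_mono)
  qed measurable
  have "AE x in M. (\<forall>i\<in>I. \<bar>a i x\<bar> \<le> real m) \<longrightarrow> real_cond_exp M F (\<lambda>x. \<Sum>i\<in>I. a i x * h i x) x
    = (\<Sum>i\<in>I. a i x * real_cond_exp M F (h i) x)" for m
  proof -
    let ?A = "{x \<in> space F. \<forall>i\<in>I. \<bar>a i x\<bar> \<le> real m}"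
    have "?A \<in> sets F"
      using I by measurable
    moreover have t_eq: "t m i x = a i x" if "x \<in> ?A" "i \<in> I" for i x
      using that unfolding t_def by fastforce
    ultimately have "AE x in M. x \<in> ?A \<longrightarrow> real_cond_exp M F (\<lambda>x. \<Sum>i\<in>I. a i x * h i x) x
        = real_cond_exp M F (\<lambda>x. \<Sum>i\<in>I. t m i x * h i x) x"
      by (intro real_cond_exp_local) (auto intro!: sum.cong)
    moreover have "AE x in M. real_cond_exp M F (\<lambda>x. \<Sum>i\<in>I. t m i x * h i x) x
        = (\<Sum>i\<in>I. real_cond_exp M F (\<lambda>x. t m i x * h i x) x)"
      by (rule real_cond_exp_sum[OF t_int])
    moreover have "AE x in M. \<forall>i\<in>I. real_cond_exp M F (\<lambda>x. t m i x * h i x) x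
        = t m i x * real_cond_exp M F (h i) x"
      using I by (intro AE_finite_allI real_cond_exp_mult t_int) auto
    ultimately show ?thesis
      using AE_space
    proof eventually_elim
      case (elim x)
      show ?case
      proof
        assume "\<forall>i\<in>I. \<bar>a i x\<bar> \<le> real m"
        then have "x \<in> ?A"
          using elim subalg by (simp add: subalgebra_def)
        then show "real_cond_exp M F (\<lambda>x. \<Sum>i\<in>I. a i x * h i x) x
            = (\<Sum>i\<in>I. a i x * real_cond_exp M F (h i) x)"
          using elim t_eq by simp
      qed
    qed
  qed
  then have "AE x in M. \<forall>m. (\<forall>i\<in>I. \<bar>a i x\<bar> \<le> real m) \<longrightarrow>
      real_cond_exp M F (\<lambda>x. \<Sum>i\<in>I. a i x * h i x) x = (\<Sum>i\<in>I. a i x * real_cond_exp M F (h i) x)"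
    by (simp only: AE_all_countable) blast
  then show ?thesis
  proof eventually_elim
    case (elim x)
    \<comment> \<open>The sum of the absolute coefficients bounds all of them at once, so each point
      lies in one of the localising events.\<close>
    obtain m :: nat where m: "(\<Sum>i\<in>I. \<bar>a i x\<bar>) \<le> real m"
      using real_arch_simple by blast
    have "\<bar>a i x\<bar> \<le> real m" if "i \<in> I" for i
      using member_le_sum[of i I "\<lambda>i. \<bar>a i x\<bar>"] that I m by simp
    then show ?case
      using elim by blast
  qed
qed

lemma (in prob_space) indep_var_of_indep_subalgebras:
  assumes F: "subalgebra M F" and H: "subalgebra M H" and indep: "indep_set (sets F) (sets H)"
    and f: "f \<in> F \<rightarrow>\<^sub>M N" and g: "g \<in> H \<rightarrow>\<^sub>M L"
  shows "indep_var N f L g"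
proof -
  have sub: "sigma_sets (space M) {u -` A \<inter> space M |A. A \<in> sets P} \<subseteq> sets G"
    if "subalgebra M G" "u \<in> G \<rightarrow>\<^sub>M P" for u G and P :: "'z measure"
  proof -
    have "space G = space M"
      using that(1) by (simp add: subalgebra_def)
    moreover have "{u -` A \<inter> space G |A. A \<in> sets P} \<subseteq> sets G"
      using that(2) by (auto intro: measurable_sets)
    ultimately show ?thesis
      using sets.sigma_sets_subset[of "{u -` A \<inter> space G |A. A \<in> sets P}" G] by simp
  qed
  have "indep_set (sigma_sets (space M) {f -` A \<inter> space M |A. A \<in> sets N})
      (sigma_sets (space M) {g -` A \<inter> space M |A. A \<in> sets L})"
    using indep sub[OF F f] sub[OF H g] unfolding indep_sets2_eq by blast
  then show ?thesis
    using measurable_from_subalg[OF F f] measurable_from_subalg[OF H g] by (simp add: indep_var_eq)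
qed

text \<open>Integrals of \<open>h\<close> over a set of \<open>F\<close> factor by independence, and
  a constant with the same integrals is the conditional expectation.\<close>

lemma (in prob_space) real_cond_exp_indep:
  assumes F: "subalgebra M F" and H: "subalgebra M H" and indep: "indep_set (sets F) (sets H)"
    and h: "h \<in> borel_measurable H" "integrable M h"
  shows "AE \<omega> in M. real_cond_exp M F h \<omega> = expectation h"
proof -
  interpret finite_measure_subalgebra M F
    using F by unfold_locales
  show ?thesis
  proof (rule real_cond_exp_charact)
    fix A assume A: "A \<in> sets F"
    then have [measurable]: "A \<in> events"
      using F by (auto simp: subalgebra_def)
    have "indep_var borel (indicator A :: 'a \<Rightarrow> real) borel h"
      by (rule indep_var_of_indep_subalgebras[OF F H indep _ h(1)]) (use A in simp)
    then have "(\<integral>\<omega>. indicator A \<omega> * h \<omega> \<partial>M) = (\<integral>\<omega>. indicator A \<omega> \<partial>M) * expectation h"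
      by (rule indep_var_lebesgue_integral) (use h in \<open>simp_all add: less_top[symmetric]\<close>)
    then show "(\<integral>\<omega>\<in>A. h \<omega> \<partial>M) = (\<integral>\<omega>\<in>A. expectation h \<partial>M)"
      by (simp add: set_lebesgue_integral_def)
  qed (use h in simp_all)
qed

section \<open>Sigma-algebras generated by families of random variables\<close>

lemma space_family_algebra [simp]: "space (family_algebra M I Z) = space M"
  by (simp add: family_algebra_def)

lemma measurable_family_algebra:
  assumes "i \<in> I"
  shows "Z i \<in> borel_measurable (family_algebra M I Z)"
proof -
  have "(\<lambda>\<omega>. \<lambda>i\<in>I. Z i \<omega>) \<in> family_algebra M I Z \<rightarrow>\<^sub>M (\<Pi>\<^sub>M i\<in>I. borel)"
    unfolding family_algebra_def by (rule measurable_vimage_algebra1) (auto simp: space_PiM)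
  from measurable_compose[OF this measurable_component_singleton[OF assms]] show ?thesis
    using assms by simp
qed

lemma subalgebra_family_algebra:
  assumes "space N = space M" and "\<And>i. i \<in> I \<Longrightarrow> Z i \<in> borel_measurable N"
  shows "subalgebra N (family_algebra M I Z)"
  unfolding subalgebra_def
proof
  have "(\<lambda>\<omega>. \<lambda>i\<in>I. Z i \<omega>) \<in> N \<rightarrow>\<^sub>M (\<Pi>\<^sub>M i\<in>I. borel)"
    using assms(2) by (rule measurable_restrict)
  then show "sets (family_algebra M I Z) \<subseteq> sets N"
    unfolding family_algebra_def by (intro sets_image_in_sets) (simp_all add: assms(1))
qed (simp add: assms(1))

subsection \<open>Supports\<close>

text \<open>A point outside the support has an open neighbourhood of measure 0, which may be shrunk
  to a set of a countable basis. So countably many null sets cover the exceptional event; this is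
  where second countability enters.\<close>

lemma (in finite_measure) AE_in_rv_support:
  fixes X :: "'a \<Rightarrow> 'b::second_countable_topology"
  assumes [measurable]: "X \<in> borel_measurable M"
  shows "AE \<omega> in M. X \<omega> \<in> rv_support M X"
proof -
  obtain B :: "'b set set" where B: "countable B" "topological_basis B"
    using ex_countable_basis by blast
  have "AE \<omega> in M. measure M (X -` U \<inter> space M) = 0 \<longrightarrow> X \<omega> \<notin> U" if "U \<in> B" for U
  proof (cases "measure M (X -` U \<inter> space M) = 0")
    case True
    have "open U"
      using that B(2) topological_basis_open by blast
    then have "X -` U \<inter> space M \<in> null_sets M"
      using True by (simp add: null_sets_def emeasure_eq_measure)
    from AE_not_in[OF this] show ?thesis
      using AE_space by eventually_elim simp
  qed simp
  then have "AE \<omega> in M. \<forall>U\<in>B. measure M (X -` U \<inter> space M) = 0 \<longrightarrow> X \<omega> \<notin> U"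
    using B(1) by (simp add: AE_ball_countable)
  then show ?thesis
  proof eventually_elim
    case (elim \<omega>)
    show ?case
      unfolding rv_support_def
    proof (intro CollectI allI impI)
      fix V assume V: "open V \<and> X \<omega> \<in> V"
      then obtain U where U: "U \<in> B" "X \<omega> \<in> U" "U \<subseteq> V"
        using B(2) by (meson topological_basisE)
      have "0 < measure M (X -` U \<inter> space M)"
        using elim U(1,2) by (auto simp: less_le)
      also have "\<dots> \<le> measure M (X -` V \<inter> space M)"
        using U(3) V by (intro finite_measure_mono) auto
      finally show "0 < measure M (X -` V \<inter> space M)" .
    qed
  qed
qed

lemma rv_support_subset_closed:
  fixes X :: "'a \<Rightarrow> 'b::topological_space"
  assumes "X \<in> borel_measurable M" and "closed C" and "AE \<omega> in M. X \<omega> \<in> C"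
  shows "rv_support M X \<subseteq> C"
proof
  fix h assume h: "h \<in> rv_support M X"
  show "h \<in> C"
  proof (rule ccontr)
    assume "h \<notin> C"
    then have "0 < measure M (X -` (- C) \<inter> space M)"
      using h assms(2) by (auto simp: rv_support_def)
    moreover have "measure M (X -` (- C) \<inter> space M) = 0"
    proof -
      have "X -` (- C) \<inter> space M \<in> sets M"
        using assms(1,2) by (intro measurable_sets[OF assms(1)]) auto
      then have "measure M (X -` (- C) \<inter> space M) = measure M {}"
        using assms(3) by (intro measure_eq_AE) auto
      then show ?thesis by simp
    qed
    ultimately show False by simp
  qed
qed

lemma subspace_support_space: "subspace (support_space M X)"
  and closed_support_space: "closed (support_space M X)"
proof -
  have "subspace (support_space M X) \<and> closed (support_space M X)"
    unfolding support_space_def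
    by (rule hull_in) (auto intro: subspace_Inter closed_Inter)
  then show "subspace (support_space M X)" "closed (support_space M X)"
    by auto
qed

lemma rv_support_subset_support_space: "rv_support M X \<subseteq> support_space M X"
  unfolding support_space_def by (rule hull_subset)

subsection \<open>Projection onto a closed subspace of a Hilbert space\<close>

text \<open>A sequence in \<open>S\<close> that minimises the distance to \<open>h\<close> is
  Cauchy, because midpoints stay in \<open>S\<close> and cannot be closer than the infimum. Its
  limit is a nearest point, and a nearest point has an orthogonal residual.\<close>

lemma closed_subspace_projection_exists:
  fixes S :: "'a::{real_inner, complete_space} set"
  assumes S: "subspace S" "closed S"
  shows "\<exists>p\<in>S. h - p \<in> orthogonal_comp S"
proof -
  define c where "c = (INF s\<in>S. (norm (h - s))\<^sup>2)"
  have ne: "S \<noteq> {}"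
    using S(1) subspace_0 by blast
  have bdd: "bdd_below ((\<lambda>s. (norm (h - s))\<^sup>2) ` S)"
    by (rule bdd_belowI[of _ 0]) auto
  have c_le: "c \<le> (norm (h - s))\<^sup>2" if "s \<in> S" for s
    unfolding c_def by (rule cINF_lower[OF bdd that])
  have "\<exists>s\<in>S. (norm (h - s))\<^sup>2 < c + 1 / real (Suc n)" for n
    using cINF_less_iff[OF ne bdd, of "c + 1 / real (Suc n)"] unfolding c_def by simp
  then obtain s where s: "\<And>n. s n \<in> S" "\<And>n. (norm (h - s n))\<^sup>2 < c + 1 / real (Suc n)"
    by metis
  have near: "(norm (s m - s n))\<^sup>2 \<le> 2 * (1 / real (Suc m) + 1 / real (Suc n))" for m n
  proof -
    have "(1/2) *\<^sub>R (s m + s n) \<in> S"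
      using s(1) S(1) by (simp add: subspace_add subspace_scale)
    then have mid: "4 * c \<le> 4 * (norm (h - (1/2) *\<^sub>R (s m + s n)))\<^sup>2"
      using c_le by simp
    \<comment> \<open>the parallelogram law for \<open>h - s m\<close> and \<open>h - s n\<close>\<close>
    have "(norm (s m - s n))\<^sup>2 = 2 * (norm (h - s m))\<^sup>2 + 2 * (norm (h - s n))\<^sup>2
        - 4 * (norm (h - (1/2) *\<^sub>R (s m + s n)))\<^sup>2"
      by (simp add: power2_norm_eq_inner inner_diff_left inner_diff_right inner_add_left inner_add_right
          inner_commute algebra_simps)
    then show ?thesis
      using mid s(2)[of m] s(2)[of n] by argo
  qed
  have "Cauchy s"
  proof (rule metric_CauchyI)
    fix e :: real assume "0 < e"
    then obtain N where N: "1 / real (Suc N) < e\<^sup>2 / 4"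
      using nat_approx_posE[of "e\<^sup>2 / 4"] by auto
    have "dist (s m) (s n) < e" if "N \<le> m" "N \<le> n" for m n
    proof -
      have "1 / real (Suc m) \<le> 1 / real (Suc N)" "1 / real (Suc n) \<le> 1 / real (Suc N)"
        using that by (simp_all add: frac_le)
      then have "(norm (s m - s n))\<^sup>2 < e\<^sup>2"
        using near[of m n] N by argo
      then show ?thesis
        using \<open>0 < e\<close> by (simp add: dist_norm power2_less_imp_less)
    qed
    then show "\<exists>M. \<forall>m\<ge>M. \<forall>n\<ge>M. dist (s m) (s n) < e"
      by blast
  qed
  then obtain p where p: "s \<longlonglongrightarrow> p"
    using Cauchy_convergent convergent_def by blast
  have "p \<in> S"
    using S(2) s(1) p by (rule closed_sequentially)
  have "(norm (h - p))\<^sup>2 \<le> c + 0"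
  proof (rule LIMSEQ_le)
    show "(\<lambda>n. (norm (h - s n))\<^sup>2) \<longlonglongrightarrow> (norm (h - p))\<^sup>2"
      using p by (intro tendsto_intros)
    show "(\<lambda>n. c + 1 / real (Suc n)) \<longlonglongrightarrow> c + 0"
      by (intro tendsto_intros LIMSEQ_Suc[OF lim_1_over_n])
    show "\<exists>N. \<forall>n\<ge>N. (norm (h - s n))\<^sup>2 \<le> c + 1 / real (Suc n)"
      using s(2) less_imp_le by blast
  qed
  have "inner y (h - p) = 0" if "y \<in> S" for y
  proof (cases "y = 0")
    case False
    \<comment> \<open>\<open>t *\<^sub>R y\<close> is the projection of \<open>h - p\<close> onto
      the line through \<open>y\<close>. Moving \<open>p\<close> by it would lower the squared
      distance by \<open>(inner y (h - p))\<^sup>2 / inner y y\<close>, so minimality forces this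
      gain to be 0.\<close>
    define t where "t = inner y (h - p) / inner y y"
    have "p + t *\<^sub>R y \<in> S"
      using \<open>p \<in> S\<close> that S(1) by (simp add: subspace_add subspace_scale)
    then have "(norm (h - p))\<^sup>2 \<le> (norm (h - (p + t *\<^sub>R y)))\<^sup>2"
      using c_le[OF \<open>p + t *\<^sub>R y \<in> S\<close>] \<open>(norm (h - p))\<^sup>2 \<le> c + 0\<close> by linarith
    also have "h - (p + t *\<^sub>R y) = (h - p) - t *\<^sub>R y"
      by simp
    also have "(norm ((h - p) - t *\<^sub>R y))\<^sup>2 = (norm (h - p))\<^sup>2 - 2 * t * inner y (h - p) + t * t * inner y y"
      unfolding power2_norm_eq_inner
      by (simp only: inner_diff_left[of "h - p"] inner_diff_right[of _ "h - p"] inner_scaleR_left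
          inner_scaleR_right inner_commute[of "h - p" y]) (simp add: algebra_simps)
    also have "t * t * inner y y = t * inner y (h - p)"
      using False by (simp add: t_def)
    finally have "(inner y (h - p))\<^sup>2 / inner y y \<le> 0"
      by (simp add: t_def power2_eq_square)
    moreover have "0 < inner y y"
      using False by simp
    ultimately show ?thesis
      by (auto simp: divide_le_0_iff)
  qed simp
  then show ?thesis
    using \<open>p \<in> S\<close> by (auto simp: orthogonal_comp_def real_inner_class.orthogonal_def)
qed

text \<open>\<open>orth_proj\<close> is a definite description, so existence and uniqueness must
  precede any use of it. For two candidates, their difference lies in \<open>S\<close> and is
  orthogonal to both residuals, hence to itself.\<close>

lemma orth_proj_in:
  assumes S: "subspace S" "closed S"
  shows "orth_proj S h \<in> S"
proof -
  have "\<exists>!p. p \<in> S \<and> h - p \<in> orthogonal_comp S"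
  proof (rule ex_ex1I)
    show "\<exists>p. p \<in> S \<and> h - p \<in> orthogonal_comp S"
      using closed_subspace_projection_exists[OF S] by blast
    fix p q assume p: "p \<in> S \<and> h - p \<in> orthogonal_comp S" and q: "q \<in> S \<and> h - q \<in> orthogonal_comp S"
    then have "p - q \<in> S"
      using S(1) by (simp add: subspace_diff)
    then have "inner (p - q) (h - q) = 0" "inner (p - q) (h - p) = 0"
      using p q by (auto simp: orthogonal_comp_def real_inner_class.orthogonal_def)
    then have "inner (p - q) (p - q) = 0"
      by (simp add: inner_diff_right)
    then show "p = q" by simp
  qed
  from theI'[OF this] show ?thesis
    unfolding orth_proj_def by blast
qed

subsection \<open>Inverse matrices\<close>

text \<open>This is Cramer's rule. It also covers singular matrices, since
  \<open>inverse 0 = 0\<close> reproduces the zero matrix of \<open>mat_inv\<close>. Every entry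
  thereby becomes a polynomial in the entries of \<open>A\<close> times the inverse of
  another.\<close>

lemma mat_inv_eq_adj_mat:
  assumes A: "A \<in> carrier_mat n n"
  shows "mat_inv A = inverse (Determinant.det A) \<cdot>\<^sub>m adj_mat A"
proof (cases "mat_inverse A")
  case None
  then have "A \<notin> Units (ring_mat TYPE(real) n ())"
    by (rule mat_inverse(1)[OF A])
  then have "Determinant.det A = 0"
    using det_non_zero_imp_unit[OF A, of "()"] by blast
  then show ?thesis
    using None A adj_mat(1)[OF A] by (auto simp: mat_inv_def intro!: eq_matI)
next
  case (Some B)
  then have B: "B * A = 1\<^sub>m n" "B \<in> carrier_mat n n"
    using mat_inverse(2)[OF A] by auto
  have "Determinant.det B * Determinant.det A = 1"
    using det_mult[OF B(2) A] B(1) by simp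
  then have det: "Determinant.det A \<noteq> 0"
    by auto
  have "adj_mat A = B * A * adj_mat A"
    using B A adj_mat(1)[OF A] by simp
  also have "\<dots> = B * (Determinant.det A \<cdot>\<^sub>m 1\<^sub>m n)"
    using assoc_mult_mat[OF B(2) A adj_mat(1)[OF A]] adj_mat(2)[OF A] by simp
  also have "\<dots> = Determinant.det A \<cdot>\<^sub>m B"
    using B by (simp add: mult_smult_distrib[of _ n n _ n])
  finally have "inverse (Determinant.det A) \<cdot>\<^sub>m adj_mat A = B"
    using det B(2) by (auto intro!: eq_matI)
  then show ?thesis
    using Some by (simp add: mat_inv_def)
qed

lemma mat_inv_carrier [simp]: "A \<in> carrier_mat n n \<Longrightarrow> mat_inv A \<in> carrier_mat n n"
  using mat_inv_eq_adj_mat[of A n] adj_mat(1)[of A n] by simp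

lemma index_mat_inv:
  assumes "A \<in> carrier_mat n n" "i < n" "j < n"
  shows "mat_inv A $$ (i, j) = inverse (Determinant.det A) * cofactor A j i"
  using assms mat_inv_eq_adj_mat[OF assms(1)] by (simp add: adj_mat_def)

lemma mat_inv_inverse:
  assumes A: "A \<in> carrier_mat n n" and det: "Determinant.det A \<noteq> 0"
  shows "mat_inv A * A = 1\<^sub>m n" "A * mat_inv A = 1\<^sub>m n"
proof -
  show "mat_inv A * A = 1\<^sub>m n"
    using adj_mat[OF A] det by (simp add: mat_inv_eq_adj_mat[OF A] mult_smult_assoc_mat[of _ n n _ n] A)
      (auto intro!: eq_matI)
  show "A * mat_inv A = 1\<^sub>m n"
    using adj_mat[OF A] det by (simp add: mat_inv_eq_adj_mat[OF A] mult_smult_distrib[of _ n n _ n] A)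
      (auto intro!: eq_matI)
qed

lemma det_neq_0_of_inverse:
  fixes A B :: "real mat"
  assumes A: "A \<in> carrier_mat n n" and B: "B \<in> carrier_mat n n" "B * A = 1\<^sub>m n"
  shows "Determinant.det A \<noteq> 0"
  using det_mult[OF B(1) A] B(2) by auto

lemma mat_inv_unique:
  assumes A: "A \<in> carrier_mat n n" and B: "B \<in> carrier_mat n n" "B * A = 1\<^sub>m n"
  shows "mat_inv A = B"
proof -
  note inv = mat_inv_inverse(2)[OF A det_neq_0_of_inverse[OF A B]]
  have "mat_inv A = B * A * mat_inv A"
    using B(2) left_mult_one_mat[OF mat_inv_carrier[OF A]] by simp
  also have "\<dots> = B"
    using assoc_mult_mat[OF B(1) A mat_inv_carrier[OF A]] inv B(1) by simp
  finally show ?thesis .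
qed

lemma invertible_mat_iff_det:
  fixes A :: "real mat"
  assumes A: "A \<in> carrier_mat n n"
  shows "invertible_mat A \<longleftrightarrow> Determinant.det A \<noteq> 0"
proof
  assume "invertible_mat A"
  then obtain B where B: "A * B = 1\<^sub>m n" "B * A = 1\<^sub>m (dim_row B)"
    using A by (auto simp: invertible_mat_def inverts_mat_def)
  have "dim_col B = n"
    using arg_cong[OF B(1), of dim_col] by simp
  moreover have "dim_row B = n"
    using arg_cong[OF B(2), of dim_col] A by simp
  ultimately show "Determinant.det A \<noteq> 0"
    using det_neq_0_of_inverse[OF A, of B] B by auto
next
  assume "Determinant.det A \<noteq> 0"
  then show "invertible_mat A"
    using mat_inv_inverse[OF A] carrier_matD[OF mat_inv_carrier[OF A]] A
    unfolding invertible_mat_def inverts_mat_def by (auto intro!: exI[of _ "mat_inv A"])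
qed

lemma mat_inv_smult:
  assumes A: "A \<in> carrier_mat n n" and "Determinant.det A \<noteq> 0" and "c \<noteq> 0"
  shows "mat_inv (c \<cdot>\<^sub>m A) = inverse c \<cdot>\<^sub>m mat_inv A"
proof (rule mat_inv_unique[of _ n])
  have "inverse c \<cdot>\<^sub>m mat_inv A * (c \<cdot>\<^sub>m A) = inverse c \<cdot>\<^sub>m (c \<cdot>\<^sub>m (mat_inv A * A))"
    unfolding mult_smult_assoc_mat[OF mat_inv_carrier[OF A] smult_carrier_mat[OF A]]
      mult_smult_distrib[OF mat_inv_carrier[OF A] A] ..
  then show "inverse c \<cdot>\<^sub>m mat_inv A * (c \<cdot>\<^sub>m A) = 1\<^sub>m n"
    using assms mat_inv_inverse(1)[OF A] by (auto intro!: eq_matI)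
qed (use A in simp_all)

lemma mat_delete_entry:
  assumes "A \<in> carrier_mat n n" "k < n - 1" "l < n - 1"
  shows "mat_delete A i j $$ (k, l) = A $$ (if k < i then k else Suc k, if l < j then l else Suc l)"
  using assms by (simp add: mat_delete_def)

lemma tendsto_det:
  fixes A :: "nat \<Rightarrow> real mat"
  assumes A: "\<And>m. A m \<in> carrier_mat n n" "B \<in> carrier_mat n n"
    and lim: "\<And>i j. i < n \<Longrightarrow> j < n \<Longrightarrow> (\<lambda>m. A m $$ (i, j)) \<longlonglongrightarrow> B $$ (i, j)"
  shows "(\<lambda>m. Determinant.det (A m)) \<longlonglongrightarrow> Determinant.det B"
  unfolding det_def'[OF A(1)] det_def'[OF A(2)]
  by (intro tendsto_intros lim) (auto simp: permutes_in_image)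

text \<open>Cofactors and determinants are continuous in the entries. Only the limit has to be
  invertible; individual matrices \<open>A m\<close> may be singular.\<close>

lemma tendsto_mat_inv:
  fixes A :: "nat \<Rightarrow> real mat"
  assumes A: "\<And>m. A m \<in> carrier_mat n n" "B \<in> carrier_mat n n"
    and lim: "\<And>i j. i < n \<Longrightarrow> j < n \<Longrightarrow> (\<lambda>m. A m $$ (i, j)) \<longlonglongrightarrow> B $$ (i, j)"
    and det: "Determinant.det B \<noteq> 0" and ij: "i < n" "j < n"
  shows "(\<lambda>m. mat_inv (A m) $$ (i, j)) \<longlonglongrightarrow> mat_inv B $$ (i, j)"
proof -
  have "(\<lambda>m. Determinant.det (mat_delete (A m) j i)) \<longlonglongrightarrow> Determinant.det (mat_delete B j i)"
  proof (rule tendsto_det[of _ "n - 1"])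
    show "(\<lambda>m. mat_delete (A m) j i $$ (k, l)) \<longlonglongrightarrow> mat_delete B j i $$ (k, l)"
      if "k < n - 1" "l < n - 1" for k l
      unfolding mat_delete_entry[OF A(1) that] mat_delete_entry[OF A(2) that]
      using that by (intro lim) auto
  qed (rule mat_delete_carrier[OF A(1)], rule mat_delete_carrier[OF A(2)])
  moreover have "(\<lambda>m. Determinant.det (A m)) \<longlonglongrightarrow> Determinant.det B"
    by (rule tendsto_det[OF A lim])
  ultimately show ?thesis
    unfolding index_mat_inv[OF A(1) ij] index_mat_inv[OF A(2) ij] cofactor_def
    by (intro tendsto_intros det)
qed

lemma measurable_det:
  fixes A :: "'a \<Rightarrow> real mat"
  assumes A: "\<And>\<omega>. A \<omega> \<in> carrier_mat n n"
    and meas: "\<And>i j. i < n \<Longrightarrow> j < n \<Longrightarrow> (\<lambda>\<omega>. A \<omega> $$ (i, j)) \<in> borel_measurable M"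
  shows "(\<lambda>\<omega>. Determinant.det (A \<omega>)) \<in> borel_measurable M"
  unfolding det_def'[OF A]
  by (intro borel_measurable_sum borel_measurable_times borel_measurable_const borel_measurable_prod meas)
    (auto simp: permutes_in_image)

text \<open>No exceptional set is excluded, because \<open>inverse\<close> with
  \<open>inverse 0 = 0\<close> is Borel measurable on all reals.\<close>

lemma measurable_mat_inv:
  fixes A :: "'a \<Rightarrow> real mat"
  assumes A: "\<And>\<omega>. A \<omega> \<in> carrier_mat n n"
    and meas: "\<And>i j. i < n \<Longrightarrow> j < n \<Longrightarrow> (\<lambda>\<omega>. A \<omega> $$ (i, j)) \<in> borel_measurable M"
    and ij: "i < n" "j < n"
  shows "(\<lambda>\<omega>. mat_inv (A \<omega>) $$ (i, j)) \<in> borel_measurable M"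
proof -
  have "(\<lambda>\<omega>. Determinant.det (mat_delete (A \<omega>) j i)) \<in> borel_measurable M"
  proof (rule measurable_det[of _ "n - 1"])
    show "(\<lambda>\<omega>. mat_delete (A \<omega>) j i $$ (k, l)) \<in> borel_measurable M"
      if "k < n - 1" "l < n - 1" for k l
      unfolding mat_delete_entry[OF A that] using that by (intro meas) auto
  qed (rule mat_delete_carrier[OF A])
  moreover have "(\<lambda>\<omega>. Determinant.det (A \<omega>)) \<in> borel_measurable M"
    by (rule measurable_det[OF A meas])
  ultimately show ?thesis
    unfolding index_mat_inv[OF A ij] cofactor_def
    by (intro borel_measurable_times borel_measurable_inverse borel_measurable_const)
qed

subsection \<open>Least squares algebra\<close>

text \<open>For an invertible Gram matrix this is the Moore-Penrose inverse of \<open>A\<close>; row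
  \<open>k\<close> lists the weights of the observations in the coordinate \<open>k\<close>.\<close>

definition ls_weights :: "real mat \<Rightarrow> real mat" where
  "ls_weights A = mat_inv (gram A) * transpose_mat A"

context
  fixes A :: "real mat" and n d :: nat
  assumes A: "A \<in> carrier_mat n d"
begin

lemma gram_carrier: "gram A \<in> carrier_mat d d"
  using A by (simp add: gram_def)

lemma index_gram: "j < d \<Longrightarrow> k < d \<Longrightarrow> gram A $$ (j, k) = (\<Sum>i<n. A $$ (i, j) * A $$ (i, k))"
  using A by (simp add: gram_def scalar_prod_def lessThan_atLeast0)

lemma transpose_gram: "transpose_mat (gram A) = gram A"
  using A by (simp add: gram_def transpose_mult[of _ d n _ d])

lemma ls_weights_carrier: "ls_weights A \<in> carrier_mat d n"
  using A mat_inv_carrier[OF gram_carrier] by (simp add: ls_weights_def)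

lemma index_ls_weights:
  "k < d \<Longrightarrow> i < n \<Longrightarrow> ls_weights A $$ (k, i) = (\<Sum>j<d. mat_inv (gram A) $$ (k, j) * A $$ (i, j))"
  using A mat_inv_carrier[OF gram_carrier]
  by (simp add: ls_weights_def scalar_prod_def lessThan_atLeast0)

lemma ls_coords_carrier: "ls_coords A v \<in> carrier_vec d"
  using carrier_matD(1)[OF ls_weights_carrier]
  by (intro carrier_vecI) (simp add: ls_coords_def ls_weights_def[symmetric])

lemma index_ls_coords:
  assumes "k < d" "v \<in> carrier_vec n"
  shows "vec_index (ls_coords A v) k = (\<Sum>i<n. ls_weights A $$ (k, i) * vec_index v i)"
  using assms ls_weights_carrier
  by (simp add: ls_coords_def ls_weights_def[symmetric] scalar_prod_def lessThan_atLeast0)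

text \<open>In this form the sums over the observations stand alone, so they can be divided by
  \<open>n\<close> and treated by laws of large numbers.\<close>

lemma index_ls_coords_gram:
  assumes k: "k < d" and v: "v \<in> carrier_vec n"
  shows "vec_index (ls_coords A v) k
    = (\<Sum>j<d. mat_inv (gram A) $$ (k, j) * (\<Sum>i<n. A $$ (i, j) * vec_index v i))"
proof -
  have "vec_index (ls_coords A v) k
      = (\<Sum>i<n. \<Sum>j<d. mat_inv (gram A) $$ (k, j) * A $$ (i, j) * vec_index v i)"
    using index_ls_coords[OF assms] k by (simp add: index_ls_weights sum_distrib_right)
  then show ?thesis
    by (subst (asm) sum.swap) (simp add: sum_distrib_left mult.assoc)
qed

context
  assumes inv: "invertible_mat (gram A)"
begin

lemma mat_inv_gram: "mat_inv (gram A) * gram A = 1\<^sub>m d" "gram A * mat_inv (gram A) = 1\<^sub>m d"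
  using mat_inv_inverse[OF gram_carrier] inv invertible_mat_iff_det[OF gram_carrier] by auto

lemma transpose_mat_inv_gram: "transpose_mat (mat_inv (gram A)) = mat_inv (gram A)"
proof -
  have "transpose_mat (mat_inv (gram A)) * gram A = transpose_mat (gram A * mat_inv (gram A))"
    using transpose_mult[OF gram_carrier mat_inv_carrier[OF gram_carrier]] transpose_gram by simp
  then have "transpose_mat (mat_inv (gram A)) * gram A = 1\<^sub>m d"
    using mat_inv_gram(2) by simp
  then show ?thesis
    using mat_inv_unique[OF gram_carrier, of "transpose_mat (mat_inv (gram A))"]
      mat_inv_carrier[OF gram_carrier] by simp
qed

lemma ls_weights_left_inverse: "ls_weights A * A = 1\<^sub>m d"
proof -
  have "ls_weights A * A = mat_inv (gram A) * (transpose_mat A * A)"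
    unfolding ls_weights_def
    by (rule assoc_mult_mat[OF mat_inv_carrier[OF gram_carrier] _ A]) (use A in simp)
  then show ?thesis
    using mat_inv_gram(1) by (simp add: gram_def)
qed

text \<open>The inverse Gram matrix is symmetric, so one of its two copies cancels against the Gram
  matrix in the middle. The covariance formula comes from this identity.\<close>

lemma ls_weights_mult_transpose: "ls_weights A * transpose_mat (ls_weights A) = mat_inv (gram A)"
proof -
  note G = mat_inv_carrier[OF gram_carrier]
  have "transpose_mat (ls_weights A) = A * mat_inv (gram A)"
    unfolding ls_weights_def using A transpose_mult[OF G, of "transpose_mat A" n] transpose_mat_inv_gram by simp
  then have "ls_weights A * transpose_mat (ls_weights A) = ls_weights A * A * mat_inv (gram A)"
    using assoc_mult_mat[OF ls_weights_carrier A G] by simp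
  then show ?thesis
    using ls_weights_left_inverse G by simp
qed

lemma sum_ls_weights_mult:
  assumes "j < d" "k < d"
  shows "(\<Sum>i<n. ls_weights A $$ (j, i) * ls_weights A $$ (k, i)) = mat_inv (gram A) $$ (j, k)"
  using assms ls_weights_carrier unfolding ls_weights_mult_transpose[symmetric]
  by (simp add: scalar_prod_def lessThan_atLeast0)

lemma ls_coords_mult_mat_vec:
  assumes "b \<in> carrier_vec d"
  shows "ls_coords A (A *\<^sub>v b) = b"
  unfolding ls_coords_def ls_weights_def[symmetric]
  using assoc_mult_mat_vec[OF ls_weights_carrier A assms] ls_weights_left_inverse assms by simp

text \<open>These are the normal equations: the residual is orthogonal to every column of
  \<open>A\<close>.\<close>

lemma gram_mult_ls_coords:
  assumes v: "v \<in> carrier_vec n"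
  shows "gram A *\<^sub>v ls_coords A v = transpose_mat A *\<^sub>v v"
proof -
  have "gram A *\<^sub>v ls_coords A v = (gram A * ls_weights A) *\<^sub>v v"
    unfolding ls_coords_def ls_weights_def[symmetric]
    using assoc_mult_mat_vec[OF gram_carrier ls_weights_carrier v] by simp
  also have "gram A * ls_weights A = (gram A * mat_inv (gram A)) * transpose_mat A"
    unfolding ls_weights_def using A
    by (intro assoc_mult_mat[symmetric, OF gram_carrier mat_inv_carrier[OF gram_carrier]]) simp
  finally show ?thesis
    using A mat_inv_gram(2) by simp
qed

lemma mult_mat_vec_eq_0:
  assumes w: "w \<in> carrier_vec d" and "A *\<^sub>v w = 0\<^sub>v n"
  shows "w = 0\<^sub>v d"
proof -
  have "w = ls_coords A (A *\<^sub>v w)"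
    using ls_coords_mult_mat_vec[OF w] by simp
  also have "\<dots> = 0\<^sub>v d"
    using assms(2) ls_weights_carrier by (auto simp: ls_coords_def ls_weights_def[symmetric])
  finally show ?thesis .
qed

text \<open>The normal equations kill the cross term between the residual and a vector of the column
  space.\<close>

lemma least_squares_pythagoras:
  assumes y: "y \<in> carrier_vec n" and v: "v \<in> carrier_vec d"
  shows "(\<Sum>i<n. (vec_index y i - vec_index (A *\<^sub>v v) i)\<^sup>2)
    = (\<Sum>i<n. (vec_index y i - vec_index (A *\<^sub>v ls_coords A y) i)\<^sup>2)
      + (\<Sum>i<n. (vec_index (A *\<^sub>v (v - ls_coords A y)) i)\<^sup>2)"
proof -
  note b = ls_coords_carrier[of y]
  define r where "r = y - A *\<^sub>v ls_coords A y"
  define w where "w = v - ls_coords A y"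
  have r: "r \<in> carrier_vec n" and w: "w \<in> carrier_vec d"
    using y v b A by (auto simp: r_def w_def)
  have At: "transpose_mat A \<in> carrier_mat d n"
    using A by simp
  have "transpose_mat A *\<^sub>v r = transpose_mat A *\<^sub>v y - transpose_mat A *\<^sub>v (A *\<^sub>v ls_coords A y)"
    unfolding r_def using At A y b by (intro mult_minus_distrib_mat_vec[of _ d n]) auto
  also have "transpose_mat A *\<^sub>v (A *\<^sub>v ls_coords A y) = gram A *\<^sub>v ls_coords A y"
    unfolding gram_def using assoc_mult_mat_vec[OF At A b] by simp
  also have "transpose_mat A *\<^sub>v y - \<dots> = 0\<^sub>v d"
    using gram_mult_ls_coords[OF y] minus_cancel_vec[OF mult_mat_vec_carrier[OF At y]] by simp
  finally have "Matrix.scalar_prod r (A *\<^sub>v w) = 0"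
    using transpose_vec_mult_scalar[OF A w r] w by simp
  then have orth: "(\<Sum>i<n. vec_index r i * vec_index (A *\<^sub>v w) i) = 0"
    using A by (simp add: scalar_prod_def lessThan_atLeast0)
  have "A *\<^sub>v w = A *\<^sub>v v - A *\<^sub>v ls_coords A y"
    unfolding w_def using A v b by (intro mult_minus_distrib_mat_vec[of _ n d]) auto
  then have "vec_index y i - vec_index (A *\<^sub>v v) i = vec_index r i - vec_index (A *\<^sub>v w) i" if "i < n" for i
    using that A y by (simp add: r_def)
  then have "(\<Sum>i<n. (vec_index y i - vec_index (A *\<^sub>v v) i)\<^sup>2)
      = (\<Sum>i<n. (vec_index r i)\<^sup>2 + (vec_index (A *\<^sub>v w) i)\<^sup>2 - 2 * (vec_index r i * vec_index (A *\<^sub>v w) i))"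
    by (intro sum.cong) (auto simp: power2_diff)
  also have "\<dots> = (\<Sum>i<n. (vec_index r i)\<^sup>2) + (\<Sum>i<n. (vec_index (A *\<^sub>v w) i)\<^sup>2)"
    using orth by (simp add: sum_subtractf sum.distrib sum_distrib_left[symmetric])
  also have "(\<Sum>i<n. (vec_index r i)\<^sup>2) = (\<Sum>i<n. (vec_index y i - vec_index (A *\<^sub>v ls_coords A y) i)\<^sup>2)"
    using A by (intro sum.cong) (auto simp: r_def)
  finally show ?thesis
    by (simp add: w_def)
qed

end

end

section \<open>From coordinates to minimisation over the spanned subspace\<close>

lemma index_mult_mat_vec_sum:
  assumes "A \<in> carrier_mat n d" "v \<in> carrier_vec d" "i < n"
  shows "vec_index (A *\<^sub>v v) i = (\<Sum>j<d. A $$ (i, j) * vec_index v j)"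
  using assms by (simp add: scalar_prod_def lessThan_atLeast0)

lemma design_matrix_carrier: "design_matrix \<phi> d xs n \<in> carrier_mat n d"
  by (simp add: design_matrix_def)

lemma index_design_matrix: "i < n \<Longrightarrow> j < d \<Longrightarrow> design_matrix \<phi> d xs n $$ (i, j) = inner (xs i) (\<phi> j)"
  by (simp add: design_matrix_def)

lemma inner_lin_comb:
  assumes "v \<in> carrier_vec d" "i < n"
  shows "inner (xs i) (lin_comb \<phi> v) = vec_index (design_matrix \<phi> d xs n *\<^sub>v v) i"
  using assms unfolding index_mult_mat_vec_sum[OF design_matrix_carrier assms]
  by (simp add: lin_comb_def inner_sum_right index_design_matrix mult.commute)

lemma span_eq_lin_combs: "span (\<phi> ` {..<d}) = lin_comb \<phi> ` carrier_vec d"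
proof (rule equalityI)
  have "subspace (lin_comb \<phi> ` carrier_vec d)"
    unfolding subspace_def
  proof (intro conjI ballI allI)
    show "0 \<in> lin_comb \<phi> ` carrier_vec d"
      by (rule image_eqI[of _ _ "0\<^sub>v d"]) (auto simp: lin_comb_def)
    show "a + b \<in> lin_comb \<phi> ` carrier_vec d"
      if ab: "a \<in> lin_comb \<phi> ` carrier_vec d" "b \<in> lin_comb \<phi> ` carrier_vec d" for a b
    proof -
      obtain u v where uv: "u \<in> carrier_vec d" "v \<in> carrier_vec d" "a = lin_comb \<phi> u" "b = lin_comb \<phi> v"
        using ab by auto
      then have "a + b = lin_comb \<phi> (u + v)"
        by (auto simp: lin_comb_def scaleR_add_left sum.distrib)
      then show ?thesis
        using uv(1,2) by (intro image_eqI[of _ _ "u + v"]) auto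
    qed
    show "c *\<^sub>R a \<in> lin_comb \<phi> ` carrier_vec d" if a: "a \<in> lin_comb \<phi> ` carrier_vec d" for c a
    proof -
      obtain u where u: "u \<in> carrier_vec d" "a = lin_comb \<phi> u"
        using a by auto
      then have "c *\<^sub>R a = lin_comb \<phi> (c \<cdot>\<^sub>v u)"
        by (auto simp: lin_comb_def scaleR_sum_right)
      then show ?thesis
        using u(1) by (intro image_eqI[of _ _ "c \<cdot>\<^sub>v u"]) auto
    qed
  qed
  moreover have "\<phi> k \<in> lin_comb \<phi> ` carrier_vec d" if "k < d" for k
  proof (rule image_eqI)
    have "lin_comb \<phi> (unit_vec d k) = (\<Sum>j<d. if j = k then \<phi> j else 0)"
      unfolding lin_comb_def by (intro sum.cong) (auto simp: that)
    then show "\<phi> k = lin_comb \<phi> (unit_vec d k)"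
      using that by simp
  qed simp
  ultimately show "span (\<phi> ` {..<d}) \<subseteq> lin_comb \<phi> ` carrier_vec d"
    by (intro span_minimal) auto
  show "lin_comb \<phi> ` carrier_vec d \<subseteq> span (\<phi> ` {..<d})"
    by (rule image_subsetI) (auto simp: lin_comb_def intro: span_sum span_scale span_base)
qed

text \<open>By Pythagoras any competitor adds the squared length of
  \<open>?A *\<^sub>v (v - c)\<close>, which is 0 only for \<open>v = c\<close> since
  \<open>?A\<close> has a left inverse. Uniqueness matters because \<open>ls_estimator\<close> picks
  a minimiser by choice.\<close>

theorem is_arg_min_rss_iff:
  assumes inv: "invertible_mat (gram (design_matrix \<phi> d xs n))"
  shows "is_arg_min (rss xs ys n) (\<lambda>b. b \<in> span (\<phi> ` {..<d})) b
    \<longleftrightarrow> b = lin_comb \<phi> (ls_coords (design_matrix \<phi> d xs n) (Matrix.vec n ys))"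
proof -
  let ?A = "design_matrix \<phi> d xs n"
  note A = design_matrix_carrier[of \<phi> d xs n]
  define c where "c = ls_coords ?A (Matrix.vec n ys)"
  have c: "c \<in> carrier_vec d"
    unfolding c_def by (rule ls_coords_carrier[OF A])
  have rss: "rss xs ys n (lin_comb \<phi> v) = rss xs ys n (lin_comb \<phi> c)
      + (\<Sum>i<n. (vec_index (?A *\<^sub>v (v - c)) i)\<^sup>2)" if v: "v \<in> carrier_vec d" for v
  proof -
    have "rss xs ys n (lin_comb \<phi> u) = (\<Sum>i<n. (vec_index (Matrix.vec n ys) i - vec_index (?A *\<^sub>v u) i)\<^sup>2)"
      if "u \<in> carrier_vec d" for u
      unfolding rss_def by (intro sum.cong) (auto simp: inner_lin_comb[OF that])
    then show ?thesis
      using least_squares_pythagoras[OF A inv _ v, of "Matrix.vec n ys"] v c by (simp add: c_def)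
  qed
  have min: "rss xs ys n (lin_comb \<phi> c) \<le> rss xs ys n (lin_comb \<phi> v)" if "v \<in> carrier_vec d" for v
    using rss[OF that] by (simp add: sum_nonneg)
  show ?thesis
    unfolding c_def[symmetric] span_eq_lin_combs
  proof
    assume "b = lin_comb \<phi> c"
    then show "is_arg_min (rss xs ys n) (\<lambda>b. b \<in> lin_comb \<phi> ` carrier_vec d) b"
      using c min by (auto simp: is_arg_min_def not_less)
  next
    assume *: "is_arg_min (rss xs ys n) (\<lambda>b. b \<in> lin_comb \<phi> ` carrier_vec d) b"
    then obtain v where v: "v \<in> carrier_vec d" "b = lin_comb \<phi> v"
      by (auto simp: is_arg_min_def)
    have "rss xs ys n (lin_comb \<phi> v) \<le> rss xs ys n (lin_comb \<phi> c)"
      using * c v by (auto simp: is_arg_min_def not_less)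
    then have "(\<Sum>i<n. (vec_index (?A *\<^sub>v (v - c)) i)\<^sup>2) = 0"
      using rss[OF v(1)] by (simp add: sum_nonneg antisym)
    then have "vec_index (?A *\<^sub>v (v - c)) i = 0" if "i < n" for i
      using that by (simp add: sum_nonneg_eq_0_iff)
    then have "?A *\<^sub>v (v - c) = 0\<^sub>v n"
      using A by (intro eq_vecI) auto
    then have "v - c = 0\<^sub>v d"
      using mult_mat_vec_eq_0[OF A inv] v c by auto
    then have "vec_index v i - vec_index c i = 0" if "i < d" for i
    proof -
      have "vec_index (v - c) i = 0"
        using \<open>v - c = 0\<^sub>v d\<close> that by simp
      then show ?thesis
        using that c by auto
    qed
    then have "v = c"
      using v c by (intro eq_vecI) auto
    then show "b = lin_comb \<phi> c"
      using v by simp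
  qed
qed

text \<open>Dividing both the Gram matrix and the sums against the response by \<open>n\<close>
  leaves the solution unchanged, and both quotients are convergent averages. The response is
  arbitrary, so that bias and noise are instances with different \<open>r\<close>.\<close>

lemma ls_coords_tendsto:
  fixes A :: "nat \<Rightarrow> real mat"
  assumes A: "\<And>n. A n \<in> carrier_mat n d" and v: "\<And>n. v n \<in> carrier_vec n"
    and Q: "Q \<in> carrier_mat d d" "Determinant.det Q \<noteq> 0" and r: "r \<in> carrier_vec d"
    and limQ: "\<And>j k. j < d \<Longrightarrow> k < d \<Longrightarrow> (\<lambda>n. (\<Sum>i<n. A n $$ (i, j) * A n $$ (i, k)) / real n) \<longlonglongrightarrow> Q $$ (j, k)"
    and limr: "\<And>j. j < d \<Longrightarrow> (\<lambda>n. (\<Sum>i<n. A n $$ (i, j) * vec_index (v n) i) / real n) \<longlonglongrightarrow> vec_index r j"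
  shows "\<forall>\<^sub>F n in sequentially. invertible_mat (gram (A n))"
    and "k < d \<Longrightarrow> (\<lambda>n. vec_index (ls_coords (A n) (v n)) k) \<longlonglongrightarrow> vec_index (mat_inv Q *\<^sub>v r) k"
proof -
  define B where "B n = inverse (real n) \<cdot>\<^sub>m gram (A n)" for n
  have B: "B n \<in> carrier_mat d d" for n
    using gram_carrier[OF A] by (simp add: B_def)
  have limB: "(\<lambda>n. B n $$ (j, k)) \<longlonglongrightarrow> Q $$ (j, k)" if "j < d" "k < d" for j k
    using limQ[OF that] carrier_matD[OF gram_carrier[OF A]] that
    by (simp add: B_def index_gram[OF A] field_simps)
  have "\<forall>\<^sub>F n in sequentially. Determinant.det (B n) \<noteq> 0"
    using tendsto_imp_eventually_ne[OF tendsto_det[OF B Q(1) limB] Q(2)] .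
  \<comment> \<open>\<open>n > 0\<close> is kept because \<open>B 0\<close> rests on
    \<open>inverse 0 = 0\<close>, and rescaling by \<open>mat_inv_smult\<close> needs a nonzero
    factor.\<close>
  then have good: "\<forall>\<^sub>F n in sequentially. n > 0 \<and> Determinant.det (gram (A n)) \<noteq> 0"
    using eventually_gt_at_top[of 0] by eventually_elim (auto simp: B_def)
  then show "\<forall>\<^sub>F n in sequentially. invertible_mat (gram (A n))"
    by eventually_elim (use invertible_mat_iff_det[OF gram_carrier[OF A]] in blast)
  show "(\<lambda>n. vec_index (ls_coords (A n) (v n)) k) \<longlonglongrightarrow> vec_index (mat_inv Q *\<^sub>v r) k" if k: "k < d"
  proof (rule Lim_transform_eventually)
    have "(\<lambda>n. \<Sum>j<d. mat_inv (B n) $$ (k, j) * ((\<Sum>i<n. A n $$ (i, j) * vec_index (v n) i) / real n))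
        \<longlonglongrightarrow> (\<Sum>j<d. mat_inv Q $$ (k, j) * vec_index r j)"
      using k by (intro tendsto_intros tendsto_mat_inv[OF B Q(1) limB Q(2)] limr) auto
    then show "(\<lambda>n. \<Sum>j<d. mat_inv (B n) $$ (k, j) * ((\<Sum>i<n. A n $$ (i, j) * vec_index (v n) i) / real n))
        \<longlonglongrightarrow> vec_index (mat_inv Q *\<^sub>v r) k"
      by (simp add: index_mult_mat_vec_sum[OF mat_inv_carrier[OF Q(1)] r k])
    show "\<forall>\<^sub>F n in sequentially.
        (\<Sum>j<d. mat_inv (B n) $$ (k, j) * ((\<Sum>i<n. A n $$ (i, j) * vec_index (v n) i) / real n))
        = vec_index (ls_coords (A n) (v n)) k"
      using good
    proof eventually_elim
      case (elim n)
      then have "mat_inv (B n) = real n \<cdot>\<^sub>m mat_inv (gram (A n))"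
        using mat_inv_smult[OF gram_carrier[OF A], of n "inverse (real n)"] by (simp add: B_def)
      then have "mat_inv (B n) $$ (k, j) = real n * mat_inv (gram (A n)) $$ (k, j)" if "j < d" for j
        using that k mat_inv_carrier[OF gram_carrier[OF A], of n] by simp
      then show ?case
        using elim by (simp add: index_ls_coords_gram[OF A k v])
    qed
  qed
qed

subsection \<open>Sampling\<close>

text \<open>Values lie in any separable Hilbert space, since these facts about sampling use nothing
  specific to functions on the line.\<close>

locale centred_sample = prob_space M for M :: "'w measure" +
  fixes X :: "'w \<Rightarrow> 'h::{real_inner, banach, second_countable_topology}"
    and x :: "nat \<Rightarrow> 'w \<Rightarrow> 'h" and \<epsilon> :: "nat \<Rightarrow> 'w \<Rightarrow> real" and \<sigma> :: real
  assumes X_meas [measurable]: "X \<in> borel_measurable M"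
    and X_sq: "integrable M (\<lambda>\<omega>. (norm (X \<omega>))\<^sup>2)" and X_mean: "(LINT \<omega>|M. X \<omega>) = 0"
    and x_indep: "indep_vars (\<lambda>_. borel) x UNIV"
    and x_distr: "\<And>i. distr M borel (x i) = distr M borel X"
    and eps_meas [measurable]: "\<And>i. \<epsilon> i \<in> borel_measurable M"
    and x_eps_indep: "indep_set (sets (family_algebra M UNIV x)) (sets (family_algebra M UNIV \<epsilon>))"
    and eps_sq: "\<And>i. integrable M (\<lambda>\<omega>. (\<epsilon> i \<omega>)\<^sup>2)"
    and eps_mean: "\<And>i. expectation (\<epsilon> i) = 0"
    and eps_var: "\<And>i. variance (\<epsilon> i) = \<sigma>\<^sup>2"
begin

lemma x_meas [measurable]: "x i \<in> borel_measurable M"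
  using x_indep by (simp add: indep_vars_def)

lemma x_algebra: "subalgebra M (family_algebra M I x)"
  by (rule subalgebra_family_algebra) simp_all

lemma eps_algebra: "subalgebra M (family_algebra M I \<epsilon>)"
  by (rule subalgebra_family_algebra) simp_all

lemma x_meas_algebra: "x i \<in> borel_measurable (family_algebra M UNIV x)"
  by (rule measurable_family_algebra) simp

lemma eps_meas_algebra: "\<epsilon> i \<in> borel_measurable (family_algebra M UNIV \<epsilon>)"
  by (rule measurable_family_algebra) simp

lemma eps_int: "integrable M (\<epsilon> i)"
  by (rule square_integrable_imp_integrable[OF eps_meas eps_sq])

lemma eps_mult_int: "integrable M (\<lambda>\<omega>. \<epsilon> i \<omega> * \<epsilon> j \<omega>)"
  by (intro integrable_mult_of_squares eps_sq eps_meas)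

lemma eps_second_moment: "expectation (\<lambda>\<omega>. (\<epsilon> i \<omega>)\<^sup>2) = \<sigma>\<^sup>2"
  using eps_var[of i] by (simp add: eps_mean)

lemma AE_x_iff:
  assumes "Measurable.pred borel P"
  shows "(AE \<omega> in M. P (x i \<omega>)) \<longleftrightarrow> (AE \<omega> in M. P (X \<omega>))"
proof -
  have "{h \<in> space borel. P h} \<in> sets borel"
    using assms by (simp add: pred_def)
  then show ?thesis
    using AE_distr_iff[OF x_meas, of P i] AE_distr_iff[OF X_meas, of P] x_distr[of i]
    by (simp only: simp_thms)
qed

lemma distr_x:
  assumes [measurable]: "f \<in> borel_measurable borel"
  shows "distr M borel (\<lambda>\<omega>. f (x i \<omega>)) = distr M borel (\<lambda>\<omega>. f (X \<omega>))"
  using distr_distr[OF assms x_meas, of i] distr_distr[OF assms X_meas] x_distr[of i] by (simp add: comp_def)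

lemma integral_x:
  fixes f :: "'h \<Rightarrow> real"
  assumes [measurable]: "f \<in> borel_measurable borel"
  shows "expectation (\<lambda>\<omega>. f (x i \<omega>)) = expectation (\<lambda>\<omega>. f (X \<omega>))"
  by (rule integral_of_distr_eq[OF _ _ distr_x]) simp_all

lemma integrable_x:
  fixes f :: "'h \<Rightarrow> real"
  assumes [measurable]: "f \<in> borel_measurable borel" and "integrable M (\<lambda>\<omega>. f (X \<omega>))"
  shows "integrable M (\<lambda>\<omega>. f (x i \<omega>))"
  by (rule integrable_of_distr_eq[OF _ _ distr_x]) (use assms in simp_all)

lemma X_int: "integrable M X"
proof (rule Bochner_Integration.integrable_bound)
  show "integrable M (\<lambda>\<omega>. norm (X \<omega>))"
    by (rule square_integrable_imp_integrable) (use X_sq in simp_all)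
qed simp_all

lemma X_inner_sq: "integrable M (\<lambda>\<omega>. (inner (X \<omega>) a)\<^sup>2)"
proof (rule Bochner_Integration.integrable_bound)
  show "integrable M (\<lambda>\<omega>. (norm (X \<omega>))\<^sup>2 * (norm a)\<^sup>2)"
    using X_sq by simp
  have "(inner h a)\<^sup>2 \<le> (norm h)\<^sup>2 * (norm a)\<^sup>2" for h
    using power_mono[OF Cauchy_Schwarz_ineq2[of h a], of 2] by (simp add: power_mult_distrib)
  then show "AE \<omega> in M. norm ((inner (X \<omega>) a)\<^sup>2) \<le> norm ((norm (X \<omega>))\<^sup>2 * (norm a)\<^sup>2)"
    by simp
qed simp

lemma X_inner_mult_int: "integrable M (\<lambda>\<omega>. inner (X \<omega>) a * inner (X \<omega>) b)"
  by (intro integrable_mult_of_squares X_inner_sq) simp_all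

lemma X_inner_mean: "expectation (\<lambda>\<omega>. inner (X \<omega>) a) = 0"
  using integral_inner_left[OF X_int, of a] X_mean by simp

lemma x_inner_int: "integrable M (\<lambda>\<omega>. inner (x i \<omega>) a)"
  by (rule integrable_x[of "\<lambda>h. inner h a"]) (use X_int in simp_all)

lemma x_inner_mult_int: "integrable M (\<lambda>\<omega>. inner (x i \<omega>) a * inner (x j \<omega>) b)"
proof (rule integrable_mult_of_squares)
  show "integrable M (\<lambda>\<omega>. (inner (x i \<omega>) a)\<^sup>2)" "integrable M (\<lambda>\<omega>. (inner (x j \<omega>) b)\<^sup>2)"
    by (rule integrable_x[of "\<lambda>h. (inner h a)\<^sup>2" for a]; simp add: X_inner_sq)+
qed simp_all

lemma x_inner_uncorrelated:
  assumes "i \<noteq> j"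
  shows "expectation (\<lambda>\<omega>. inner (x i \<omega>) a * inner (x j \<omega>) a) = 0"
proof -
  have "indep_vars (\<lambda>_. borel) (\<lambda>i \<omega>. inner (x i \<omega>) a) {i, j}"
    by (rule indep_vars_compose2[OF indep_vars_subset[OF x_indep]]) simp_all
  from indep_vars_lebesgue_integral[OF _ this] assms show ?thesis
    by (simp add: x_inner_int integral_x[of "\<lambda>h. inner h a"] X_inner_mean)
qed

lemma average_inner_mult_tendsto:
  "AE \<omega> in M. (\<lambda>n. (\<Sum>i<n. inner (x i \<omega>) a * inner (x i \<omega>) b) / real n)
    \<longlonglongrightarrow> expectation (\<lambda>\<omega>. inner (X \<omega>) a * inner (X \<omega>) b)"
proof (rule iid_strong_law)
  show "indep_vars (\<lambda>_. borel) (\<lambda>i \<omega>. inner (x i \<omega>) a * inner (x i \<omega>) b) UNIV"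
    by (rule indep_vars_compose2[OF x_indep]) simp
  show "distr M borel (\<lambda>\<omega>. inner (x i \<omega>) a * inner (x i \<omega>) b)
      = distr M borel (\<lambda>\<omega>. inner (X \<omega>) a * inner (X \<omega>) b)" for i
    by (rule distr_x[of "\<lambda>h. inner h a * inner h b"]) simp
qed (rule X_inner_mult_int)

text \<open>The errors may depend on each other arbitrarily; it is the independence and centring of the
  regressors that makes the products uncorrelated.\<close>

lemma average_inner_noise_tendsto:
  "AE \<omega> in M. (\<lambda>n. (\<Sum>i<n. inner (x i \<omega>) a * \<epsilon> i \<omega>) / real n) \<longlonglongrightarrow> 0"
proof (rule rajchman_law)
  \<comment> \<open>Independence of the regressors and the errors splits each mixed moment of fourth
    order into two of second order, and also supplies its integrability.\<close>
  have prod: "integrable M (\<lambda>\<omega>. (inner (x i \<omega>) a * inner (x j \<omega>) a) * (\<epsilon> i \<omega> * \<epsilon> j \<omega>))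
    \<and> expectation (\<lambda>\<omega>. (inner (x i \<omega>) a * inner (x j \<omega>) a) * (\<epsilon> i \<omega> * \<epsilon> j \<omega>))
      = expectation (\<lambda>\<omega>. inner (x i \<omega>) a * inner (x j \<omega>) a) * expectation (\<lambda>\<omega>. \<epsilon> i \<omega> * \<epsilon> j \<omega>)" for i j
  proof -
    have "indep_var borel (\<lambda>\<omega>. inner (x i \<omega>) a * inner (x j \<omega>) a) borel (\<lambda>\<omega>. \<epsilon> i \<omega> * \<epsilon> j \<omega>)"
      using x_meas_algebra[measurable] eps_meas_algebra[measurable]
      by (intro indep_var_of_indep_subalgebras[OF x_algebra eps_algebra x_eps_indep]) measurable
    from indep_var_integrable[OF this x_inner_mult_int eps_mult_int]
      indep_var_lebesgue_integral[OF this x_inner_mult_int eps_mult_int]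
    show ?thesis by simp
  qed
  have eq: "(\<lambda>\<omega>. (inner (x i \<omega>) a * \<epsilon> i \<omega>) * (inner (x j \<omega>) a * \<epsilon> j \<omega>))
      = (\<lambda>\<omega>. (inner (x i \<omega>) a * inner (x j \<omega>) a) * (\<epsilon> i \<omega> * \<epsilon> j \<omega>))" for i j
    by (simp add: mult_ac)
  show "integrable M (\<lambda>\<omega>. (inner (x i \<omega>) a * \<epsilon> i \<omega>)\<^sup>2)" for i
    unfolding power2_eq_square eq using prod by blast
  show "expectation (\<lambda>\<omega>. (inner (x i \<omega>) a * \<epsilon> i \<omega>)\<^sup>2)
      \<le> expectation (\<lambda>\<omega>. (inner (X \<omega>) a)\<^sup>2) * \<sigma>\<^sup>2" for i
    using prod[of i i] eps_second_moment[of i] integral_x[of "\<lambda>h. (inner h a)\<^sup>2" i]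
    unfolding power2_eq_square eq by simp
  show "expectation (\<lambda>\<omega>. (inner (x i \<omega>) a * \<epsilon> i \<omega>) * (inner (x j \<omega>) a * \<epsilon> j \<omega>)) = 0"
    if "i \<noteq> j" for i j
    unfolding eq using prod[of i j] x_inner_uncorrelated[OF that] by simp
qed simp

context
  fixes F :: "'w measure"
  assumes F: "subalgebra (family_algebra M UNIV x) F"
begin

lemma F_algebra: "subalgebra M F"
  using F x_algebra[of UNIV] by (auto simp: subalgebra_def)

text \<open>Conditioning will be on the first \<open>n\<close> regressors only, whereas independence
  is assumed for the whole family; it passes to the smaller sigma-algebra \<open>F\<close>.\<close>

lemma real_cond_exp_eps:
  assumes h: "h \<in> borel_measurable (family_algebra M UNIV \<epsilon>)" "integrable M h"
  shows "AE \<omega> in M. real_cond_exp M F h \<omega> = expectation h"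
proof (rule real_cond_exp_indep[OF F_algebra eps_algebra _ h])
  show "indep_set (sets F) (sets (family_algebra M UNIV \<epsilon>))"
    using x_eps_indep F unfolding indep_sets2_eq subalgebra_def by blast
qed

lemma real_cond_exp_noise_combination:
  assumes I: "finite I" and a: "\<And>i. i \<in> I \<Longrightarrow> a i \<in> borel_measurable F"
    and h: "\<And>i. i \<in> I \<Longrightarrow> h i \<in> borel_measurable (family_algebra M UNIV \<epsilon>)"
      "\<And>i. i \<in> I \<Longrightarrow> integrable M (h i)"
  shows "AE \<omega> in M. real_cond_exp M F (\<lambda>\<omega>. \<Sum>i\<in>I. a i \<omega> * h i \<omega>) \<omega> = (\<Sum>i\<in>I. a i \<omega> * expectation (h i))"
proof -
  interpret finite_measure_subalgebra M F
    using F_algebra by unfold_locales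
  \<comment> \<open>Extension by 0 outside \<open>I\<close>, since
    \<open>real_cond_exp_lincomb\<close> asks for measurable coefficients and integrable factors at
    every index.\<close>
  let ?a = "\<lambda>i. if i \<in> I then a i else (\<lambda>_. 0)" and ?h = "\<lambda>i. if i \<in> I then h i else (\<lambda>_. 0)"
  have "AE \<omega> in M. real_cond_exp M F (\<lambda>\<omega>. \<Sum>i\<in>I. ?a i \<omega> * ?h i \<omega>) \<omega>
      = (\<Sum>i\<in>I. ?a i \<omega> * real_cond_exp M F (?h i) \<omega>)"
    by (rule real_cond_exp_lincomb[OF I]) (use a h in auto)
  moreover have "AE \<omega> in M. \<forall>i\<in>I. real_cond_exp M F (h i) \<omega> = expectation (h i)"
    using I by (intro AE_finite_allI real_cond_exp_eps h)
  ultimately show ?thesis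
    by eventually_elim simp
qed

lemma real_cond_exp_affine_noise:
  assumes g: "g \<in> borel_measurable F" and a: "\<And>i. i < n \<Longrightarrow> a i \<in> borel_measurable F"
  shows "AE \<omega> in M. real_cond_exp M F (\<lambda>\<omega>. g \<omega> + (\<Sum>i<n. a i \<omega> * \<epsilon> i \<omega>)) \<omega> = g \<omega>"
proof -
  \<comment> \<open>The term \<open>g\<close> becomes one more summand, at index \<open>n\<close>
    with the constant factor 1. Splitting it off by additivity would require it to be
    integrable.\<close>
  let ?a = "\<lambda>i. if i < n then a i else g" and ?h = "\<lambda>i. if i < n then \<epsilon> i else (\<lambda>_. 1)"
  have "AE \<omega> in M. real_cond_exp M F (\<lambda>\<omega>. \<Sum>i\<in>{..<Suc n}. ?a i \<omega> * ?h i \<omega>) \<omega>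
      = (\<Sum>i\<in>{..<Suc n}. ?a i \<omega> * expectation (?h i))"
    by (rule real_cond_exp_noise_combination) (use g a eps_int eps_meas_algebra in auto)
  then show ?thesis
    by (simp add: eps_mean prob_space add.commute cong: if_cong)
qed

text \<open>Expanded over pairs, the product is a combination of the variables
  \<open>\<epsilon> i * \<epsilon> j\<close> with coefficients measurable in \<open>F\<close>; of
  their expectations only the diagonal ones survive.\<close>

lemma real_cond_exp_quadratic_noise:
  assumes a: "\<And>i. i < n \<Longrightarrow> a i \<in> borel_measurable F" and b: "\<And>i. i < n \<Longrightarrow> b i \<in> borel_measurable F"
    and uncorr: "\<And>i j. i < n \<Longrightarrow> j < n \<Longrightarrow> i \<noteq> j \<Longrightarrow> expectation (\<lambda>\<omega>. \<epsilon> i \<omega> * \<epsilon> j \<omega>) = 0"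
  shows "AE \<omega> in M. real_cond_exp M F (\<lambda>\<omega>. (\<Sum>i<n. a i \<omega> * \<epsilon> i \<omega>) * (\<Sum>i<n. b i \<omega> * \<epsilon> i \<omega>)) \<omega>
    = \<sigma>\<^sup>2 * (\<Sum>i<n. a i \<omega> * b i \<omega>)"
proof -
  let ?I = "{..<n} \<times> {..<n}"
  let ?a = "\<lambda>p \<omega>. a (fst p) \<omega> * b (snd p) \<omega>" and ?h = "\<lambda>p \<omega>. \<epsilon> (fst p) \<omega> * \<epsilon> (snd p) \<omega>"
  have "AE \<omega> in M. real_cond_exp M F (\<lambda>\<omega>. \<Sum>p\<in>?I. ?a p \<omega> * ?h p \<omega>) \<omega>
      = (\<Sum>p\<in>?I. ?a p \<omega> * expectation (?h p))"
    by (rule real_cond_exp_noise_combination)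
      (use a b in \<open>auto intro!: borel_measurable_times eps_meas_algebra eps_mult_int\<close>)
  moreover have "(\<Sum>p\<in>?I. ?a p \<omega> * ?h p \<omega>) = (\<Sum>i<n. a i \<omega> * \<epsilon> i \<omega>) * (\<Sum>i<n. b i \<omega> * \<epsilon> i \<omega>)" for \<omega>
    by (simp add: sum_product sum.cartesian_product case_prod_beta mult_ac)
  moreover have "(\<Sum>p\<in>?I. ?a p \<omega> * expectation (?h p)) = \<sigma>\<^sup>2 * (\<Sum>i<n. a i \<omega> * b i \<omega>)" for \<omega>
  proof -
    have "(\<Sum>p\<in>?I. ?a p \<omega> * expectation (?h p))
        = (\<Sum>i<n. \<Sum>j<n. a i \<omega> * b j \<omega> * expectation (\<lambda>\<omega>. \<epsilon> i \<omega> * \<epsilon> j \<omega>))"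
      by (simp add: sum.cartesian_product case_prod_beta)
    also have "\<dots> = (\<Sum>i<n. \<Sum>j<n. if j = i then a i \<omega> * b i \<omega> * \<sigma>\<^sup>2 else 0)"
      using uncorr eps_second_moment by (intro sum.cong refl) (auto simp: power2_eq_square)
    also have "\<dots> = \<sigma>\<^sup>2 * (\<Sum>i<n. a i \<omega> * b i \<omega>)"
      by (simp add: sum_distrib_left mult_ac)
    finally show ?thesis .
  qed
  ultimately show ?thesis
    by simp
qed

end

end

lemma (in finite_measure) AE_in_support_space:
  assumes "X \<in> borel_measurable M"
  shows "AE \<omega> in M. X \<omega> \<in> support_space M X"
  using AE_in_rv_support[OF assms] rv_support_subset_support_space by (auto elim: AE_mp)

text \<open>The orthogonal complement of \<open>e\<close> is a closed subspace carrying
  \<open>X\<close>, so it contains the support and therefore the closed subspace generated by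
  it.\<close>

lemma support_space_subset_of_AE_orthogonal:
  fixes X :: "'w \<Rightarrow> L2"
  assumes "X \<in> borel_measurable M" and "AE \<omega> in M. inner (X \<omega>) e = 0"
  shows "support_space M X \<subseteq> {h. inner h e = 0}"
  unfolding support_space_def
proof (rule hull_minimal)
  have closed: "closed {h. inner h e = 0}"
    by (intro closed_Collect_eq continuous_intros)
  then show "subspace {h. inner h e = 0} \<and> closed {h. inner h e = 0}"
    by (simp add: subspace_def inner_add_left)
  show "rv_support M X \<subseteq> {h. inner h e = 0}"
    using rv_support_subset_closed[OF assms(1) closed] assms(2) by simp
qed

subsection \<open>The least squares estimator in \<open>E\<close>\<close>

text \<open>The covariance formula is stated for errors that are pairwise uncorrelated up to
  \<open>n\<close>, as their mixed moments would otherwise contribute to it. Minimality is stated as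
  an equivalence, so that it also expresses uniqueness of the minimiser.\<close>

theorem mainTheorem1:
  fixes M :: "'w measure" and T :: "real set" and X :: "'w \<Rightarrow> L2" and x :: "nat \<Rightarrow> 'w \<Rightarrow> L2"
    and \<epsilon> y :: "nat \<Rightarrow> 'w \<Rightarrow> real" and \<sigma> :: real
    and \<beta> \<beta>E \<beta>F \<beta>P :: L2 and S D E F :: "L2 set"
    and d :: nat and \<phi> :: "nat \<Rightarrow> L2" and bE :: "real Matrix.vec"
  assumes "prob_space M" and "compact T" and "\<beta> \<in> L2_on T"
    and "X \<in> borel_measurable M" and "\<And>\<omega>. \<omega> \<in> space M \<Longrightarrow> X \<omega> \<in> L2_on T"
    and "integrable M (\<lambda>\<omega>. (norm (X \<omega>))\<^sup>2)" and "(LINT \<omega>|M. X \<omega>) = 0"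
    and "prob_space.indep_vars M (\<lambda>_. borel) x UNIV"
    and "\<And>i. distr M borel (x i) = distr M borel X"
    and "\<And>i. \<epsilon> i \<in> borel_measurable M"
    and "prob_space.indep_set M (sets (family_algebra M UNIV x)) (sets (family_algebra M UNIV \<epsilon>))"
    and "\<And>i. integrable M (\<lambda>\<omega>. (\<epsilon> i \<omega>)\<^sup>2)"
    and "\<And>i. prob_space.expectation M (\<epsilon> i) = 0"
    and "\<And>i. prob_space.variance M (\<epsilon> i) = \<sigma>\<^sup>2" and "\<sigma>\<^sup>2 > 0"
    and "\<And>i \<omega>. \<omega> \<in> space M \<Longrightarrow> y i \<omega> = inner (x i \<omega>) \<beta> + \<epsilon> i \<omega>"
    and "S = support_space M X"
    and "D \<subseteq> L2_on T" and "subspace D" and "identifiable T S D"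
    and "\<exists>B. finite B \<and> span B = D" and "dim D = d"
    and "E = orth_proj S ` D" and "F = S \<inter> orthogonal_comp E"
    and "\<beta>E \<in> E" and "\<beta>F \<in> F" and "\<beta>P \<in> orth_compl_on T S" and "\<beta> = \<beta>E + \<beta>F + \<beta>P"
    and "orthonormal_basis \<phi> d E"
    and "bE \<in> carrier_vec d" and "\<beta>E = lin_comb \<phi> bE"
  shows
    "let XE = (\<lambda>n \<omega>. design_matrix \<phi> d (\<lambda>i. x i \<omega>) n);
         bhat = (\<lambda>n \<omega>. ls_coords (XE n \<omega>) (Matrix.vec n (\<lambda>i. y i \<omega>)));
         \<beta>hat = (\<lambda>n \<omega>. ls_estimator E (\<lambda>i. x i \<omega>) (\<lambda>i. y i \<omega>) n);
         \<gamma>n = (\<lambda>n \<omega>. ls_coords (XE n \<omega>) (Matrix.vec n (\<lambda>i. inner (x i \<omega>) \<beta>F)));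
         secmom = mat d d (\<lambda>(j, k). LINT \<omega>|M. inner (X \<omega>) (\<phi> j) * inner (X \<omega>) (\<phi> k));
         \<gamma> = mat_inv secmom *\<^sub>v
               Matrix.vec d (\<lambda>j. LINT \<omega>|M. inner (X \<omega>) (\<phi> j) * inner (X \<omega>) \<beta>F)
     in
       (\<forall>n. \<forall>\<omega>\<in>space M. invertible_mat (gram (XE n \<omega>)) \<longrightarrow>
          (\<forall>b. is_arg_min (rss (\<lambda>i. x i \<omega>) (\<lambda>i. y i \<omega>) n) (\<lambda>b. b \<in> E) b \<longleftrightarrow>
               b = lin_comb \<phi> (bhat n \<omega>)))
     \<and> (\<forall>n. AE \<omega> in M. invertible_mat (gram (XE n \<omega>)) \<longrightarrow>
          cond_exp_vec M (family_algebra M {..<n} x) d (bhat n) \<omega> = bE + \<gamma>n n \<omega>)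
     \<and> (\<forall>n. (\<forall>i<n. \<forall>j<n. i \<noteq> j \<longrightarrow> prob_space.expectation M (\<lambda>\<omega>. \<epsilon> i \<omega> * \<epsilon> j \<omega>) = 0) \<longrightarrow>
          (AE \<omega> in M. invertible_mat (gram (XE n \<omega>)) \<longrightarrow>
             cond_cov_mat M (family_algebra M {..<n} x) d (bhat n) \<omega> = \<sigma>\<^sup>2 \<cdot>\<^sub>m mat_inv (gram (XE n \<omega>))))
     \<and> (AE \<omega> in M. \<forall>\<^sub>F n in sequentially. invertible_mat (gram (XE n \<omega>)))
     \<and> invertible_mat secmom
     \<and> (AE \<omega> in M. \<forall>k<d. (\<lambda>n. vec_index (\<gamma>n n \<omega>) k) \<longlonglongrightarrow> vec_index \<gamma> k)
     \<and> (AE \<omega> in M. \<forall>k<d. (\<lambda>n. vec_index (bhat n \<omega>) k) \<longlonglongrightarrow> vec_index (bE + \<gamma>) k)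
     \<and> (AE \<omega> in M. (\<lambda>n. \<beta>hat n \<omega>) \<longlonglongrightarrow> \<beta>E + lin_comb \<phi> \<gamma>)"
proof -
  interpret prob_space M by fact
  interpret centred_sample M X x \<epsilon> \<sigma>
    by unfold_locales (use assms(4-14) in auto)
  define A where "A n \<omega> = design_matrix \<phi> d (\<lambda>i. x i \<omega>) n" for n \<omega>
  have A: "A n \<omega> \<in> carrier_mat n d" for n \<omega>
    unfolding A_def by (rule design_matrix_carrier)
  have index_A: "i < n \<Longrightarrow> j < d \<Longrightarrow> A n \<omega> $$ (i, j) = inner (x i \<omega>) (\<phi> j)" for n \<omega> i j
    unfolding A_def by (rule index_design_matrix)
  define bhat where "bhat n \<omega> = ls_coords (A n \<omega>) (Matrix.vec n (\<lambda>i. y i \<omega>))" for n \<omega>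
  define \<gamma>n where "\<gamma>n n \<omega> = ls_coords (A n \<omega>) (Matrix.vec n (\<lambda>i. inner (x i \<omega>) \<beta>F))" for n \<omega>
  define Q where "Q = Matrix.mat d d (\<lambda>(j, k). LINT \<omega>|M. inner (X \<omega>) (\<phi> j) * inner (X \<omega>) (\<phi> k))"
  define r where "r = Matrix.vec d (\<lambda>j. LINT \<omega>|M. inner (X \<omega>) (\<phi> j) * inner (X \<omega>) \<beta>F)"
  have Q: "Q \<in> carrier_mat d d" and r: "r \<in> carrier_vec d"
    by (simp_all add: Q_def r_def)
  have bhat: "bhat n \<omega> \<in> carrier_vec d" and \<gamma>n: "\<gamma>n n \<omega> \<in> carrier_vec d" for n \<omega>
    unfolding bhat_def \<gamma>n_def by (intro ls_coords_carrier[OF A])+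
  have bE: "bE \<in> carrier_vec d" by fact
  have y: "y i \<omega> = inner (x i \<omega>) \<beta> + \<epsilon> i \<omega>" if "\<omega> \<in> space M" for i \<omega>
    by (rule assms(16)[OF that])

  \<comment> \<open>The support space and the subspace \<open>E\<close>\<close>
  have S: "subspace S" "closed S"
    unfolding \<open>S = support_space M X\<close> by (rule subspace_support_space closed_support_space)+
  have E_sub: "E \<subseteq> S"
    unfolding \<open>E = orth_proj S ` D\<close> using orth_proj_in[OF S] by blast
  have E_span: "E = span (\<phi> ` {..<d})"
    and ortho: "\<And>j k. j < d \<Longrightarrow> k < d \<Longrightarrow> inner (\<phi> j) (\<phi> k) = (if j = k then 1 else 0)"
    using \<open>orthonormal_basis \<phi> d E\<close> by (auto simp: orthonormal_basis_def)
  \<comment> \<open>\<open>S\<close> is closed, hence Borel, so the probability of lying in it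
    depends on the law alone and carries over from \<open>X\<close>.\<close>
  have "AE \<omega> in M. x i \<omega> \<in> S" for i
    using AE_x_iff[of "\<lambda>h. h \<in> S" i] AE_in_support_space[OF X_meas] S(2)
    unfolding \<open>S = support_space M X\<close> by (simp add: pred_def)
  then have AE_S: "AE \<omega> in M. \<forall>i. x i \<omega> \<in> S"
    by (simp add: AE_all_countable)

  \<comment> \<open>Invertibility of the second moment matrix\<close>
  have det_Q: "Determinant.det Q \<noteq> 0"
  proof
    assume "Determinant.det Q = 0"
    then obtain v where v: "v \<in> carrier_vec d" "v \<noteq> 0\<^sub>v d" "Q *\<^sub>v v = 0\<^sub>v d"
      using det_0_iff_vec_prod_zero[OF Q] by blast
    define e where "e = lin_comb \<phi> v"
    have Xe: "inner (X \<omega>) e = (\<Sum>j<d. vec_index v j * inner (X \<omega>) (\<phi> j))" for \<omega>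
      using v(1) by (simp add: e_def lin_comb_def inner_sum_right)
    \<comment> \<open>The quadratic form of \<open>Q\<close> at \<open>v\<close> is the second
      moment of the component of \<open>X\<close> along \<open>e\<close>.\<close>
    have "(LINT \<omega>|M. (inner (X \<omega>) e)\<^sup>2)
        = (LINT \<omega>|M. (\<Sum>j<d. \<Sum>k<d. vec_index v j * (vec_index v k * (inner (X \<omega>) (\<phi> j) * inner (X \<omega>) (\<phi> k)))))"
      by (simp add: Xe power2_eq_square sum_product mult_ac)
    also have "\<dots> = (\<Sum>j<d. \<Sum>k<d. vec_index v j * (vec_index v k * (LINT \<omega>|M. inner (X \<omega>) (\<phi> j) * inner (X \<omega>) (\<phi> k))))"
      by (simp add: X_inner_mult_int)
    also have "\<dots> = (\<Sum>j<d. vec_index v j * vec_index (Q *\<^sub>v v) j)"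
      by (simp add: index_mult_mat_vec_sum[OF Q v(1)] sum_distrib_left mult_ac)
        (simp add: Q_def mult_ac)
    also have "\<dots> = 0"
      by (simp add: v(3))
    finally have "AE \<omega> in M. (inner (X \<omega>) e)\<^sup>2 = 0"
      using integral_nonneg_eq_0_iff_AE[OF X_inner_sq] by simp
    then have "AE \<omega> in M. inner (X \<omega>) e = 0"
      by simp
    then have "S \<subseteq> {h. inner h e = 0}"
      unfolding \<open>S = support_space M X\<close> by (rule support_space_subset_of_AE_orthogonal[OF X_meas])
    moreover have "e \<in> S"
      using E_sub v(1) unfolding E_span span_eq_lin_combs e_def by blast
    ultimately have "e = 0"
      by auto
    \<comment> \<open>Orthonormality recovers the coordinates of \<open>v\<close> from
      \<open>e\<close>.\<close>
    have "vec_index v k = 0" if "k < d" for k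
    proof -
      have "inner e (\<phi> k) = (\<Sum>j<d. if j = k then vec_index v j else 0)"
        unfolding e_def lin_comb_def inner_sum_left using v(1) that by (intro sum.cong) (auto simp: ortho)
      then show ?thesis
        using \<open>e = 0\<close> that by simp
    qed
    then show False
      using v(1,2) by (auto intro: eq_vecI)
  qed

  \<comment> \<open>Signal, noise and the conditional moments\<close>
  define W where "W n \<omega> = ls_weights (A n \<omega>)" for n \<omega>
  \<comment> \<open>The splitting into \<open>G\<close> and \<open>N\<close> holds for singular
    designs as well. The conditional moments can thus be computed on the whole space, and
    invertibility enters only when \<open>G\<close> and the products of weights are
    identified.\<close>
  define G where "G n k \<omega> = (\<Sum>i<n. W n \<omega> $$ (k, i) * inner (x i \<omega>) \<beta>)" for n k \<omega>
  define N where "N n k \<omega> = (\<Sum>i<n. W n \<omega> $$ (k, i) * \<epsilon> i \<omega>)" for n k \<omega>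
  \<comment> \<open>The noise is itself a least squares solution, with the errors as response, so
    its limit follows from the same lemma as that of the bias.\<close>
  have N_eq: "N n k \<omega> = vec_index (ls_coords (A n \<omega>) (Matrix.vec n (\<lambda>i. \<epsilon> i \<omega>))) k" if "k < d" for n k \<omega>
    unfolding N_def W_def using index_ls_coords[OF A that] by simp
  have bhat_split: "vec_index (bhat n \<omega>) k = G n k \<omega> + N n k \<omega>" if "\<omega> \<in> space M" "k < d" for n k \<omega>
    unfolding bhat_def G_def N_def W_def index_ls_coords[OF A that(2) vec_carrier] sum.distrib[symmetric]
    by (intro sum.cong) (simp_all add: y[OF that(1)] distrib_left)
  have G_eq: "G n k \<omega> = vec_index (bE + \<gamma>n n \<omega>) k"
    if inv: "invertible_mat (gram (A n \<omega>))" and k: "k < d" and xS: "\<forall>i. x i \<omega> \<in> S" for n k \<omega>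
  proof -
    have "inner (x i \<omega>) \<beta>P = 0" for i
      using xS \<open>\<beta>P \<in> orth_compl_on T S\<close>
      by (auto simp: orth_compl_on_def orthogonal_comp_def real_inner_class.orthogonal_def)
    then have "inner (x i \<omega>) \<beta> = vec_index (A n \<omega> *\<^sub>v bE) i + inner (x i \<omega>) \<beta>F" if "i < n" for i
      using inner_lin_comb[OF bE that, of "\<lambda>i. x i \<omega>" \<phi>] \<open>\<beta> = \<beta>E + \<beta>F + \<beta>P\<close> \<open>\<beta>E = lin_comb \<phi> bE\<close>
      by (simp add: A_def inner_add_right)
    then have "G n k \<omega> = (\<Sum>i<n. W n \<omega> $$ (k, i) * vec_index (A n \<omega> *\<^sub>v bE) i)
        + (\<Sum>i<n. W n \<omega> $$ (k, i) * inner (x i \<omega>) \<beta>F)"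
      unfolding G_def sum.distrib[symmetric] by (intro sum.cong) (simp_all add: distrib_left)
    also have "(\<Sum>i<n. W n \<omega> $$ (k, i) * vec_index (A n \<omega> *\<^sub>v bE) i) = vec_index bE k"
      unfolding W_def using index_ls_coords[OF A k mult_mat_vec_carrier[OF A bE], of n \<omega> \<omega>] ls_coords_mult_mat_vec[OF A inv bE]
      by simp
    also have "(\<Sum>i<n. W n \<omega> $$ (k, i) * inner (x i \<omega>) \<beta>F) = vec_index (\<gamma>n n \<omega>) k"
      unfolding W_def \<gamma>n_def using index_ls_coords[OF A k] by simp
    finally show ?thesis
      using k \<gamma>n[of n \<omega>] by simp
  qed

  have F: "subalgebra (family_algebra M UNIV x) (family_algebra M {..<n} x)" for n
    by (rule subalgebra_family_algebra) (simp_all add: x_meas_algebra)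
  have x_meas_F: "x i \<in> borel_measurable (family_algebra M {..<n} x)" if "i < n" for i n
    by (rule measurable_family_algebra) (use that in simp)
  have A_meas: "(\<lambda>\<omega>. A n \<omega> $$ (i, j)) \<in> borel_measurable (family_algebra M {..<n} x)"
    if "i < n" "j < d" for n i j
    unfolding index_A[OF that] using x_meas_F[OF that(1)] by measurable
  have gram_meas: "(\<lambda>\<omega>. gram (A n \<omega>) $$ (i, j)) \<in> borel_measurable (family_algebra M {..<n} x)"
    if "i < d" "j < d" for n i j
    unfolding index_gram[OF A that]
    by (intro borel_measurable_sum borel_measurable_times A_meas) (use that in auto)
  have W_meas: "(\<lambda>\<omega>. W n \<omega> $$ (k, i)) \<in> borel_measurable (family_algebra M {..<n} x)"
    if "k < d" "i < n" for n k i
    unfolding W_def index_ls_weights[OF A that]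
    by (intro borel_measurable_sum borel_measurable_times A_meas measurable_mat_inv[of _ d]
        gram_carrier[OF A] gram_meas) (use that in auto)
  have G_meas: "G n k \<in> borel_measurable (family_algebra M {..<n} x)" if "k < d" for n k
    unfolding G_def[abs_def]
    by (intro borel_measurable_sum borel_measurable_times W_meas borel_measurable_inner
        borel_measurable_const x_meas_F) (use that in auto)
  have N_meas: "N n k \<in> borel_measurable M" if "k < d" for n k
    unfolding N_def[abs_def]
    by (intro borel_measurable_sum borel_measurable_times eps_meas
        measurable_from_subalg[OF F_algebra[OF F] W_meas]) (use that in auto)
  have bhat_meas: "(\<lambda>\<omega>. vec_index (bhat n \<omega>) k) \<in> borel_measurable M" if "k < d" for n k
  proof -
    have "(\<lambda>\<omega>. G n k \<omega> + N n k \<omega>) \<in> borel_measurable M"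
      by (intro borel_measurable_add N_meas measurable_from_subalg[OF F_algebra[OF F] G_meas] that)
    then show ?thesis
      using bhat_split[OF _ that] by (subst measurable_cong) auto
  qed
  have sigma_fin: "sigma_finite_subalgebra M (family_algebra M {..<n} x)" for n
  proof -
    interpret finite_measure_subalgebra M "family_algebra M {..<n} x"
      using F_algebra[OF F] by unfold_locales
    show ?thesis
      by (rule sigma_finite_subalgebra_axioms)
  qed
  have cond_exp: "AE \<omega> in M. real_cond_exp M (family_algebra M {..<n} x) (\<lambda>\<omega>. vec_index (bhat n \<omega>) k) \<omega> = G n k \<omega>"
    if k: "k < d" for n k
  proof -
    interpret sigma_finite_subalgebra M "family_algebra M {..<n} x"
      by (rule sigma_fin)
    have "AE \<omega> in M. real_cond_exp M (family_algebra M {..<n} x) (\<lambda>\<omega>. vec_index (bhat n \<omega>) k) \<omega>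
        = real_cond_exp M (family_algebra M {..<n} x) (\<lambda>\<omega>. G n k \<omega> + N n k \<omega>) \<omega>"
      by (intro real_cond_exp_cong AE_I2 bhat_split bhat_meas borel_measurable_add N_meas
          measurable_from_subalg[OF F_algebra[OF F] G_meas] k)
    moreover have "AE \<omega> in M. real_cond_exp M (family_algebra M {..<n} x) (\<lambda>\<omega>. G n k \<omega> + N n k \<omega>) \<omega> = G n k \<omega>"
      unfolding N_def by (intro real_cond_exp_affine_noise[OF F] G_meas W_meas k)
    ultimately show ?thesis
      by eventually_elim simp
  qed
  have cond_exp_all: "AE \<omega> in M. \<forall>k<d. vec_index (cond_exp_vec M (family_algebra M {..<n} x) d (bhat n) \<omega>) k = G n k \<omega>" for n
  proof -
    have "AE \<omega> in M. \<forall>k\<in>{..<d}. real_cond_exp M (family_algebra M {..<n} x) (\<lambda>\<omega>. vec_index (bhat n \<omega>) k) \<omega> = G n k \<omega>"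
      using cond_exp by (intro AE_finite_allI) auto
    then show ?thesis
      by eventually_elim (simp add: cond_exp_vec_def)
  qed

  have part1: "\<forall>n. \<forall>\<omega>\<in>space M. invertible_mat (gram (A n \<omega>)) \<longrightarrow>
      (\<forall>b. is_arg_min (rss (\<lambda>i. x i \<omega>) (\<lambda>i. y i \<omega>) n) (\<lambda>b. b \<in> E) b \<longleftrightarrow> b = lin_comb \<phi> (bhat n \<omega>))"
    unfolding E_span bhat_def A_def using is_arg_min_rss_iff by blast

  have part2: "\<forall>n. AE \<omega> in M. invertible_mat (gram (A n \<omega>)) \<longrightarrow>
      cond_exp_vec M (family_algebra M {..<n} x) d (bhat n) \<omega> = bE + \<gamma>n n \<omega>"
  proof
    fix n
    show "AE \<omega> in M. invertible_mat (gram (A n \<omega>)) \<longrightarrow>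
        cond_exp_vec M (family_algebra M {..<n} x) d (bhat n) \<omega> = bE + \<gamma>n n \<omega>"
      using cond_exp_all[of n] AE_S
    proof eventually_elim
      case (elim \<omega>)
      show ?case
      proof (intro impI eq_vecI)
        show "dim_vec (cond_exp_vec M (family_algebra M {..<n} x) d (bhat n) \<omega>) = dim_vec (bE + \<gamma>n n \<omega>)"
          using \<gamma>n[of n \<omega>] by (simp add: cond_exp_vec_def)
        fix k assume "invertible_mat (gram (A n \<omega>))" "k < dim_vec (bE + \<gamma>n n \<omega>)"
        then show "vec_index (cond_exp_vec M (family_algebra M {..<n} x) d (bhat n) \<omega>) k = vec_index (bE + \<gamma>n n \<omega>) k"
          using elim G_eq[of n \<omega> k] \<gamma>n[of n \<omega>] by simp
      qed
    qed
  qed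

  have part3: "\<forall>n. (\<forall>i<n. \<forall>j<n. i \<noteq> j \<longrightarrow> expectation (\<lambda>\<omega>. \<epsilon> i \<omega> * \<epsilon> j \<omega>) = 0) \<longrightarrow>
      (AE \<omega> in M. invertible_mat (gram (A n \<omega>)) \<longrightarrow>
        cond_cov_mat M (family_algebra M {..<n} x) d (bhat n) \<omega> = \<sigma>\<^sup>2 \<cdot>\<^sub>m mat_inv (gram (A n \<omega>)))"
  proof (intro allI impI)
    fix n assume uncorr: "\<forall>i<n. \<forall>j<n. i \<noteq> j \<longrightarrow> expectation (\<lambda>\<omega>. \<epsilon> i \<omega> * \<epsilon> j \<omega>) = 0"
    let ?F = "family_algebra M {..<n} x"
    let ?C = "cond_exp_vec M ?F d (bhat n)"
    interpret sigma_finite_subalgebra M ?F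
      by (rule sigma_fin)
    have C_meas: "(\<lambda>\<omega>. vec_index (?C \<omega>) k) \<in> borel_measurable M" if "k < d" for k
      using that by (simp add: cond_exp_vec_def)
    have "AE \<omega> in M. real_cond_exp M ?F (\<lambda>\<omega>. (vec_index (bhat n \<omega>) j - vec_index (?C \<omega>) j)
          * (vec_index (bhat n \<omega>) k - vec_index (?C \<omega>) k)) \<omega>
        = \<sigma>\<^sup>2 * (\<Sum>i<n. W n \<omega> $$ (j, i) * W n \<omega> $$ (k, i))" if jk: "j < d" "k < d" for j k
    proof -
      \<comment> \<open>Subtracting the conditional mean removes \<open>G\<close> almost everywhere,
        so only products of noise terms remain.\<close>
      have "AE \<omega> in M. (vec_index (bhat n \<omega>) j - vec_index (?C \<omega>) j)
          * (vec_index (bhat n \<omega>) k - vec_index (?C \<omega>) k) = N n j \<omega> * N n k \<omega>"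
        using cond_exp_all[of n] AE_space
        by eventually_elim (simp add: bhat_split jk)
      then have "AE \<omega> in M. real_cond_exp M ?F (\<lambda>\<omega>. (vec_index (bhat n \<omega>) j - vec_index (?C \<omega>) j)
            * (vec_index (bhat n \<omega>) k - vec_index (?C \<omega>) k)) \<omega>
          = real_cond_exp M ?F (\<lambda>\<omega>. N n j \<omega> * N n k \<omega>) \<omega>"
        by (intro real_cond_exp_cong borel_measurable_times borel_measurable_diff bhat_meas C_meas N_meas jk)
      moreover have "AE \<omega> in M. real_cond_exp M ?F (\<lambda>\<omega>. N n j \<omega> * N n k \<omega>) \<omega>
          = \<sigma>\<^sup>2 * (\<Sum>i<n. W n \<omega> $$ (j, i) * W n \<omega> $$ (k, i))"
        unfolding N_def by (intro real_cond_exp_quadratic_noise[OF F] W_meas jk) (use uncorr in auto)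
      ultimately show ?thesis
        by eventually_elim simp
    qed
    then have "AE \<omega> in M. \<forall>j\<in>{..<d}. \<forall>k\<in>{..<d}. real_cond_exp M ?F (\<lambda>\<omega>. (vec_index (bhat n \<omega>) j - vec_index (?C \<omega>) j)
          * (vec_index (bhat n \<omega>) k - vec_index (?C \<omega>) k)) \<omega>
        = \<sigma>\<^sup>2 * (\<Sum>i<n. W n \<omega> $$ (j, i) * W n \<omega> $$ (k, i))"
      by (intro AE_finite_allI) auto
    then show "AE \<omega> in M. invertible_mat (gram (A n \<omega>)) \<longrightarrow>
        cond_cov_mat M ?F d (bhat n) \<omega> = \<sigma>\<^sup>2 \<cdot>\<^sub>m mat_inv (gram (A n \<omega>))"
    proof eventually_elim
      case (elim \<omega>)
      show ?case
      proof (intro impI eq_matI)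
        fix j k
        assume inv: "invertible_mat (gram (A n \<omega>))"
          and "j < dim_row (\<sigma>\<^sup>2 \<cdot>\<^sub>m mat_inv (gram (A n \<omega>)))" "k < dim_col (\<sigma>\<^sup>2 \<cdot>\<^sub>m mat_inv (gram (A n \<omega>)))"
        then have jk: "j < d" "k < d"
          using carrier_matD[OF mat_inv_carrier[OF gram_carrier[OF A]]] by auto
        show "cond_cov_mat M ?F d (bhat n) \<omega> $$ (j, k) = (\<sigma>\<^sup>2 \<cdot>\<^sub>m mat_inv (gram (A n \<omega>))) $$ (j, k)"
          using elim jk sum_ls_weights_mult[OF A inv jk] carrier_matD[OF mat_inv_carrier[OF gram_carrier[OF A]]]
          by (simp add: cond_cov_mat_def W_def)
      qed (use carrier_matD[OF mat_inv_carrier[OF gram_carrier[OF A]]] in \<open>simp_all add: cond_cov_mat_def\<close>)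
    qed
  qed

  \<comment> \<open>Almost sure limits\<close>
  have lim_Q: "AE \<omega> in M. \<forall>j k. (\<lambda>n. (\<Sum>i<n. inner (x i \<omega>) (\<phi> j) * inner (x i \<omega>) (\<phi> k)) / real n)
      \<longlonglongrightarrow> (LINT \<omega>|M. inner (X \<omega>) (\<phi> j) * inner (X \<omega>) (\<phi> k))"
    using average_inner_mult_tendsto by (simp add: AE_all_countable)
  have lim_r: "AE \<omega> in M. \<forall>j. (\<lambda>n. (\<Sum>i<n. inner (x i \<omega>) (\<phi> j) * inner (x i \<omega>) \<beta>F) / real n)
      \<longlonglongrightarrow> (LINT \<omega>|M. inner (X \<omega>) (\<phi> j) * inner (X \<omega>) \<beta>F)"
    using average_inner_mult_tendsto by (simp add: AE_all_countable)
  have lim_noise: "AE \<omega> in M. \<forall>j. (\<lambda>n. (\<Sum>i<n. inner (x i \<omega>) (\<phi> j) * \<epsilon> i \<omega>) / real n) \<longlonglongrightarrow> 0"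
    using average_inner_noise_tendsto by (simp add: AE_all_countable)
  have limits: "AE \<omega> in M. \<omega> \<in> space M \<and> (\<forall>\<^sub>F n in sequentially. invertible_mat (gram (A n \<omega>)))
      \<and> (\<forall>k<d. (\<lambda>n. vec_index (\<gamma>n n \<omega>) k) \<longlonglongrightarrow> vec_index (mat_inv Q *\<^sub>v r) k)
      \<and> (\<forall>k<d. (\<lambda>n. vec_index (bhat n \<omega>) k) \<longlonglongrightarrow> vec_index (bE + mat_inv Q *\<^sub>v r) k)"
    using lim_Q lim_r lim_noise AE_S AE_space
  proof eventually_elim
    case (elim \<omega>)
    have Q_lim: "(\<lambda>n. (\<Sum>i<n. A n \<omega> $$ (i, j) * A n \<omega> $$ (i, k)) / real n) \<longlonglongrightarrow> Q $$ (j, k)"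
      if "j < d" "k < d" for j k
      using elim(1) that by (simp add: index_A Q_def)
    note ls = ls_coords_tendsto[where A = "\<lambda>n. A n \<omega>" and Q = Q, OF A _ Q det_Q _ Q_lim]
    \<comment> \<open>Invertibility does not involve the response, so the zero response with limit 0
      serves.\<close>
    have inv: "\<forall>\<^sub>F n in sequentially. invertible_mat (gram (A n \<omega>))"
      by (rule ls(1)[where v = "\<lambda>n. 0\<^sub>v n" and r = "0\<^sub>v d"]) simp_all
    have \<gamma>_lim: "(\<lambda>n. vec_index (\<gamma>n n \<omega>) k) \<longlonglongrightarrow> vec_index (mat_inv Q *\<^sub>v r) k" if "k < d" for k
      unfolding \<gamma>n_def by (rule ls(2)[OF _ r]) (use elim(2) that in \<open>simp_all add: index_A r_def\<close>)
    have N_lim: "(\<lambda>n. N n k \<omega>) \<longlonglongrightarrow> 0" if "k < d" for k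
    proof -
      \<comment> \<open>With the errors as response the averages have limit 0, so the zero vector
        takes the place of \<open>r\<close>.\<close>
      have "(\<lambda>n. vec_index (ls_coords (A n \<omega>) (Matrix.vec n (\<lambda>i. \<epsilon> i \<omega>))) k) \<longlonglongrightarrow> vec_index (mat_inv Q *\<^sub>v 0\<^sub>v d) k"
        by (rule ls(2)) (use elim(3) that in \<open>simp_all add: index_A\<close>)
      then show ?thesis
        using that by (simp add: N_eq index_mult_mat_vec_sum[OF mat_inv_carrier[OF Q]])
    qed
    have "(\<lambda>n. vec_index (bhat n \<omega>) k) \<longlonglongrightarrow> vec_index (bE + mat_inv Q *\<^sub>v r) k" if k: "k < d" for k
    proof (rule Lim_transform_eventually)
      have "(\<lambda>n. vec_index bE k + vec_index (\<gamma>n n \<omega>) k + N n k \<omega>)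
          \<longlonglongrightarrow> vec_index bE k + vec_index (mat_inv Q *\<^sub>v r) k + 0"
        using k by (intro tendsto_intros \<gamma>_lim N_lim)
      then show "(\<lambda>n. vec_index bE k + vec_index (\<gamma>n n \<omega>) k + N n k \<omega>)
          \<longlonglongrightarrow> vec_index (bE + mat_inv Q *\<^sub>v r) k"
        using k carrier_matD(1)[OF mat_inv_carrier[OF Q]] by simp
      show "\<forall>\<^sub>F n in sequentially. vec_index bE k + vec_index (\<gamma>n n \<omega>) k + N n k \<omega> = vec_index (bhat n \<omega>) k"
        using inv
      proof eventually_elim
        fix n assume "invertible_mat (gram (A n \<omega>))"
        then show "vec_index bE k + vec_index (\<gamma>n n \<omega>) k + N n k \<omega> = vec_index (bhat n \<omega>) k"
          using bhat_split[OF elim(5) k, of n] G_eq[OF _ k elim(4), of n] carrier_vecD[OF \<gamma>n[of n \<omega>]] k by simp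
      qed
    qed
    then show ?case
      using elim(5) inv \<gamma>_lim by blast
  qed
  have part8: "AE \<omega> in M. (\<lambda>n. ls_estimator E (\<lambda>i. x i \<omega>) (\<lambda>i. y i \<omega>) n) \<longlonglongrightarrow> \<beta>E + lin_comb \<phi> (mat_inv Q *\<^sub>v r)"
    using limits
  proof eventually_elim
    case (elim \<omega>)
    have dim: "dim_vec (mat_inv Q *\<^sub>v r) = d"
      using carrier_matD(1)[OF mat_inv_carrier[OF Q]] by simp
    show ?case
    proof (rule Lim_transform_eventually)
      have "(\<lambda>n. \<Sum>k<d. vec_index (bhat n \<omega>) k *\<^sub>R \<phi> k) \<longlonglongrightarrow> (\<Sum>k<d. vec_index (bE + mat_inv Q *\<^sub>v r) k *\<^sub>R \<phi> k)"
        using elim by (intro tendsto_intros) auto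
      also have "(\<Sum>k<d. vec_index (bE + mat_inv Q *\<^sub>v r) k *\<^sub>R \<phi> k) = \<beta>E + lin_comb \<phi> (mat_inv Q *\<^sub>v r)"
        using bE dim by (simp add: \<open>\<beta>E = lin_comb \<phi> bE\<close> lin_comb_def scaleR_add_left sum.distrib)
      finally show "(\<lambda>n. \<Sum>k<d. vec_index (bhat n \<omega>) k *\<^sub>R \<phi> k) \<longlonglongrightarrow> \<beta>E + lin_comb \<phi> (mat_inv Q *\<^sub>v r)" .
      have "\<forall>\<^sub>F n in sequentially. invertible_mat (gram (A n \<omega>))"
        using elim by blast
      then show "\<forall>\<^sub>F n in sequentially. (\<Sum>k<d. vec_index (bhat n \<omega>) k *\<^sub>R \<phi> k)
          = ls_estimator E (\<lambda>i. x i \<omega>) (\<lambda>i. y i \<omega>) n"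
      proof eventually_elim
        fix n assume "invertible_mat (gram (A n \<omega>))"
        then have "is_arg_min (rss (\<lambda>i. x i \<omega>) (\<lambda>i. y i \<omega>) n) (\<lambda>b. b \<in> E) b \<longleftrightarrow> b = lin_comb \<phi> (bhat n \<omega>)" for b
          using part1 elim by blast
        \<comment> \<open>Since the minimiser is unique, the choice operator behind
          \<open>ls_estimator\<close> has to return it.\<close>
        then have "ls_estimator E (\<lambda>i. x i \<omega>) (\<lambda>i. y i \<omega>) n = lin_comb \<phi> (bhat n \<omega>)"
          by (simp add: ls_estimator_def arg_min_on_def arg_min_def)
        then show "(\<Sum>k<d. vec_index (bhat n \<omega>) k *\<^sub>R \<phi> k) = ls_estimator E (\<lambda>i. x i \<omega>) (\<lambda>i. y i \<omega>) n"
          using carrier_vecD[OF bhat[of n \<omega>]] by (simp add: lin_comb_def)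
      qed
    qed
  qed
  have "invertible_mat Q"
    using det_Q invertible_mat_iff_det[OF Q] by simp
  moreover have "AE \<omega> in M. \<forall>\<^sub>F n in sequentially. invertible_mat (gram (A n \<omega>))"
    "AE \<omega> in M. \<forall>k<d. (\<lambda>n. vec_index (\<gamma>n n \<omega>) k) \<longlonglongrightarrow> vec_index (mat_inv Q *\<^sub>v r) k"
    "AE \<omega> in M. \<forall>k<d. (\<lambda>n. vec_index (bhat n \<omega>) k) \<longlonglongrightarrow> vec_index (bE + mat_inv Q *\<^sub>v r) k"
    using limits by (eventually_elim, blast)+
  ultimately show ?thesis
    unfolding Let_def
    using part1 part2 part3 part8
    unfolding A_def[abs_def] bhat_def[abs_def] \<gamma>n_def[abs_def] Q_def r_def
    by (intro conjI)
qed

end
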